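(* There is an algorithm which, given a chordal graph $G$ with $n$ vertices and $m$ edges and a comparison oracle for a perfect elimination ordering $\pi$ of $G$, outputs $\pi$ in time $\mathcal{O}(n+m+\log|\mathcal{P}_G|)$ and with $\mathcal{O}(\log|\mathcal{P}_G|)$ comparisons, where $\mathcal{P}_G$ is the set of all perfect elimination orderings of $G$.
   Context: Model: word RAM; graphs are finite, undirected, and given by adjacency lists; a comparison oracle for a permutation $\pi$ of $V(G)$ answers queries "does $u$ precede $v$ in $\pi$?" in constant time, each query being one comparison. Logarithms are base 2 and constants in $\mathcal{O}(\cdot)$ are absolute. A graph is chordal if it has no induced cycle of length four or more. A vertex is simplicial in a graph if its neighborhood forms a clique. A perfect elimination ordering of $G$ is an ordering $v_1v_2\dots v_n$ of $V(G)$ such that, for each $i$, the vertex $v_i$ is simplicial in $G-\{v_1,\dots,v_{i-1}\}$. *)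

theory Defs
  imports Complex_Main
begin

type_synonym 'a graph = "'a set \<times> 'a set set"

abbreviation verts :: "'a graph \<Rightarrow> 'a set" where "verts \<equiv> fst"
abbreviation edges :: "'a graph \<Rightarrow> 'a set set" where "edges \<equiv> snd"

definition fin_graph :: "'a graph \<Rightarrow> bool" where
  "fin_graph G \<longleftrightarrow> finite (verts G) \<and> (\<forall>e\<in>edges G. e \<subseteq> verts G \<and> card e = 2)"

definition neighborhood :: "'a graph \<Rightarrow> 'a \<Rightarrow> 'a set" where
  "neighborhood G v = {u. {u, v} \<in> edges G}"

definition clique :: "'a graph \<Rightarrow> 'a set \<Rightarrow> bool" where
  "clique G K \<longleftrightarrow> K \<subseteq> verts G \<and> (\<forall>u\<in>K. \<forall>v\<in>K. u \<noteq> v \<longrightarrow> {u, v} \<in> edges G)"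

definition induced_cycle :: "'a graph \<Rightarrow> 'a list \<Rightarrow> bool" where
  "induced_cycle G cs \<longleftrightarrow> 3 \<le> length cs \<and> distinct cs \<and> set cs \<subseteq> verts G \<and>
     (\<forall>i j. i < j \<and> j < length cs \<longrightarrow>
        ({cs ! i, cs ! j} \<in> edges G \<longleftrightarrow> j = Suc i \<or> (i = 0 \<and> j = length cs - 1)))"

definition chordal :: "'a graph \<Rightarrow> bool" where
  "chordal G \<longleftrightarrow> \<not> (\<exists>cs. induced_cycle G cs \<and> 4 \<le> length cs)"

definition simplicial :: "'a graph \<Rightarrow> 'a \<Rightarrow> bool" where
  "simplicial G v \<longleftrightarrow> v \<in> verts G \<and> clique G (neighborhood G v)"

definition del_verts :: "'a graph \<Rightarrow> 'a set \<Rightarrow> 'a graph" where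
  "del_verts G S = (verts G - S, {e \<in> edges G. e \<inter> S = {}})"

definition peo :: "'a graph \<Rightarrow> 'a list \<Rightarrow> bool" where
  "peo G vs \<longleftrightarrow> distinct vs \<and> set vs = verts G \<and>
     (\<forall>i < length vs. simplicial (del_verts G (set (take i vs))) (vs ! i))"

definition precedes :: "'a list \<Rightarrow> 'a \<Rightarrow> 'a \<Rightarrow> bool" where
  "precedes vs u v \<longleftrightarrow> (\<exists>i j. i < j \<and> j < length vs \<and> vs ! i = u \<and> vs ! j = v)"

text \<open>
  A program is a fixed finite list of instructions, so it can name only finitely many registers
  and constants. Registers and memory cells hold words, that is, numbers below \<open>2 ^ w\<close>, and
  arithmetic is modulo \<open>2 ^ w\<close>; in particular only the cells below \<open>2 ^ w\<close> can be addressed.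
  Every instruction takes one time step. The permutation is accessible only through \<open>Query\<close>.
\<close>

datatype alu = Add | Sub | Mul | Div | Mod | And | Or | Xor | Shl | Shr

fun alu_val :: "nat \<Rightarrow> alu \<Rightarrow> nat \<Rightarrow> nat \<Rightarrow> nat" where
  "alu_val w Add a b = a + b"
| "alu_val w Sub a b = 2 ^ w + a - b"
| "alu_val w Mul a b = a * b"
| "alu_val w Div a b = a div b"
| "alu_val w Mod a b = a mod b"
| "alu_val w And a b = and a b"
| "alu_val w Or a b = or a b"
| "alu_val w Xor a b = xor a b"
| "alu_val w Shl a b = push_bit b a"
| "alu_val w Shr a b = drop_bit b a"

datatype instr =
    Const nat nat         \<comment> \<open>register, constant\<close>
  | Arith alu nat nat nat \<comment> \<open>operation, target register, operand registers\<close>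
  | Load nat nat          \<comment> \<open>target register, register holding the address\<close>
  | Store nat nat         \<comment> \<open>register holding the address, source register\<close>
  | Jump nat
  | JumpEq nat nat nat    \<comment> \<open>registers to compare, jump target\<close>
  | JumpLess nat nat nat  \<comment> \<open>registers to compare, jump target\<close>
  | Query nat nat nat     \<comment> \<open>target register, registers holding the two vertices\<close>

type_synonym program = "instr list"

record config =
  pc :: nat
  reg :: "nat \<Rightarrow> nat"
  mem :: "nat \<Rightarrow> nat"
  queries :: nat

definition set_reg :: "nat \<Rightarrow> nat \<Rightarrow> nat \<Rightarrow> config \<Rightarrow> config" where
  "set_reg w r x s = s\<lparr>pc := Suc (pc s), reg := (reg s)(r := take_bit w x)\<rparr>"

fun exec_instr :: "nat \<Rightarrow> (nat \<Rightarrow> nat \<Rightarrow> bool) \<Rightarrow> instr \<Rightarrow> config \<Rightarrow> config" where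
  "exec_instr w before (Const r k) s = set_reg w r k s"
| "exec_instr w before (Arith f r a b) s = set_reg w r (alu_val w f (reg s a) (reg s b)) s"
| "exec_instr w before (Load r a) s = set_reg w r (mem s (reg s a)) s"
| "exec_instr w before (Store a b) s =
     s\<lparr>pc := Suc (pc s), mem := (mem s)(reg s a := reg s b)\<rparr>"
| "exec_instr w before (Jump l) s = s\<lparr>pc := l\<rparr>"
| "exec_instr w before (JumpEq a b l) s =
     s\<lparr>pc := (if reg s a = reg s b then l else Suc (pc s))\<rparr>"
| "exec_instr w before (JumpLess a b l) s =
     s\<lparr>pc := (if reg s a < reg s b then l else Suc (pc s))\<rparr>"
| "exec_instr w before (Query r a b) s =
     (set_reg w r (of_bool (before (reg s a) (reg s b))) s)\<lparr>queries := Suc (queries s)\<rparr>"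

definition halted :: "program \<Rightarrow> config \<Rightarrow> bool" where
  "halted P s \<longleftrightarrow> length P \<le> pc s"

definition step :: "nat \<Rightarrow> (nat \<Rightarrow> nat \<Rightarrow> bool) \<Rightarrow> program \<Rightarrow> config \<Rightarrow> config" where
  "step w before P s = (if halted P s then s else exec_instr w before (P ! pc s) s)"

definition initial :: "nat \<Rightarrow> nat list \<Rightarrow> config" where
  "initial w xs = \<lparr>pc = 0, reg = (\<lambda>_. 0),
     mem = (\<lambda>i. if i < length xs then take_bit w (xs ! i) else 0), queries = 0\<rparr>"

definition run :: "nat \<Rightarrow> (nat \<Rightarrow> nat \<Rightarrow> bool) \<Rightarrow> program \<Rightarrow> nat list \<Rightarrow> nat \<Rightarrow> config" where
  "run w before P xs t = (step w before P ^^ t) (initial w xs)"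

text \<open>An output of \<open>n\<close> words is an array in memory, with register 0 holding its address.\<close>

definition out_words :: "nat \<Rightarrow> config \<Rightarrow> nat list" where
  "out_words n s = map (\<lambda>i. mem s (reg s 0 + i)) [0..<n]"

definition adjacency_lists :: "nat graph \<Rightarrow> nat list list \<Rightarrow> bool" where
  "adjacency_lists G adj \<longleftrightarrow> verts G = {..<length adj} \<and>
     (\<forall>v < length adj. distinct (adj ! v) \<and> set (adj ! v) = neighborhood G v)"

text \<open>
  Cell 0 holds \<open>n\<close>. The adjacency list of \<open>v\<close> occupies the cells from the address stored in
  cell \<open>1 + v\<close> up to, but excluding, the address stored in cell \<open>2 + v\<close>.
\<close>

definition graph_input :: "nat list list \<Rightarrow> nat list" where
  "graph_input adj =
     length adj #
     map (\<lambda>v. length adj + 2 + sum_list (map length (take v adj))) [0..<Suc (length adj)] @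
     concat adj"

end

theory Submission
  imports Defs "HOL-Library.FuncSet" "HOL-Library.Multiset"
begin

text \<open>
  A vertex is simplicial iff no pair of its neighbors is nonadjacent. When a simplicial vertex \<open>v\<close> is
  removed, the number of nonadjacent pairs of neighbors of a neighbor \<open>u\<close> drops by
  \<open>deg u - deg v\<close>, so these numbers can be maintained in time \<open>O(n + m)\<close>. Running the updates
  backwards along a maximum cardinality search, which in a chordal graph inserts only simplicial
  vertices, computes their initial values.

  The algorithm keeps the simplicial vertices of the remaining graph in a heap ordered by \<open>\<pi>\<close> and
  repeatedly removes the minimum. The heap consists of sorted runs that are merged like the digits
  of a binary counter, so removing \<open>v\<close> has amortized cost \<open>O(1 + log (1 + d v))\<close>, where
  \<open>d v\<close> is the number of insertions while \<open>v\<close> is in the heap. Choosing for every \<open>v\<close> any time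
  between its insertion and its removal and sorting by these times gives an elimination ordering,
  and at most \<open>4 ^ n\<close> choices give the same one. Hence the logarithms sum to at most
  \<open>log |P| + 2 n\<close>. Finally, a chordal graph with at least two vertices has two simplicial
  vertices, so \<open>n - 1 \<le> log |P|\<close>.
\<close>

section \<open>Counting elimination orderings\<close>

text \<open>The cost of a removal must depend on the time that the element has spent in the heap,
  not on the size of the heap. Take a path on \<open>n\<close> vertices and about sqrt n isolated
  vertices: log |P| is \<open>O(n)\<close>, but if the order takes the path first, a heap with cost
  logarithmic in its size spends order n log n steps. Hence the levels of the heap are tied to the
  age of their elements. In the counting bound, the lifetimes become intervals
  \<open>{s v..e v}\<close> of insertion counts. One time per interval, chosen freely, respects all
  removals that made a vertex simplicial. Sorting forgets the times, and what is lost is a weakly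
  increasing list of \<open>n\<close> numbers below \<open>n\<close>; this is where
  \<open>4 ^ n\<close> comes from. The query bound has no additive term, so the part linear in
  \<open>n\<close> must be absorbed by log |P|. This fails for \<open>n = 1\<close> only, where no
  query at all is allowed, and the program treats that case separately.\<close>

definition nb :: "'a set set \<Rightarrow> 'a set \<Rightarrow> 'a \<Rightarrow> 'a set" where
  "nb E A u = {x \<in> A. {x, u} \<in> E}"

text \<open>Pairs are ordered, so each nonadjacent pair counts twice. The vertex \<open>u\<close>
  need not lie in \<open>A\<close>, so that the same set serves before and after an insertion of
  \<open>u\<close>.\<close>

definition miss :: "'a set set \<Rightarrow> 'a set \<Rightarrow> 'a \<Rightarrow> ('a \<times> 'a) set" where
  "miss E A u = {(x, y). x \<in> nb E A u \<and> y \<in> nb E A u \<and> x \<noteq> y \<and> {x, y} \<notin> E}"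

text \<open>Perfect elimination orderings of the subgraph induced by \<open>A\<close>, by recursion
  on the list, so that deleting a vertex only shrinks \<open>A\<close> while \<open>E\<close> stays
  fixed. Agreement with \<open>peo\<close> is \<open>peo_iff_elim\<close>.\<close>

fun elim :: "'a set set \<Rightarrow> 'a set \<Rightarrow> 'a list \<Rightarrow> bool" where
  "elim E A [] \<longleftrightarrow> A = {}"
| "elim E A (v # vs) \<longleftrightarrow> v \<in> A \<and> miss E A v = {} \<and> elim E (A - {v}) vs"

lemma miss_mono: "B \<subseteq> A \<Longrightarrow> miss E B v \<subseteq> miss E A v"
  by (auto simp: miss_def nb_def)

lemma finite_nb [simp]: "finite A \<Longrightarrow> finite (nb E A u)"
  by (auto simp: nb_def)

lemma finite_miss [simp]: "finite A \<Longrightarrow> finite (miss E A u)"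
  by (rule finite_subset[of _ "nb E A u \<times> nb E A u"]) (auto simp: miss_def)

lemma elim_iff:
  "elim E A vs \<longleftrightarrow> distinct vs \<and> set vs = A \<and>
     (\<forall>i < length vs. miss E (A - set (take i vs)) (vs ! i) = {})"
proof (induction vs arbitrary: A)
  case Nil
  then show ?case by auto
next
  case (Cons v vs)
  have "(\<forall>i < length (v # vs). miss E (A - set (take i (v # vs))) ((v # vs) ! i) = {}) \<longleftrightarrow>
      miss E A v = {} \<and> (\<forall>i < length vs. miss E (A - {v} - set (take i vs)) (vs ! i) = {})"
    by (auto simp: All_less_Suc2 insert_Diff_if Diff_insert2[symmetric])
  then show ?case using Cons by auto
qed

text \<open>Induced subgraphs inherit the ordering, because a smaller vertex set leaves fewer
  nonadjacent pairs (\<open>miss_mono\<close>).\<close>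

lemma elim_filter:
  "elim E A vs \<Longrightarrow> B \<subseteq> A \<Longrightarrow> elim E B (filter (\<lambda>x. x \<in> B) vs)"
proof (induction vs arbitrary: A B)
  case Nil
  then show ?case by auto
next
  case (Cons v vs)
  show ?case
  proof (cases "v \<in> B")
    case True
    have "elim E (B - {v}) (filter (\<lambda>x. x \<in> B - {v}) vs)"
      using Cons.IH[of "A - {v}" "B - {v}"] Cons.prems by (auto simp del: Diff_iff)
    moreover have "filter (\<lambda>x. x \<in> B - {v}) vs = filter (\<lambda>x. x \<in> B) vs"
      using Cons.prems by (auto intro!: filter_cong simp: elim_iff)
    ultimately show ?thesis
      using True Cons.prems miss_mono[of B A E v] by auto
  next
    case False
    then show ?thesis using Cons by (auto intro!: Cons.IH[of "A - {v}"])
  qed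
qed

lemma miss_nonadj:
  assumes "{a, v} \<notin> E" shows "miss E A a = miss E (A - {v}) a"
  using assms by (auto simp: miss_def nb_def insert_commute)

text \<open>Dirac's theorem, by induction along the ordering. The neighbors of the first vertex
  \<open>v\<close> form a clique, so of two nonadjacent simplicial vertices of the rest at least one
  is nonadjacent to \<open>v\<close>. It stays simplicial when \<open>v\<close> returns, and it
  pairs up with \<open>v\<close>.\<close>

lemma elim_two_simplicial:
  assumes "elim E A vs"
  shows "(\<forall>x\<in>A. \<forall>y\<in>A. x \<noteq> y \<longrightarrow> {x, y} \<in> E) \<or>
    (\<exists>a\<in>A. \<exists>b\<in>A. a \<noteq> b \<and> {a, b} \<notin> E \<and> miss E A a = {} \<and> miss E A b = {})"
  using assms
proof (induction vs arbitrary: A)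
  case Nil
  then show ?case by auto
next
  case (Cons v vs)
  let ?A = "A - {v}"
  have v: "v \<in> A" "miss E A v = {}" using Cons.prems by auto
  have clash: ?case if "a \<in> A" "a \<noteq> v" "{a, v} \<notin> E" "miss E ?A a = {}" for a
  proof -
    have "miss E A a = {}" using that miss_nonadj[of a v E A] by simp
    then show ?thesis using that(1-3) v by blast
  qed
  from Cons have "(\<forall>x\<in>?A. \<forall>y\<in>?A. x \<noteq> y \<longrightarrow> {x, y} \<in> E) \<or>
    (\<exists>a\<in>?A. \<exists>b\<in>?A. a \<noteq> b \<and> {a, b} \<notin> E \<and> miss E ?A a = {} \<and> miss E ?A b = {})" by auto
  then show ?case
  proof
    assume comp: "\<forall>x\<in>?A. \<forall>y\<in>?A. x \<noteq> y \<longrightarrow> {x, y} \<in> E"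
    show ?case
    proof (cases "\<exists>a\<in>?A. {a, v} \<notin> E")
      case True
      then obtain a where "a \<in> ?A" "{a, v} \<notin> E" by auto
      moreover have "miss E ?A a = {}" using comp by (auto simp: miss_def nb_def)
      ultimately show ?thesis using clash by auto
    next
      case False
      then have "x \<noteq> y \<longrightarrow> {x, y} \<in> E" if "x \<in> A" "y \<in> A" for x y
        using that comp by (cases "x = v"; cases "y = v") (auto simp: insert_commute)
      then show ?thesis by auto
    qed
  next
    assume "\<exists>a\<in>?A. \<exists>b\<in>?A. a \<noteq> b \<and> {a, b} \<notin> E \<and> miss E ?A a = {} \<and> miss E ?A b = {}"
    then obtain a b where ab: "a \<in> ?A" "b \<in> ?A" "a \<noteq> b" "{a, b} \<notin> E"
      "miss E ?A a = {}" "miss E ?A b = {}" by auto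
    have "{a, v} \<notin> E \<or> {b, v} \<notin> E"
      using v(2) ab by (auto simp: miss_def nb_def)
    then show ?case using clash ab by auto
  qed
qed

lemma finite_elim: "finite A \<Longrightarrow> finite {vs. elim E A vs}"
  by (rule finite_subset[OF _ finite_subset_distinct[of A]]) (auto simp: elim_iff)

text \<open>Either of two simplicial vertices may come first, and \<open>elim_filter\<close> orders
  what remains. So each vertex but the last doubles the count.\<close>

lemma card_elim_ge:
  assumes "finite A" "elim E A vs"
  shows "2 ^ (card A - 1) \<le> card {vs. elim E A vs}"
  using assms
proof (induction "card A" arbitrary: A vs rule: less_induct)
  case less
  have ne: "card {vs. elim E A vs} \<noteq> 0"
    using finite_elim[OF less.prems(1)] less.prems(2) by auto
  show ?case
  proof (cases "card A \<le> 1")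
    case True
    then have "card A - 1 = 0" by simp
    with ne show ?thesis by simp
  next
    case False
    obtain a b where ab: "a \<in> A" "b \<in> A" "a \<noteq> b" "miss E A a = {}" "miss E A b = {}"
    proof -
      from elim_two_simplicial[OF less.prems(2)] show ?thesis
      proof
        assume c: "\<forall>x\<in>A. \<forall>y\<in>A. x \<noteq> y \<longrightarrow> {x, y} \<in> E"
        from False obtain a b where "a \<in> A" "b \<in> A" "a \<noteq> b"
          by (metis card_le_Suc0_iff_eq less.prems(1) One_nat_def)
        moreover have "miss E A x = {}" for x using c by (auto simp: miss_def nb_def)
        ultimately show ?thesis using that by blast
      qed (use that in blast)
    qed
    let ?S = "\<lambda>x. {vs. elim E (A - {x}) vs}"
    have sub: "2 ^ (card A - 2) \<le> card (?S x)" if "x \<in> A" for x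
    proof -
      have "card (A - {x}) < card A" using that less.prems(1) by (meson card_Diff1_less)
      moreover have "card (A - {x}) - 1 = card A - 2"
        using that less.prems(1) by simp
      ultimately show ?thesis
        using less.hyps[of "A - {x}"] elim_filter[OF less.prems(2), of "A - {x}"] less.prems(1)
        by fastforce
    qed
    have "2 ^ (card A - 1) = 2 ^ (card A - 2) + (2 ^ (card A - 2) :: nat)"
      using False by (simp add: mult_2[symmetric] power_Suc[symmetric] del: power_Suc)
    also have "\<dots> \<le> card (?S a) + card (?S b)" using sub ab by (intro add_mono) auto
    also have "\<dots> = card (Cons a ` ?S a) + card (Cons b ` ?S b)"
      by (simp add: card_image)
    also have "\<dots> = card (Cons a ` ?S a \<union> Cons b ` ?S b)"
      using ab less.prems(1) by (intro card_Un_disjoint[symmetric] finite_imageI finite_elim) auto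
    also have "\<dots> \<le> card {vs. elim E A vs}"
      using ab by (intro card_mono finite_elim less.prems) auto
    finally show ?thesis .
  qed
qed

text \<open>Adding \<open>i\<close> to entry \<open>i\<close> makes a weakly increasing list
  strictly increasing, so it is determined by its set, one of the \<open>2 ^ (2 * n)\<close> subsets
  of \<open>{..<2 * n}\<close>.\<close>

lemma card_sorted_lists_le:
  "card {xs. length xs = n \<and> sorted xs \<and> set xs \<subseteq> {..<n::nat}} \<le> 4 ^ n" (is "card ?S \<le> _")
proof -
  let ?g = "\<lambda>xs. map (\<lambda>i. xs ! i + i) [0..<n]"
  have strict: "sorted_wrt (<) (?g xs)" if "xs \<in> ?S" for xs
    using that by (auto simp: sorted_wrt_iff_nth_less intro!: add_le_less_mono sorted_nth_mono)
  have "inj_on (\<lambda>xs. set (?g xs)) ?S"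
  proof (rule inj_onI)
    fix xs ys assume xs: "xs \<in> ?S" and ys: "ys \<in> ?S" and eq: "set (?g xs) = set (?g ys)"
    have "?g xs = ?g ys"
      using strict[OF xs] strict[OF ys] eq strict_sorted_equal by blast
    then have nth: "?g xs ! i = ?g ys ! i" for i by (rule arg_cong)
    have "xs ! i = ys ! i" if "i < n" for i using nth[of i] that by simp
    then show "xs = ys" using xs ys by (intro nth_equalityI) auto
  qed
  moreover have "(\<lambda>xs. set (?g xs)) ` ?S \<subseteq> Pow {..<2 * n}"
  proof -
    have "xs ! i + i < 2 * n" if "xs \<in> ?S" "i < n" for xs i
    proof -
      have "xs ! i \<in> {..<n}" using that nth_mem[of i xs] by blast
      then show ?thesis using that(2) by simp
    qed
    then show ?thesis by auto
  qed
  ultimately have "card ?S \<le> card (Pow {..<2 * n})"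
    by (intro card_inj_on_le[of "\<lambda>xs. set (?g xs)"]) auto
  then show ?thesis by (simp add: card_Pow power_mult)
qed

text \<open>
  Sorting the vertices by arbitrary times chosen in their intervals gives an elimination ordering,
  and the times are recovered from the ordering and the sorted list of times.
\<close>
lemma prod_intervals_le:
  fixes s e :: "'a \<Rightarrow> nat"
  assumes fin: "finite A"
    and se: "\<And>v. v \<in> A \<Longrightarrow> s v \<le> e v \<and> e v < card A"
    and av: "\<And>v. v \<in> A \<Longrightarrow> miss E (A - {u \<in> A. e u < s v}) v = {}"
  shows "(\<Prod>v\<in>A. Suc (e v - s v)) \<le> card {vs. elim E A vs} * 4 ^ card A"
proof -
  obtain l where l: "set l = A" "distinct l" using finite_distinct_list[OF fin] by auto
  let ?n = "card A"
  let ?T = "PiE A (\<lambda>v. {s v..e v})"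
  let ?L = "{xs. length xs = ?n \<and> sorted xs \<and> set xs \<subseteq> {..<?n}}"
  let ?o = "\<lambda>t. sort_key t l"
  let ?h = "\<lambda>t. (?o t, map t (?o t))"
  have "(\<Prod>v\<in>A. Suc (e v - s v)) = card ?T"
    using fin by (simp add: card_PiE) (intro prod.cong refl, use se in fastforce)
  also have "\<dots> \<le> card ({vs. elim E A vs} \<times> ?L)"
  proof (rule card_inj_on_le[of ?h])
    show "inj_on ?h ?T"
    proof (rule inj_onI)
      fix t t' assume t: "t \<in> ?T" "t' \<in> ?T" and "?h t = ?h t'"
      then have "map t (?o t) = map t' (?o t)" by auto
      then have "t v = t' v" if "v \<in> A" for v using that l by (auto simp: map_eq_conv)
      then show "t = t'" using t by (meson PiE_ext)
    qed
    show "?h ` ?T \<subseteq> {vs. elim E A vs} \<times> ?L"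
    proof
      fix z assume "z \<in> ?h ` ?T"
      then obtain t where z: "z = ?h t" and t: "t \<in> ?T" by auto
      have tv: "s v \<le> t v" "t v \<le> e v" if "v \<in> A" for v using t that by (auto simp: PiE_iff)
      have srt: "sorted (map t (?o t))" by simp
      have len: "length (?o t) = ?n" using l by (metis distinct_card length_sort)
      have "miss E (A - set (take i (?o t))) (?o t ! i) = {}" if i: "i < length (?o t)" for i
      proof -
        \<comment> \<open>By \<open>av\<close>, this vertex is simplicial once all \<open>u\<close>
          with \<open>e u < s ?v\<close> are gone. Every choice of times puts them earlier, since
          \<open>t u <= e u < s ?v <= t ?v\<close>, and the absence of further vertices does no
          harm.\<close>
        let ?v = "?o t ! i"
        have v: "?v \<in> A" using i l by (metis nth_mem set_sort)
        have "{u \<in> A. e u < s ?v} \<subseteq> set (take i (?o t))"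
        proof
          fix u assume u: "u \<in> {u \<in> A. e u < s ?v}"
          then have "u \<in> set (?o t)" using l by auto
          then obtain k where k: "k < length (?o t)" "?o t ! k = u" by (metis in_set_conv_nth)
          have "t u < t ?v" using u tv[of u] tv[OF v] by auto
          have "k < i"
          proof (rule ccontr)
            assume "\<not> k < i"
            then have "map t (?o t) ! i \<le> map t (?o t) ! k"
              using srt k by (intro sorted_nth_mono) auto
            then show False using \<open>t u < t ?v\<close> k i by simp
          qed
          then show "u \<in> set (take i (?o t))" using k by (auto simp: in_set_conv_nth intro!: exI[of _ k])
        qed
        then have "miss E (A - set (take i (?o t))) ?v \<subseteq> miss E (A - {u \<in> A. e u < s ?v}) ?v"
          by (intro miss_mono) auto
        then show ?thesis using av[OF v] by auto
      qed
      moreover have "t v < ?n" if "v \<in> A" for v using tv[OF that] se[OF that] by simp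
      ultimately show "z \<in> {vs. elim E A vs} \<times> ?L"
        using l len srt unfolding z by (auto simp: elim_iff)
    qed
    have "finite ?L" by (rule finite_subset[OF _ finite_lists_length_eq[of "{..<?n}" ?n]]) auto
    then show "finite ({vs. elim E A vs} \<times> ?L)" using finite_elim[OF fin] by blast
  qed
  also have "\<dots> \<le> card {vs. elim E A vs} * 4 ^ ?n"
    using card_sorted_lists_le[of ?n] by (simp add: card_cartesian_product)
  finally show ?thesis .
qed

section \<open>Nonadjacent pairs of neighbors under insertion of a simplicial vertex\<close>

lemma card_nb_le:
  assumes fin: "finite A" and vA: "v \<notin> A" and cl: "miss E A v = {}"
    and u: "u \<in> nb E A v"
  shows "card (nb E A v) \<le> card (nb E (insert v A) u)"
proof -
  have "nb E A v - {u} \<subseteq> nb E A u"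
    using cl u by (auto simp: miss_def nb_def)
  then have "card (nb E A v - {u}) \<le> card (nb E A u)" using fin by (intro card_mono) auto
  moreover have "nb E (insert v A) u = insert v (nb E A u)"
    using u by (auto simp: nb_def insert_commute)
  moreover have "v \<notin> nb E A u" using vA by (auto simp: nb_def)
  ultimately show ?thesis using u fin by (simp add: card_Diff_singleton)
qed

text \<open>The new nonadjacent pairs of \<open>u\<close> join \<open>v\<close> to the neighbors of
  \<open>u\<close> outside the neighborhood of \<open>v\<close>. As \<open>v\<close> is simplicial,
  its neighborhood lies in that of \<open>u\<close> except for \<open>u\<close> itself, so the
  number of these vertices is the difference of the degrees; the factor 2 is for the two
  orientations. By \<open>card_nb_le\<close> the subtraction is not truncated.\<close>

lemma card_miss_insert:
  assumes fin: "finite A" and vA: "v \<notin> A" and irr: "\<And>x. {x} \<notin> E"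
    and cl: "miss E A v = {}" and u: "u \<in> nb E A v"
  shows "card (miss E (insert v A) u) =
    card (miss E A u) + 2 * (card (nb E (insert v A) u) - card (nb E A v))"
proof -
  let ?X = "nb E A u - nb E A v"
  have nbu: "nb E (insert v A) u = insert v (nb E A u)"
    using u by (auto simp: nb_def insert_commute)
  have vn: "v \<notin> nb E A u" using vA by (auto simp: nb_def)
  have sub: "nb E A v - {u} \<subseteq> nb E A u"
    using cl u by (auto simp: miss_def nb_def)
  have un: "u \<notin> nb E A u" using irr by (auto simp: nb_def)
  have "miss E (insert v A) u = miss E A u \<union> ({v} \<times> ?X \<union> ?X \<times> {v})"
    unfolding miss_def nbu using vA by (auto simp: nb_def insert_commute)
  moreover have "miss E A u \<inter> ({v} \<times> ?X \<union> ?X \<times> {v}) = {}"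
    using vn by (auto simp: miss_def)
  moreover have "{v} \<times> ?X \<inter> ?X \<times> {v} = {}" using vn by auto
  ultimately have "card (miss E (insert v A) u) = card (miss E A u) + (card ?X + card ?X)"
    using fin by (simp add: card_Un_disjoint card_cartesian_product)
  moreover have "card ?X = card (nb E (insert v A) u) - card (nb E A v)"
  proof -
    have "?X = nb E A u - (nb E A v - {u})" using un by auto
    then have "card ?X = card (nb E A u) - card (nb E A v - {u})"
      using sub fin by (simp add: card_Diff_subset)
    then show ?thesis using u fin vn nbu by (simp add: card_Diff_singleton) 
       (metis Suc_diff_diff card_gt_0_iff diff_Suc_1 empty_iff finite_nb Suc_pred)
  qed
  ultimately show ?thesis by simp
qed

lemma nb_nonadj: "{u, v} \<notin> E \<Longrightarrow> nb E (insert v A) u = nb E A u"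
  by (auto simp: nb_def insert_commute)

lemma nb_adj: "{u, v} \<in> E \<Longrightarrow> nb E (insert v A) u = insert v (nb E A u)"
  by (auto simp: nb_def insert_commute)


section \<open>Maximum cardinality search inserts simplicial vertices\<close>

definition mcs :: "'a set set \<Rightarrow> 'a set \<Rightarrow> 'a list \<Rightarrow> bool" where
  "mcs E V xs \<longleftrightarrow> (\<forall>i < length xs. \<forall>y \<in> V - set (take (Suc i) xs).
     card (nb E (set (take i xs)) y) \<le> card (nb E (set (take i xs)) (xs ! i)))"

text \<open>The numbers in \<open>ps\<close> are visit positions: a chordless path both of whose
  ends are visited before every inner vertex. A vertex inserted with two nonadjacent earlier
  neighbors is the middle of such a path with three vertices.\<close>

definition ipath :: "(nat \<Rightarrow> nat \<Rightarrow> bool) \<Rightarrow> nat list \<Rightarrow> bool" where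
  "ipath adj ps \<longleftrightarrow> distinct ps \<and> 3 \<le> length ps \<and>
     (\<forall>i j. i < j \<and> j < length ps \<longrightarrow> (adj (ps ! i) (ps ! j) \<longleftrightarrow> j = Suc i)) \<and>
     (\<forall>i. 0 < i \<and> i < length ps - 1 \<longrightarrow> max (hd ps) (last ps) < ps ! i)"

lemma ipath_rev:
  assumes "ipath adj ps" and sym: "\<And>a b. adj a b \<longleftrightarrow> adj b a"
  shows "ipath adj (rev ps)"
  unfolding ipath_def
proof (intro conjI allI impI)
  let ?k = "length ps"
  show "distinct (rev ps)" "3 \<le> length (rev ps)" using assms by (auto simp: ipath_def)
  fix i
  show "adj (rev ps ! i) (rev ps ! j) \<longleftrightarrow> j = Suc i" if "i < j \<and> j < length (rev ps)" for j
  proof -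
    have "adj (ps ! (?k - Suc j)) (ps ! (?k - Suc i)) \<longleftrightarrow> ?k - Suc i = Suc (?k - Suc j)"
    proof -
      have "?k - Suc j < ?k - Suc i" "?k - Suc i < ?k" using that by auto
      moreover have "adj (ps ! a) (ps ! b) \<longleftrightarrow> b = Suc a" if "a < b" "b < ?k" for a b
        using assms(1) that by (simp add: ipath_def)
      ultimately show ?thesis by simp
    qed
    moreover have "?k - Suc i = Suc (?k - Suc j) \<longleftrightarrow> j = Suc i" using that by auto
    ultimately show ?thesis using that sym by (simp add: rev_nth)
  qed
  assume i: "0 < i \<and> i < length (rev ps) - 1"
  then have "max (hd ps) (last ps) < ps ! (?k - Suc i)"
  proof -
    have "0 < ?k - Suc i" "?k - Suc i < ?k - 1" using i by auto
    moreover have "max (hd ps) (last ps) < ps ! a" if "0 < a" "a < ?k - 1" for a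
      using assms(1) that by (simp add: ipath_def)
    ultimately show ?thesis by blast
  qed
  moreover have "hd (rev ps) = last ps" "last (rev ps) = hd ps" by (simp_all add: hd_rev last_rev)
  ultimately show "max (hd (rev ps)) (last (rev ps)) < rev ps ! i"
    using i rev_nth[of i ps] by (simp add: less_diff_conv)
qed

text \<open>Take such a path whose later end \<open>v\<close> is earliest. The vertex
  \<open>p\<close> next to the other end \<open>u\<close> is unvisited when \<open>v\<close> is
  chosen, and it sees \<open>u\<close>, which \<open>v\<close> does not. By maximality
  \<open>v\<close> has an earlier neighbor \<open>x\<close> that \<open>p\<close> does not see.
  Following the path from \<open>u\<close> to the first later vertex adjacent to \<open>x\<close>
  gives a path from \<open>u\<close> to \<open>x\<close> with an earlier later end or, if
  \<open>u\<close> and \<open>x\<close> are adjacent, an induced cycle of length at least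
  four.\<close>

lemma mcs_no_ipath:
  fixes xs :: "'a list"
  assumes ch: "chordal G" and irr: "\<And>x. {x} \<notin> edges G"
    and xs: "distinct xs" "set xs \<subseteq> verts G" and mcs: "mcs (edges G) (verts G) xs"
  defines "adj \<equiv> \<lambda>a b. {xs ! a, xs ! b} \<in> edges G"
  assumes ps: "ipath adj ps" "set ps \<subseteq> {..<length xs}"
  shows False
  using ps
proof (induction "max (hd ps) (last ps)" arbitrary: ps rule: less_induct)
  case less
  have sym: "adj a b \<longleftrightarrow> adj b a" for a b by (simp add: adj_def insert_commute)
  \<comment> \<open>Only the orientation with the later end last is treated; reversing the path
    gives the other one.\<close>
  have claim: False if P: "ipath adj ps" "set ps \<subseteq> {..<length xs}" and lt: "hd ps < last ps"
    and hyp: "\<And>qs. max (hd qs) (last qs) < last ps \<Longrightarrow> ipath adj qs \<Longrightarrow>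
      set qs \<subseteq> {..<length xs} \<Longrightarrow> False" for ps
  proof -
    define k where "k = length ps - 1"
    define u where "u = ps ! 0"
    define v where "v = ps ! k"
    define p where "p = ps ! 1"
    have len: "length ps = Suc k" "2 \<le> k" using P by (auto simp: ipath_def k_def)
    have "ps \<noteq> []" using len by auto
    then have hl: "hd ps = u" "last ps = v"
      using len(1) by (simp_all add: u_def v_def hd_conv_nth last_conv_nth)
    have uv: "u < v" using lt hl by simp
    have dist: "distinct ps" using P by (simp add: ipath_def)
    have ad: "adj (ps ! i) (ps ! j) \<longleftrightarrow> j = Suc i" if "i < j" "j \<le> k" for i j
      using P(1) that len by (auto simp: ipath_def)
    have inner: "v < ps ! i" if "0 < i" "i < k" for i
      using P(1) that len hl uv by (auto simp: ipath_def)
    have bnd: "ps ! i < length xs" if "i \<le> k" for i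
    proof -
      have "ps ! i \<in> set ps" using that len by (intro nth_mem) simp
      then show ?thesis using P(2) by auto
    qed
    have vl: "v < length xs" and pl: "p < length xs" and ul: "u < length xs"
      using bnd[of k] bnd[of 1] bnd[of 0] len by (auto simp: v_def p_def u_def)
    have pv: "v < p" using inner[of 1] len by (auto simp: p_def)
    let ?N = "nb (edges G) (set (take v xs))"
    have "xs ! p \<in> verts G - set (take (Suc v) xs)"
      using xs pl pv by (auto simp: in_set_conv_nth nth_eq_iff_index_eq subset_iff)
    then have le: "card (?N (xs ! p)) \<le> card (?N (xs ! v))"
      using mcs vl by (auto simp: mcs_def)
    have "xs ! u \<in> ?N (xs ! p)"
      using ad[of 0 1] len uv vl by (auto simp: nb_def adj_def u_def p_def in_set_conv_nth intro!: exI[of _ "ps ! 0"])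
    moreover have "xs ! u \<notin> ?N (xs ! v)"
      using ad[of 0 k] len by (auto simp: nb_def adj_def u_def v_def)
    moreover have "finite (?N (xs ! p))" by simp
    ultimately have "\<not> ?N (xs ! v) \<subseteq> ?N (xs ! p)"
      using le by (metis card_seteq)
    then obtain y where y: "y \<in> ?N (xs ! v)" "y \<notin> ?N (xs ! p)" by auto
    then obtain x where x: "x < v" "xs ! x = y"
      using vl by (auto simp: nb_def in_set_conv_nth)
    have xv: "adj x v" "\<not> adj x p"
      using x y by (auto simp: nb_def adj_def)
    \<comment> \<open>The first path vertex after \<open>u\<close> adjacent to \<open>x\<close>;
      position \<open>k\<close> shows that one exists. It is not \<open>p\<close>, so
      \<open>I\<close> is at least 2 and the list \<open>qs\<close> below has at least four
      entries.\<close>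
    define I where "I = (LEAST i. 1 \<le> i \<and> adj x (ps ! i))"
    have ex: "1 \<le> k \<and> adj x (ps ! k)" using len xv by (auto simp: v_def)
    have I: "1 \<le> I" "adj x (ps ! I)" "I \<le> k"
      using LeastI[of "\<lambda>i. 1 \<le> i \<and> adj x (ps ! i)", OF ex]
        Least_le[of "\<lambda>i. 1 \<le> i \<and> adj x (ps ! i)", OF ex] by (auto simp: I_def)
    have nI: "\<not> adj x (ps ! i)" if "1 \<le> i" "i < I" for i
      using not_less_Least[of i "\<lambda>i. 1 \<le> i \<and> adj x (ps ! i)"] that by (auto simp: I_def)
    have I2: "2 \<le> I" using I xv by (cases "I = 1") (auto simp: p_def)
    define qs where "qs = take (Suc I) ps @ [x]"
    have lq: "length qs = I + 2" using I len by (simp add: qs_def)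
    have nq: "qs ! i = (if i \<le> I then ps ! i else x)" if "i < I + 2" for i
      using that I len by (auto simp: qs_def nth_append)
    have xu: "x \<noteq> u" using xv ad[of 0 1] len by (auto simp: u_def p_def)
    have gt: "x < ps ! i" if "1 \<le> i" "i \<le> k" for i
      using inner[of i] that x by (cases "i = k") (auto simp: v_def)
    have xnot: "x \<notin> set (take (Suc I) ps)"
    proof
      assume "x \<in> set (take (Suc I) ps)"
      then obtain i where i: "i \<le> I" "ps ! i = x"
        using I len unfolding in_set_conv_nth by (auto simp: less_Suc_eq_le)
      then show False using xu gt[of i] I by (cases i) (auto simp: u_def)
    qed
    have dq: "distinct qs" using dist xnot by (simp add: qs_def)
    have sq: "set qs \<subseteq> {..<length xs}"
      using P(2) x vl set_take_subset[of "Suc I" ps] by (auto simp: qs_def)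
    have aq: "adj (qs ! i) (qs ! j) \<longleftrightarrow> j = Suc i \<or> (i = 0 \<and> j = I + 1 \<and> adj u x)"
      if "i < j" "j < I + 2" for i j
    proof (cases "j \<le> I")
      case True
      then show ?thesis using that ad[of i j] I by (auto simp: nq)
    next
      case False
      then have j: "j = I + 1" using that(2) by linarith
      consider "i = 0" | "1 \<le> i" "i < I" | "i = I" using \<open>i < j\<close> j by linarith
      then show ?thesis
      proof cases
        case 1 then show ?thesis using j I2 by (auto simp: nq u_def)
      next
        case 2 then show ?thesis using j nI[of i] sym by (auto simp: nq)
      next
        case 3 then show ?thesis using j I I2 sym by (auto simp: nq)
      qed
    qed
    show False
    proof (cases "adj u x")
      case False
      have hlq: "hd qs = u" "last qs = x"
        using len by (auto simp: qs_def u_def hd_append hd_conv_nth take_Suc)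
      have "ipath adj qs"
        unfolding ipath_def
      proof (intro conjI allI impI)
        show "distinct qs" "3 \<le> length qs" using dq lq I2 by auto
        show "adj (qs ! i) (qs ! j) \<longleftrightarrow> j = Suc i" if "i < j \<and> j < length qs" for i j
          using that aq False lq by auto
        fix i assume i: "0 < i \<and> i < length qs - 1"
        have "v \<le> ps ! i" using i inner[of i] I lq by (cases "i = k") (auto simp: v_def)
        then show "max (hd qs) (last qs) < qs ! i"
          using i uv x lq by (simp add: hlq nq)
      qed
      then show False using hyp[of qs] hlq hl uv x sq by auto
    next
      case True
      let ?cs = "map (\<lambda>i. xs ! i) qs"
      have "distinct ?cs" using dq sq xs(1)
        by (auto simp: distinct_map inj_on_def subset_iff nth_eq_iff_index_eq)
      moreover have "set ?cs \<subseteq> verts G" using sq xs(2) by (auto dest: nth_mem)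
      moreover have "{?cs ! i, ?cs ! j} \<in> edges G \<longleftrightarrow> j = Suc i \<or> (i = 0 \<and> j = length ?cs - 1)"
        if "i < j \<and> j < length ?cs" for i j
        using aq[of i j] that True lq by (auto simp: adj_def)
      ultimately have "induced_cycle G ?cs" using lq I2 by (auto simp: induced_cycle_def)
      then show False using ch lq I2 by (auto simp: chordal_def)
    qed
  qed
  have "hd ps \<noteq> last ps"
  proof -
    have "distinct ps" "3 \<le> length ps" using less.prems by (auto simp: ipath_def)
    then show ?thesis by (cases ps) (auto split: if_splits)
  qed
  then consider "hd ps < last ps" | "hd (rev ps) < last (rev ps)"
    by (force simp: hd_rev last_rev)
  then show False
  proof cases
    case 1
    then show False using claim[of ps] less by (auto simp: max_def)
  next
    case 2
    show False
    proof (rule claim[of "rev ps"])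
      show "ipath adj (rev ps)" using ipath_rev less.prems(1) sym by blast
      show "set (rev ps) \<subseteq> {..<length xs}" using less.prems by simp
      show "hd (rev ps) < last (rev ps)" by fact
      show False if "max (hd qs) (last qs) < last (rev ps)" "ipath adj qs"
        "set qs \<subseteq> {..<length xs}" for qs
        using less.hyps[of qs] that by (auto simp: last_rev less_max_iff_disj)
    qed
  qed
qed

lemma mcs_simplicial:
  assumes ch: "chordal G" and irr: "\<And>x. {x} \<notin> edges G"
    and xs: "distinct xs" "set xs \<subseteq> verts G" and mcs: "mcs (edges G) (verts G) xs"
    and i: "i < length xs"
  shows "miss (edges G) (set (take i xs)) (xs ! i) = {}"
proof (rule ccontr)
  assume "miss (edges G) (set (take i xs)) (xs ! i) \<noteq> {}"
  then obtain y z where yz: "y \<in> set (take i xs)" "z \<in> set (take i xs)" "y \<noteq> z"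
    "{y, z} \<notin> edges G" "{y, xs ! i} \<in> edges G" "{z, xs ! i} \<in> edges G"
    by (auto simp: miss_def nb_def)
  obtain a b where ab: "a < i" "b < i" "xs ! a = y" "xs ! b = z"
    using yz i by (auto simp: in_set_conv_nth)
  have "a \<noteq> b" using ab yz by auto
  show False
  proof (rule mcs_no_ipath[OF ch irr xs mcs])
    show "set [a, i, b] \<subseteq> {..<length xs}" using ab i by auto
    have "{xs ! ([a, i, b] ! j), xs ! ([a, i, b] ! k)} \<in> edges G \<longleftrightarrow> k = Suc j"
      if "j < k" "k < 3" for j k
      using that ab yz by (auto simp: less_Suc_eq numeral_3_eq_3 insert_commute)
    then show "ipath (\<lambda>a b. {xs ! a, xs ! b} \<in> edges G) [a, i, b]"
      using ab \<open>a \<noteq> b\<close> by (auto simp: ipath_def)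
  qed
qed

section \<open>A while language for the word RAM\<close>

datatype com =
    Cst nat nat
  | Plus nat nat nat
  | Minus nat nat nat
  | Get nat nat nat  \<comment> \<open>target variable, array, index variable\<close>
  | Put nat nat nat  \<comment> \<open>array, index variable, source variable\<close>
  | Ask nat nat nat
  | Nop
  | Seq com com (infixr ";;" 60)
  | IfEq nat nat com com
  | WhileNeq nat nat com

record state =
  vars :: "nat \<Rightarrow> nat"
  arr :: "nat \<Rightarrow> nat \<Rightarrow> nat"
  asked :: nat
  time :: nat

text \<open>\<open>time\<close> counts machine steps exactly. Array 0 lies at its own addresses and
  needs one instruction; for the others the five instructions of \<open>addr\<close> come
  first.\<close>

definition access_cost :: "nat \<Rightarrow> nat" where
  "access_cost k = (if k = 0 then 1 else 6)"

text \<open>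
  Array 0 consists of the cells below \<open>b\<close>. Cell \<open>i\<close> of array \<open>k \<ge> 1\<close> has the address
  \<open>b + 16 * i + k\<close>, so all arrays are unbounded and disjoint. The side conditions exclude overflow.
\<close>
inductive exec :: "nat \<Rightarrow> nat \<Rightarrow> (nat \<Rightarrow> nat \<Rightarrow> bool) \<Rightarrow> com \<Rightarrow> state \<Rightarrow> state \<Rightarrow> bool"
  for M b before where
  Cst: "k < M \<Longrightarrow>
    exec M b before (Cst r k) s (s\<lparr>vars := (vars s)(r := k), time := Suc (time s)\<rparr>)"
| Plus: "vars s x + vars s y < M \<Longrightarrow>
    exec M b before (Plus r x y) s
      (s\<lparr>vars := (vars s)(r := vars s x + vars s y), time := Suc (time s)\<rparr>)"
| Minus: "vars s y \<le> vars s x \<Longrightarrow>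
    exec M b before (Minus r x y) s
      (s\<lparr>vars := (vars s)(r := vars s x - vars s y), time := Suc (time s)\<rparr>)"
| Get: "k < 16 \<Longrightarrow> (k = 0 \<longrightarrow> vars s x < b) \<Longrightarrow>
    exec M b before (Get r k x) s
      (s\<lparr>vars := (vars s)(r := arr s k (vars s x)), time := time s + access_cost k\<rparr>)"
| Put: "k < 16 \<Longrightarrow> (k = 0 \<longrightarrow> vars s x < b) \<Longrightarrow>
    exec M b before (Put k x y) s
      (s\<lparr>arr := (arr s)(k := (arr s k)(vars s x := vars s y)), time := time s + access_cost k\<rparr>)"
| Ask: "1 < M \<Longrightarrow>
    exec M b before (Ask r x y) s
      (s\<lparr>vars := (vars s)(r := of_bool (before (vars s x) (vars s y))),
         asked := Suc (asked s), time := Suc (time s)\<rparr>)"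
| Nop: "exec M b before Nop s s"
| Seq: "exec M b before c1 s s' \<Longrightarrow> exec M b before c2 s' s'' \<Longrightarrow>
    exec M b before (c1 ;; c2) s s''"
| IfEqT: "vars s x = vars s y \<Longrightarrow>
    exec M b before c1 (s\<lparr>time := time s + 1\<rparr>) s' \<Longrightarrow> exec M b before (IfEq x y c1 c2) s s'"
| IfEqF: "vars s x \<noteq> vars s y \<Longrightarrow>
    exec M b before c2 (s\<lparr>time := time s + 2\<rparr>) s' \<Longrightarrow> exec M b before (IfEq x y c1 c2) s s'"
| WhileF: "vars s x = vars s y \<Longrightarrow>
    exec M b before (WhileNeq x y c) s (s\<lparr>time := time s + 1\<rparr>)"
| WhileT: "vars s x \<noteq> vars s y \<Longrightarrow> exec M b before c (s\<lparr>time := time s + 2\<rparr>) s' \<Longrightarrow>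
    exec M b before (WhileNeq x y c) s' s'' \<Longrightarrow> exec M b before (WhileNeq x y c) s s''"

inductive_cases exec_CstE: "exec M b q (Cst r k) s s'"
inductive_cases exec_PlusE: "exec M b q (Plus r x y) s s'"
inductive_cases exec_MinusE: "exec M b q (Minus r x y) s s'"
inductive_cases exec_GetE: "exec M b q (Get r k x) s s'"
inductive_cases exec_PutE: "exec M b q (Put k x y) s s'"
inductive_cases exec_AskE: "exec M b q (Ask r x y) s s'"
inductive_cases exec_NopE: "exec M b q Nop s s'"
inductive_cases exec_SeqE: "exec M b q (c1 ;; c2) s s'"
inductive_cases exec_IfE: "exec M b q (IfEq x y c1 c2) s s'"

text \<open>The existential makes this total correctness: it asserts a terminating execution that
  reaches \<open>Q\<close> and meets all side conditions against overflow.\<close>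

definition wp :: "nat \<Rightarrow> nat \<Rightarrow> (nat \<Rightarrow> nat \<Rightarrow> bool) \<Rightarrow> com \<Rightarrow> (state \<Rightarrow> bool) \<Rightarrow> state \<Rightarrow> bool" where
  "wp M b q c Q s \<longleftrightarrow> (\<exists>s'. exec M b q c s s' \<and> Q s')"

lemma wp_Cst: "wp M b q (Cst r k) Q s \<longleftrightarrow>
    k < M \<and> Q (s\<lparr>vars := (vars s)(r := k), time := Suc (time s)\<rparr>)"
  unfolding wp_def by (auto elim: exec_CstE intro: exec.Cst)

lemma wp_Plus: "wp M b q (Plus r x y) Q s \<longleftrightarrow> vars s x + vars s y < M \<and>
    Q (s\<lparr>vars := (vars s)(r := vars s x + vars s y), time := Suc (time s)\<rparr>)"
  unfolding wp_def by (auto elim: exec_PlusE intro: exec.Plus)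

lemma wp_Minus: "wp M b q (Minus r x y) Q s \<longleftrightarrow> vars s y \<le> vars s x \<and>
    Q (s\<lparr>vars := (vars s)(r := vars s x - vars s y), time := Suc (time s)\<rparr>)"
  unfolding wp_def by (auto elim: exec_MinusE intro: exec.Minus)

lemma wp_Get: "wp M b q (Get r k x) Q s \<longleftrightarrow> k < 16 \<and> (k = 0 \<longrightarrow> vars s x < b) \<and>
    Q (s\<lparr>vars := (vars s)(r := arr s k (vars s x)), time := time s + access_cost k\<rparr>)"
  unfolding wp_def by (auto elim!: exec_GetE intro!: exec.Get)

lemma wp_Put: "wp M b q (Put k x y) Q s \<longleftrightarrow> k < 16 \<and> (k = 0 \<longrightarrow> vars s x < b) \<and>
    Q (s\<lparr>arr := (arr s)(k := (arr s k)(vars s x := vars s y)), time := time s + access_cost k\<rparr>)"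
  unfolding wp_def by (auto elim!: exec_PutE intro!: exec.Put)

lemma wp_Ask: "wp M b q (Ask r x y) Q s \<longleftrightarrow> 1 < M \<and>
    Q (s\<lparr>vars := (vars s)(r := of_bool (q (vars s x) (vars s y))),
         asked := Suc (asked s), time := Suc (time s)\<rparr>)"
  (is "?L \<longleftrightarrow> ?R")
proof
  assume ?L
  then obtain s' where "exec M b q (Ask r x y) s s'" "Q s'" unfolding wp_def by blast
  then show ?R by (elim exec_AskE) (simp only: simp_thms)
next
  assume ?R
  then show ?L unfolding wp_def using exec.Ask by blast
qed

lemma wp_Nop: "wp M b q Nop Q s \<longleftrightarrow> Q s"
  unfolding wp_def by (auto elim: exec_NopE intro: exec.Nop)

lemma wp_Seq: "wp M b q (c1 ;; c2) Q s \<longleftrightarrow> wp M b q c1 (wp M b q c2 Q) s"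
  unfolding wp_def by (blast elim: exec_SeqE intro: exec.Seq)

lemma wp_IfEq: "wp M b q (IfEq x y c1 c2) Q s \<longleftrightarrow>
    (if vars s x = vars s y then wp M b q c1 Q (s\<lparr>time := time s + 1\<rparr>)
     else wp M b q c2 Q (s\<lparr>time := time s + 2\<rparr>))"
  (is "?L \<longleftrightarrow> ?R")
proof
  assume ?L
  then obtain s' where "exec M b q (IfEq x y c1 c2) s s'" "Q s'" unfolding wp_def by blast
  then show ?R unfolding wp_def by (elim exec_IfE) auto
next
  assume ?R
  then show ?L unfolding wp_def
    using exec.IfEqT[of s x y M b q c1 _ c2] exec.IfEqF[of s x y M b q c2 _ c1]
    by (cases "vars s x = vars s y") (force, force)
qed

lemma exec_time_mono: "exec M b q c s s' \<Longrightarrow> time s \<le> time s'"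
  by (induction rule: exec.induct) auto

lemma wp_mono: "wp M b q c Q s \<Longrightarrow> (\<And>s'. Q s' \<Longrightarrow> R s') \<Longrightarrow> wp M b q c R s"
  unfolding wp_def by blast

text \<open>Termination comes for free: a bound on the running time is part of the invariant.\<close>
lemma wp_While:
  assumes "I s" and time: "\<And>s. I s \<Longrightarrow> time s \<le> B"
    and body: "\<And>s. I s \<Longrightarrow> vars s x \<noteq> vars s y \<Longrightarrow>
      wp M b q c I (s\<lparr>time := time s + 2\<rparr>)"
    and exit: "\<And>s. I s \<Longrightarrow> vars s x = vars s y \<Longrightarrow> Q (s\<lparr>time := time s + 1\<rparr>)"
  shows "wp M b q (WhileNeq x y c) Q s"
  using assms(1)
proof (induction "B - time s" arbitrary: s rule: less_induct)
  case less
  show ?case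
  proof (cases "vars s x = vars s y")
    case True
    then show ?thesis using exit[OF less.prems] unfolding wp_def by (blast intro: exec.WhileF)
  next
    case False
    then obtain s' where s': "exec M b q c (s\<lparr>time := time s + 2\<rparr>) s'" "I s'"
      using body[OF less.prems] unfolding wp_def by blast
    have "time s + 2 \<le> time s'" using exec_time_mono[OF s'(1)] by simp
    then have "B - time s' < B - time s" using time[OF s'(2)] by linarith
    then have "wp M b q (WhileNeq x y c) Q s'" using less.hyps s'(2) by blast
    then show ?thesis using s'(1) False unfolding wp_def by (blast intro: exec.WhileT)
  qed
qed

section \<open>Compilation to the word RAM\<close>

definition addr :: "nat \<Rightarrow> nat \<Rightarrow> instr list" where
  "addr k x = [Const 2 16, Arith Mul 2 2 (x + 3), Arith Add 2 2 1, Const 0 k, Arith Add 2 2 0]"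

text \<open>Registers 0 to 2 are reserved: 0 for constants, 1 for \<open>b\<close>, 2 for addresses;
  variable \<open>r\<close> is register \<open>r + 3\<close>. In \<open>IfEq\<close> the second
  branch comes first, so a true test costs only the jump, a false one the failed test and the jump
  over the other branch, as \<open>exec\<close> charges. Jump targets use lengths of code compiled
  at position 0, which \<open>length_comp\<close> justifies.\<close>

fun comp :: "nat \<Rightarrow> com \<Rightarrow> program" where
  "comp p (Cst r k) = [Const (r + 3) k]"
| "comp p (Plus r x y) = [Arith Add (r + 3) (x + 3) (y + 3)]"
| "comp p (Minus r x y) = [Arith Sub (r + 3) (x + 3) (y + 3)]"
| "comp p (Get r k x) = (if k = 0 then [Load (r + 3) (x + 3)] else addr k x @ [Load (r + 3) 2])"
| "comp p (Put k x y) = (if k = 0 then [Store (x + 3) (y + 3)] else addr k x @ [Store 2 (y + 3)])"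
| "comp p (Ask r x y) = [Query (r + 3) (x + 3) (y + 3)]"
| "comp p Nop = []"
| "comp p (c1 ;; c2) = comp p c1 @ comp (p + length (comp p c1)) c2"
| "comp p (IfEq x y c1 c2) =
    (let k2 = length (comp 0 c2); k1 = length (comp 0 c1)
     in JumpEq (x + 3) (y + 3) (p + k2 + 2) # comp (Suc p) c2 @ Jump (p + k2 + k1 + 2) # comp (p + k2 + 2) c1)"
| "comp p (WhileNeq x y c) =
    JumpEq (x + 3) (y + 3) (p + length (comp 0 c) + 2) # comp (Suc p) c @ [Jump p]"

lemma length_comp: "length (comp p c) = length (comp p' c)"
proof (induction c arbitrary: p p')
  case (Seq c1 c2)
  then show ?case by (metis comp.simps(8) length_append)
next
  case (IfEq x y c1 c2)
  then show ?case by (simp add: Let_def) metis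
qed auto

definition code_at :: "program \<Rightarrow> nat \<Rightarrow> program \<Rightarrow> bool" where
  "code_at P p c \<longleftrightarrow> (\<forall>i < length c. p + i < length P \<and> P ! (p + i) = c ! i)"

lemma code_at_Nil [simp]: "code_at P p []"
  by (simp add: code_at_def)

lemma code_at_Cons [simp]:
  "code_at P p (x # c) \<longleftrightarrow> p < length P \<and> P ! p = x \<and> code_at P (Suc p) c"
  by (auto simp: code_at_def All_less_Suc2)

lemma code_at_append [simp]:
  "code_at P p (c @ d) \<longleftrightarrow> code_at P p c \<and> code_at P (p + length c) d"
  by (induction c arbitrary: p) auto

lemma code_at_middle: "code_at (pre @ c @ post) (length pre) c"
  by (auto simp: code_at_def nth_append)

definition bounded :: "nat \<Rightarrow> state \<Rightarrow> bool" where
  "bounded M s \<longleftrightarrow> (\<forall>r. vars s r < M) \<and> (\<forall>k i. arr s k i < M)"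

text \<open>Indices below \<open>M\<close> suffice, since an index is the value of a variable and
  \<open>bounded\<close> keeps these below \<open>M\<close>. The addresses are then below
  \<open>32 * M\<close>, so none wraps around under the assumption \<open>32 * M <= 2 ^ w\<close> of
  the simulation.\<close>

definition repr :: "nat \<Rightarrow> nat \<Rightarrow> state \<Rightarrow> config \<Rightarrow> bool" where
  "repr M b s cf \<longleftrightarrow> bounded M s \<and> (\<forall>r. reg cf (r + 3) = vars s r) \<and> reg cf 1 = b \<and>
     (\<forall>i<b. mem cf i = arr s 0 i) \<and>
     (\<forall>k i. 1 \<le> k \<and> k < 16 \<and> i < M \<longrightarrow> mem cf (b + 16 * i + k) = arr s k i) \<and>
     queries cf = asked s"

lemma repr_time [simp]: "repr M b (s\<lparr>time := t\<rparr>) cf = repr M b s cf"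
  by (simp add: repr_def bounded_def)

lemma repr_pc [simp]: "repr M b s (cf\<lparr>pc := p\<rparr>) = repr M b s cf"
  by (simp add: repr_def)

lemma repr_set_var:
  assumes "repr M b s cf" "v < M"
  shows "repr M b (s\<lparr>vars := (vars s)(r := v)\<rparr>) (cf\<lparr>reg := (reg cf)(r + 3 := v)\<rparr>)"
  using assms by (auto simp: repr_def bounded_def)

lemma take_bit_less: "x < 2 ^ w \<Longrightarrow> take_bit w (x::nat) = x"
  by (simp add: take_bit_nat_eq_self)

definition reaches :: "nat \<Rightarrow> (nat \<Rightarrow> nat \<Rightarrow> bool) \<Rightarrow> program \<Rightarrow> nat \<Rightarrow> config \<Rightarrow> config \<Rightarrow> bool" where
  "reaches w q P t cf cf' \<longleftrightarrow> (step w q P ^^ t) cf = cf'"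

lemma reaches_0 [simp]: "reaches w q P 0 cf cf' \<longleftrightarrow> cf' = cf"
  by (auto simp: reaches_def)

lemma reaches_trans:
  "reaches w q P t cf cf' \<Longrightarrow> reaches w q P t' cf' cf'' \<Longrightarrow> reaches w q P (t + t') cf cf''"
  unfolding reaches_def by (subst add.commute) (simp add: funpow_add)

lemma reaches_Suc:
  "pc cf < length P \<Longrightarrow>
    reaches w q P (Suc t) cf cf' \<longleftrightarrow> reaches w q P t (exec_instr w q (P ! pc cf) cf) cf'"
  by (simp add: reaches_def funpow_Suc_right step_def halted_def del: funpow.simps)

lemma reaches_addr:
  assumes R: "repr M b s cf" and w: "32 * M \<le> 2 ^ w" and bM: "b \<le> M" and M: "1 \<le> M"
    and k: "k < 16" and code: "code_at P (pc cf) (addr k x)"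
  shows "\<exists>cf'. reaches w q P 5 cf cf' \<and> pc cf' = pc cf + 5 \<and> repr M b s cf' \<and>
    reg cf' 2 = b + 16 * vars s x + k"
proof -
  have x: "vars s x < M" and rx: "reg cf (x + 3) = vars s x" and r1: "reg cf (Suc 0) = b"
    using R by (auto simp: repr_def bounded_def)
  have bits: "take_bit w 16 = (16::nat)" "take_bit w (16 * vars s x) = 16 * vars s x"
    "take_bit w (16 * vars s x + b) = 16 * vars s x + b" "take_bit w k = k"
    "take_bit w (16 * vars s x + b + k) = 16 * vars s x + b + k"
    using x w bM M k by (auto intro!: take_bit_less)
  let ?c1 = "set_reg w 2 16 cf"
  let ?c2 = "set_reg w 2 (16 * vars s x) ?c1"
  let ?c3 = "set_reg w 2 (16 * vars s x + b) ?c2"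
  let ?c4 = "set_reg w 0 k ?c3"
  let ?c5 = "set_reg w 2 (16 * vars s x + b + k) ?c4"
  note regs = set_reg_def bits rx r1
  have c: "P ! pc cf = Const 2 16" "P ! Suc (pc cf) = Arith Mul 2 2 (x + 3)"
    "P ! Suc (Suc (pc cf)) = Arith Add 2 2 1" "P ! Suc (Suc (Suc (pc cf))) = Const 0 k"
    "P ! Suc (Suc (Suc (Suc (pc cf)))) = Arith Add 2 2 0" "Suc (Suc (Suc (Suc (pc cf)))) < length P"
    using code by (simp_all add: addr_def)
  have pc: "pc (set_reg w r v cf) = Suc (pc cf)" for r v cf by (simp add: set_reg_def)
  have one: "reaches w q P (Suc 0) cf' cf''"
    if "pc cf' < length P" "exec_instr w q (P ! pc cf') cf' = cf''" for cf' cf''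
    using that by (simp add: reaches_Suc)
  have "reaches w q P (Suc 0) cf ?c1" by (rule one) (use c in \<open>simp_all\<close>)
  moreover have "reaches w q P (Suc 0) ?c1 ?c2" by (rule one) (use c in \<open>simp_all add: pc\<close>, simp add: regs)
  moreover have "reaches w q P (Suc 0) ?c2 ?c3" by (rule one) (use c in \<open>simp_all add: pc\<close>, simp add: regs)
  moreover have "reaches w q P (Suc 0) ?c3 ?c4" by (rule one) (use c in \<open>simp_all add: pc\<close>)
  moreover have "reaches w q P (Suc 0) ?c4 ?c5" by (rule one) (use c in \<open>simp_all add: pc\<close>, simp add: regs)
  ultimately have "reaches w q P (Suc 0 + Suc 0 + Suc 0 + Suc 0 + Suc 0) cf ?c5"
    by (intro reaches_trans) 
  then have "reaches w q P 5 cf ?c5" by (simp add: eval_nat_numeral)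
  moreover have "repr M b s ?c5"
    using R by (simp add: repr_def set_reg_def)
  moreover have "reg ?c5 2 = b + 16 * vars s x + k" by (simp add: regs)
  ultimately show ?thesis by (intro exI[of _ ?c5]) (simp add: pc)
qed

lemma length_addr [simp]: "length (addr k x) = 5"
  by (simp add: addr_def)

lemma cell_address_inject:
  "k < 16 \<Longrightarrow> k' < 16 \<Longrightarrow> b + 16 * i + k = b + 16 * j + k' \<longleftrightarrow> i = j \<and> k = k'" for b i j k k' :: nat
  by presburger

lemma repr_put:
  assumes R: "repr M b s cf" and "1 \<le> k" "k < 16" "v < M" "i < M"
  shows "repr M b (s\<lparr>arr := (arr s)(k := (arr s k)(i := v))\<rparr>)
    (cf\<lparr>mem := (mem cf)(b + 16 * i + k := v)\<rparr>)"
proof -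
  have "b + 16 * j + k' = b + 16 * i + k \<longleftrightarrow> j = i \<and> k' = k" if "k' < 16" for j k'
    using that assms cell_address_inject by blast
  then show ?thesis using assms by (auto simp: repr_def bounded_def)
qed

lemma repr_put0:
  assumes R: "repr M b s cf" and "v < M" "i < b"
  shows "repr M b (s\<lparr>arr := (arr s)(0 := (arr s 0)(i := v))\<rparr>) (cf\<lparr>mem := (mem cf)(i := v)\<rparr>)"
  using assms by (auto simp: repr_def bounded_def)

text \<open>Simulation by induction on the execution. Machine steps and the increase of
  \<open>time\<close> agree exactly, so bounds proved about \<open>time\<close> carry over to the
  program unchanged.\<close>

lemma comp_correct:
  assumes "exec M b q c s s'" and w: "32 * M \<le> 2 ^ w" and bM: "b \<le> M" and M: "1 \<le> M"
  shows "repr M b s cf \<Longrightarrow> code_at P (pc cf) (comp (pc cf) c) \<Longrightarrow>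
    \<exists>cf' t. reaches w q P t cf cf' \<and> time s' = time s + t \<and>
      pc cf' = pc cf + length (comp (pc cf) c) \<and> repr M b s' cf'"
  using assms(1)
proof (induction arbitrary: cf rule: exec.induct)
  have Mw: "x < M \<Longrightarrow> take_bit w x = x" for x using w by (intro take_bit_less) auto
  have set_var: "\<exists>cf' t. reaches w q P t cf cf' \<and> Suc (time s) = time s + t \<and> pc cf' = Suc (pc cf) \<and>
      repr M b (s\<lparr>vars := (vars s)(r := v), time := Suc (time s)\<rparr>) cf'"
    if "repr M b s cf" "v < M" "pc cf < length P" "exec_instr w q (P ! pc cf) cf = set_reg w (r + 3) v cf"
    for s cf r v
  proof (intro exI conjI)
    show "reaches w q P (Suc 0) cf (set_reg w (r + 3) v cf)" using that by (simp add: reaches_Suc)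
    show "repr M b (s\<lparr>vars := (vars s)(r := v), time := Suc (time s)\<rparr>) (set_reg w (r + 3) v cf)"
      using that Mw repr_set_var[of M b s "cf\<lparr>pc := Suc (pc cf)\<rparr>" v r]
      by (simp add: set_reg_def repr_def bounded_def)
  qed (auto simp: set_reg_def)
  have Rv: "repr M b s cf \<Longrightarrow> reg cf (r + 3) = vars s r \<and> vars s r < M \<and> arr s k i < M"
    for s cf r k i by (simp add: repr_def bounded_def)
  {
    case (Cst k r s)
    show ?case using Cst set_var[of s cf k r] by simp
  next
    case (Plus s x y r)
    show ?case using Plus Rv[OF Plus(2)] set_var[of s cf "vars s x + vars s y" r] by simp
  next
    case (Minus s y x r)
    \<comment> \<open>\<open>Sub\<close> computes \<open>2 ^ w + a - b\<close>. The side condition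
      \<open>b <= a\<close> excludes a borrow, so reduction modulo \<open>2 ^ w\<close> leaves the
      true difference.\<close>
    have "take_bit w (2 ^ w + vars s x - vars s y) = vars s x - vars s y"
      using Minus(1) Rv[OF Minus(2), of x] Mw[of "vars s x - vars s y"]
    proof -
      have "2 ^ w + vars s x - vars s y = 2 ^ w + (vars s x - vars s y)" using Minus(1) by simp
      moreover have "take_bit w (2 ^ w + z) = take_bit w z" for z :: nat
        by (simp add: take_bit_eq_mod)
      ultimately show ?thesis
        using Rv[OF Minus(2), of x] Mw[of "vars s x - vars s y"] by (simp add: less_imp_diff_less)
    qed
    then have "set_reg w (r + 3) (2 ^ w + vars s x - vars s y) cf = set_reg w (r + 3) (vars s x - vars s y) cf"
      using Rv[OF Minus(2), of x] Mw[of "vars s x - vars s y"] by (simp add: set_reg_def less_imp_diff_less)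
    then show ?case using Minus Rv[OF Minus(2)] set_var[of s cf "vars s x - vars s y" r]
      by (simp add: less_imp_diff_less)
  next
    case (Get k s x r)
    show ?case
    proof (cases "k = 0")
      case True
      have "mem cf (vars s x) = arr s 0 (vars s x)" using Get True by (auto simp: repr_def)
      then show ?thesis using Get True Rv[OF Get(3)]
          set_var[of s cf "arr s 0 (vars s x)" r]
        by (simp add: access_cost_def)
    next
      case False
      obtain cf1 where cf1: "reaches w q P 5 cf cf1" "pc cf1 = pc cf + 5" "repr M b s cf1"
        "reg cf1 2 = b + 16 * vars s x + k"
        using reaches_addr[OF Get(3) w bM M Get(1), of P x q] Get False by auto
      have m: "mem cf1 (b + 16 * vars s x + k) = arr s k (vars s x)"
        using cf1(3) Get(1) False Rv[OF cf1(3)] by (auto simp: repr_def)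
      have "\<exists>cf' t. reaches w q P t cf1 cf' \<and> Suc (time s) = time s + t \<and> pc cf' = Suc (pc cf1) \<and>
        repr M b (s\<lparr>vars := (vars s)(r := arr s k (vars s x)), time := Suc (time s)\<rparr>) cf'"
        using Get False Rv[OF cf1(3)] cf1
        by (intro set_var) (auto simp: m)
      then obtain cf' t where more: "reaches w q P t cf1 cf'" "Suc (time s) = time s + t"
        "pc cf' = Suc (pc cf1)"
        "repr M b (s\<lparr>vars := (vars s)(r := arr s k (vars s x)), time := Suc (time s)\<rparr>) cf'" by blast
      from more(1) have "reaches w q P (5 + t) cf cf'" by (rule reaches_trans[OF cf1(1)])
      with more show ?thesis using False cf1(2)
        by (intro exI[of _ cf'] exI[of _ "5 + t"]) (simp add: access_cost_def)
    qed
  next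
    case (Put k s x y)
    show ?case
    proof (cases "k = 0")
      case True
      let ?cf = "cf\<lparr>pc := Suc (pc cf), mem := (mem cf)(vars s x := vars s y)\<rparr>"
      have "reaches w q P (Suc 0) cf ?cf" using Put True Rv[OF Put(3)] by (auto simp: reaches_Suc)
      moreover have "repr M b (s\<lparr>arr := (arr s)(0 := (arr s 0)(vars s x := vars s y))\<rparr>) ?cf"
        using repr_put0[of M b s "cf\<lparr>pc := Suc (pc cf)\<rparr>" "vars s y" "vars s x"] Put True Rv[OF Put(3)] by auto
      ultimately show ?thesis using True
        by (intro exI[of _ ?cf] exI[of _ "Suc 0"]) (simp add: access_cost_def)
    next
      case False
      obtain cf1 where cf1: "reaches w q P 5 cf cf1" "pc cf1 = pc cf + 5" "repr M b s cf1"
        "reg cf1 2 = b + 16 * vars s x + k"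
        using reaches_addr[OF Put(3) w bM M Put(1), of P x q] Put False by auto
      let ?cf = "cf1\<lparr>pc := Suc (pc cf1), mem := (mem cf1)(b + 16 * vars s x + k := vars s y)\<rparr>"
      have one: "reaches w q P (Suc 0) cf1 ?cf"
        using Put False Rv[OF cf1(3)] cf1 by (auto simp: reaches_Suc)
      moreover have "repr M b (s\<lparr>arr := (arr s)(k := (arr s k)(vars s x := vars s y))\<rparr>) ?cf"
        using repr_put[of M b s "cf1\<lparr>pc := Suc (pc cf1)\<rparr>" k "vars s y" "vars s x"] Put False Rv[OF cf1(3)] cf1(3)
        by auto
      moreover from one have "reaches w q P (5 + Suc 0) cf ?cf" by (rule reaches_trans[OF cf1(1)])
      ultimately show ?thesis using False cf1(2)
        by (intro exI[of _ ?cf] exI[of _ "5 + Suc 0"]) (simp add: access_cost_def)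
    qed
  next
    case (Ask r x y s)
    let ?v = "of_bool (q (vars s x) (vars s y)) :: nat"
    let ?cf = "(set_reg w (r + 3) ?v cf)\<lparr>queries := Suc (queries cf)\<rparr>"
    have "?v < M" using Ask(1) by auto
    then have "repr M b (s\<lparr>vars := (vars s)(r := ?v)\<rparr>) (set_reg w (r + 3) ?v cf)"
      using repr_set_var[of M b s "cf\<lparr>pc := Suc (pc cf)\<rparr>" ?v r] Ask Mw[of ?v] by (simp add: set_reg_def)
    then have "repr M b (s\<lparr>vars := (vars s)(r := ?v), asked := Suc (asked s), time := Suc (time s)\<rparr>) ?cf"
      by (simp add: repr_def bounded_def set_reg_def)
    moreover have "reaches w q P (Suc 0) cf ?cf"
      using Ask Rv[OF Ask(2)] by (auto simp: reaches_Suc)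
    ultimately show ?case
      by (intro exI[of _ ?cf] exI[of _ "Suc 0"]) (auto simp: set_reg_def)
  next
    case (Nop s)
    then show ?case by (intro exI[of _ cf] exI[of _ 0]) auto
  next
    case (Seq c1 s s' c2 s'')
    from Seq.IH(1)[OF Seq.prems(1)] Seq.prems(2) obtain cf1 t1 where
      1: "reaches w q P t1 cf cf1" "time s' = time s + t1"
        "pc cf1 = pc cf + length (comp (pc cf) c1)" "repr M b s' cf1" by auto
    from Seq.IH(2)[OF 1(4)] Seq.prems(2) 1(3) obtain cf2 t2 where
      2: "reaches w q P t2 cf1 cf2" "time s'' = time s' + t2"
        "pc cf2 = pc cf1 + length (comp (pc cf1) c2)" "repr M b s'' cf2" by auto
    show ?case using reaches_trans[OF 1(1) 2(1)] 1 2
      by (intro exI[of _ cf2] exI[of _ "t1 + t2"]) (auto simp: algebra_simps)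
  next
    case (IfEqT s x y c1 s' c2)
    let ?k2 = "length (comp 0 c2)"
    let ?cf = "cf\<lparr>pc := pc cf + ?k2 + 2\<rparr>"
    have l2: "0 < p \<Longrightarrow> length (comp p c2) = ?k2" for p by (rule length_comp)
    have l1: "0 < p \<Longrightarrow> length (comp p c1) = length (comp 0 c1)" for p by (rule length_comp)
    have 1: "reaches w q P (Suc 0) cf ?cf"
      using IfEqT.prems IfEqT.hyps(1) Rv[OF IfEqT.prems(1)]
      by (simp add: reaches_Suc Let_def)
    have "\<exists>cf' t. reaches w q P t ?cf cf' \<and> time s' = time (s\<lparr>time := time s + 1\<rparr>) + t \<and>
        pc cf' = pc ?cf + length (comp (pc ?cf) c1) \<and> repr M b s' cf'"
      using IfEqT.prems by (intro IfEqT.IH) (simp_all add: Let_def l2 algebra_simps)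
    then obtain cf' t where 2: "reaches w q P t ?cf cf'" "time s' = time s + 1 + t"
      "pc cf' = pc cf + ?k2 + 2 + length (comp 0 c1)" "repr M b s' cf'" by (auto simp: l1)
    show ?case using reaches_trans[OF 1 2(1)] 2
      by (intro exI[of _ cf'] exI[of _ "Suc 0 + t"]) (simp add: Let_def l1 l2)
  next
    case (IfEqF s x y c2 s' c1)
    let ?k2 = "length (comp 0 c2)"
    let ?cf = "cf\<lparr>pc := Suc (pc cf)\<rparr>"
    have l2: "0 < p \<Longrightarrow> length (comp p c2) = ?k2" for p by (rule length_comp)
    have l1: "0 < p \<Longrightarrow> length (comp p c1) = length (comp 0 c1)" for p by (rule length_comp)
    have 1: "reaches w q P (Suc 0) cf ?cf"
      using IfEqF.prems IfEqF.hyps(1) Rv[OF IfEqF.prems(1)]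
      by (auto simp: reaches_Suc Let_def)
    have "\<exists>cf' t. reaches w q P t ?cf cf' \<and> time s' = time (s\<lparr>time := time s + 2\<rparr>) + t \<and>
        pc cf' = pc ?cf + length (comp (pc ?cf) c2) \<and> repr M b s' cf'"
      using IfEqF.prems by (intro IfEqF.IH) (auto simp: Let_def l2 algebra_simps)
    then obtain cf' t where 2: "reaches w q P t ?cf cf'" "time s' = time s + 2 + t"
      "pc cf' = Suc (pc cf) + ?k2" "repr M b s' cf'" by (auto simp: l2)
    let ?cf' = "cf'\<lparr>pc := pc cf + ?k2 + length (comp 0 c1) + 2\<rparr>"
    have 3: "reaches w q P (Suc 0) cf' ?cf'"
      using IfEqF.prems(2) 2(3) by (simp add: reaches_Suc Let_def l1 l2)
    show ?case using reaches_trans[OF reaches_trans[OF 1 2(1)] 3] 2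
      by (intro exI[of _ ?cf'] exI[of _ "Suc 0 + t + Suc 0"]) (auto simp: Let_def l1 l2)
  next
    case (WhileF s x y c)
    let ?cf = "cf\<lparr>pc := pc cf + length (comp 0 c) + 2\<rparr>"
    have l: "0 < p \<Longrightarrow> length (comp p c) = length (comp 0 c)" for p by (rule length_comp)
    have "reaches w q P (Suc 0) cf ?cf"
      using WhileF.prems WhileF.hyps Rv[OF WhileF.prems(1)]
      by (auto simp: reaches_Suc)
    then show ?case using WhileF.prems
      by (intro exI[of _ ?cf] exI[of _ "Suc 0"]) (auto simp: l)
  next
    case (WhileT s x y c s' s'')
    let ?cf = "cf\<lparr>pc := Suc (pc cf)\<rparr>"
    have l: "0 < p \<Longrightarrow> length (comp p c) = length (comp 0 c)" for p by (rule length_comp)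
    have 1: "reaches w q P (Suc 0) cf ?cf"
      using WhileT.prems WhileT.hyps(1) Rv[OF WhileT.prems(1)]
      by (auto simp: reaches_Suc)
    have "\<exists>cf' t. reaches w q P t ?cf cf' \<and> time s' = time (s\<lparr>time := time s + 2\<rparr>) + t \<and>
        pc cf' = pc ?cf + length (comp (pc ?cf) c) \<and> repr M b s' cf'"
      using WhileT.prems by (intro WhileT.IH) auto
    then obtain cf' t where 2: "reaches w q P t ?cf cf'" "time s' = time s + 2 + t"
      "pc cf' = Suc (pc cf) + length (comp 0 c)" "repr M b s' cf'" by (auto simp: l)
    let ?cf' = "cf'\<lparr>pc := pc cf\<rparr>"
    have 3: "reaches w q P (Suc 0) cf' ?cf'"
      using WhileT.prems(2) 2(3) by (simp add: reaches_Suc l)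
    have "\<exists>cf'' t. reaches w q P t ?cf' cf'' \<and> time s'' = time s' + t \<and>
        pc cf'' = pc ?cf' + length (comp (pc ?cf') (WhileNeq x y c)) \<and> repr M b s'' cf''"
      using WhileT.prems(2) 2(4) by (intro WhileT.IH) auto
    then obtain cf'' t' where 4: "reaches w q P t' ?cf' cf''" "time s'' = time s' + t'"
      "pc cf'' = pc cf + length (comp (pc cf) (WhileNeq x y c))" "repr M b s'' cf''" by auto
    show ?case using reaches_trans[OF reaches_trans[OF reaches_trans[OF 1 2(1)] 3] 4(1)] 2 4
      by (intro exI[of _ cf''] exI[of _ "Suc 0 + t + Suc 0 + t'"]) auto
  }
qed

section \<open>Sorted linked lists\<close>

definition frame :: "nat set \<Rightarrow> nat set \<Rightarrow> state \<Rightarrow> state \<Rightarrow> bool" where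
  "frame V A s s' \<longleftrightarrow> (\<forall>r. r \<notin> V \<longrightarrow> vars s' r = vars s r) \<and> (\<forall>k. k \<notin> A \<longrightarrow> arr s' k = arr s k)"

lemma frame_refl [simp]: "frame V A s s"
  by (simp add: frame_def)

lemma frame_trans:
  "frame V A s s' \<Longrightarrow> frame V' A' s' s'' \<Longrightarrow> V \<subseteq> W \<Longrightarrow> V' \<subseteq> W \<Longrightarrow> A \<subseteq> B \<Longrightarrow> A' \<subseteq> B \<Longrightarrow> frame W B s s''"
  unfolding frame_def by (metis subsetD)

lemma frame_vars: "frame V A s s' \<Longrightarrow> r \<notin> V \<Longrightarrow> vars s' r = vars s r"
  by (simp add: frame_def)

lemma frame_arr: "frame V A s s' \<Longrightarrow> k \<notin> A \<Longrightarrow> arr s' k = arr s k"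
  by (simp add: frame_def)

lemmas wp_simps = wp_Cst wp_Plus wp_Minus wp_Get wp_Put wp_Ask wp_Nop wp_Seq wp_IfEq access_cost_def

fun lseg :: "(nat \<Rightarrow> nat) \<Rightarrow> nat \<Rightarrow> nat list \<Rightarrow> nat \<Rightarrow> bool" where
  "lseg nx p [] q \<longleftrightarrow> p = q"
| "lseg nx p (x # xs) q \<longleftrightarrow> p = x \<and> x \<noteq> 0 \<and> lseg nx (nx x) xs q"

lemma lseg_append: "lseg nx p (xs @ ys) q \<longleftrightarrow> (\<exists>r. lseg nx p xs r \<and> lseg nx r ys q)"
  by (induction xs arbitrary: p) auto

lemma lseg_cong: "\<forall>x\<in>set xs. nx x = nx' x \<Longrightarrow> lseg nx p xs q = lseg nx' p xs q"
  by (induction xs arbitrary: p) auto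

lemma lseg_upd: "a \<notin> set xs \<Longrightarrow> lseg (nx(a := v)) p xs q = lseg nx p xs q"
  by (rule lseg_cong) auto

fun hd0 :: "nat list \<Rightarrow> nat" where
  "hd0 [] = 0"
| "hd0 (x # xs) = x"

lemma lseg_hd0: "lseg nx p xs 0 \<Longrightarrow> p = hd0 xs"
  by (cases xs) auto

fun mrg :: "(nat \<Rightarrow> nat) \<Rightarrow> nat list \<Rightarrow> nat list \<Rightarrow> nat list" where
  "mrg rk [] ys = ys"
| "mrg rk (x # xs) [] = x # xs"
| "mrg rk (x # xs) (y # ys) =
    (if rk x < rk y then x # mrg rk xs (y # ys) else y # mrg rk (x # xs) ys)"

lemma mrg_Nil2 [simp]: "mrg rk xs [] = xs"
  by (cases xs) auto

lemma mset_mrg [simp]: "mset (mrg rk xs ys) = mset xs + mset ys"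
  by (induction rk xs ys rule: mrg.induct) auto

lemma set_mrg [simp]: "set (mrg rk xs ys) = set xs \<union> set ys"
  by (metis mset_mrg set_mset_mset set_mset_union)

lemma sorted_mrg:
  "sorted (map rk xs) \<Longrightarrow> sorted (map rk ys) \<Longrightarrow> sorted (map rk (mrg rk xs ys))"
  by (induction rk xs ys rule: mrg.induct) force+

text \<open>
  Variables 0 and 1 always hold these constants. Array 0 is the input, later the output. For
  vertices, array 1 counts the neighbors, array 2 is half the number of ordered nonadjacent pairs
  of neighbors, and array 3 is a mark. Array 4 contains the heads of the buckets of the search,
  arrays 5 and 6 the vertex and the successor of a bucket entry. Array 7 links the elements of the
  heap, array 8 contains the heads of the runs, array 9 the bits of the counter, and array 10 the
  best element of the levels from \<open>j\<close> on. Array 11 collects the sorted vertices.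
\<close>
definition merge_code :: com where
  "merge_code =
    Cst 33 0 ;;
    WhileNeq 30 0 (
      IfEq 31 0 (Plus 31 30 0 ;; Cst 30 0)
       (Minus 34 30 1 ;; Minus 35 31 1 ;; Ask 36 34 35 ;;
        IfEq 36 1 (Put 7 33 30 ;; Plus 33 30 0 ;; Get 30 7 30)
                  (Put 7 33 31 ;; Plus 33 31 0 ;; Get 31 7 31))) ;;
    Put 7 33 31 ;; Get 32 7 0"

text \<open>Heap elements are pointers, that is, vertices increased by one, with 0 as the null pointer.\<close>
definition ranked :: "nat \<Rightarrow> (nat \<Rightarrow> nat \<Rightarrow> bool) \<Rightarrow> (nat \<Rightarrow> nat) \<Rightarrow> nat set \<Rightarrow> bool" where
  "ranked M before rk U \<longleftrightarrow> U \<subseteq> {1..<M} \<and> (\<forall>x\<in>U. \<forall>y\<in>U. before (x - 1) (y - 1) \<longleftrightarrow> rk x < rk y)"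

definition const_vars :: "state \<Rightarrow> bool" where
  "const_vars s \<longleftrightarrow> vars s 0 = 0 \<and> vars s 1 = 1"

lemma const_vars_frame: "frame V A s s' \<Longrightarrow> 0 \<notin> V \<Longrightarrow> 1 \<notin> V \<Longrightarrow> const_vars s \<Longrightarrow> const_vars s'"
  by (simp add: frame_def const_vars_def)

text \<open>Cell 0 of array 7, which belongs to no element, serves as a dummy head: variable 33
  points to the last output cell and starts at 0, so the first append is no special case. When the
  second list runs out, the first one is moved to its place, so the loop always ends with the
  remainder in variable 31.\<close>

lemma wp_merge:
  assumes x: "lseg (arr s 7) (vars s 30) xs 0" and y: "lseg (arr s 7) (vars s 31) ys 0"
    and d: "distinct (xs @ ys)" and U: "ranked M q rk U" "set xs \<subseteq> U" "set ys \<subseteq> U"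
    and c: "const_vars s" and M: "1 < M"
  shows "wp M b q merge_code (\<lambda>s'. lseg (arr s' 7) (vars s' 32) (mrg rk xs ys) 0 \<and>
      (\<forall>p. p \<notin> insert 0 (set xs \<union> set ys) \<longrightarrow> arr s' 7 p = arr s 7 p) \<and>
      frame {30..36} {7} s s' \<and>
      time s' \<le> time s + 60 * (length xs + length ys) + 60 \<and>
      asked s' \<le> asked s + (length xs + length ys)) s"
    (is "wp M b q merge_code ?Q s")
proof -
  let ?T = "time s + 60 * (length xs + length ys) + 30"
  \<comment> \<open>\<open>ds\<close> is the output so far. Its last cell still holds an old
    pointer, so only the state after writing some \<open>r\<close> there is described. The 20 steps
    for nonempty \<open>xs'\<close> pay for moving the first list when the second is empty.\<close>
  define I where "I = (\<lambda>t. \<exists>ds xs' ys'. mrg rk xs ys = ds @ mrg rk xs' ys' \<and>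
     lseg (arr t 7) (vars t 30) xs' 0 \<and> lseg (arr t 7) (vars t 31) ys' 0 \<and>
     (\<forall>r. lseg ((arr t 7)(vars t 33 := r)) (((arr t 7)(vars t 33 := r)) 0) ds r) \<and>
     distinct (ds @ xs' @ ys') \<and> set (ds @ xs' @ ys') = set xs \<union> set ys \<and>
     vars t 33 \<in> insert 0 (set ds) \<and>
     (\<forall>p. p \<notin> insert 0 (set xs \<union> set ys) \<longrightarrow> arr t 7 p = arr s 7 p) \<and>
     frame {30..36} {7} s t \<and>
     time t + 60 * (length xs' + length ys') + (if xs' = [] then 0 else 20) \<le> ?T \<and>
     asked t + length xs' + length ys' \<le> asked s + length xs + length ys)"
  have Upos: "p \<noteq> 0 \<and> p < M" if "p \<in> U" for p using U that by (auto simp: ranked_def)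
  have zero: "0 \<notin> set xs \<union> set ys" using U Upos by auto
  have c01: "vars t 0 = 0 \<and> vars t (Suc 0) = 1" if "frame {30..36} {7} s t" for t
    using that c by (auto simp: frame_def const_vars_def)
  have init: "I (s\<lparr>vars := (vars s)(33 := 0), time := Suc (time s)\<rparr>)"
    unfolding I_def
    by (rule exI[of _ "[]"], rule exI[of _ xs], rule exI[of _ ys]) (use x y d in \<open>auto simp: frame_def\<close>)
  have body: "wp M b q (IfEq 31 0 (Plus 31 30 0 ;; Cst 30 0)
       (Minus 34 30 1 ;; Minus 35 31 1 ;; Ask 36 34 35 ;;
        IfEq 36 1 (Put 7 33 30 ;; Plus 33 30 0 ;; Get 30 7 30)
                  (Put 7 33 31 ;; Plus 33 31 0 ;; Get 31 7 31))) I (t\<lparr>time := time t + 2\<rparr>)"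
    if "I t" and ne: "vars t 30 \<noteq> vars t 0" for t
  proof -
    from \<open>I t\<close> obtain ds xs' ys' where I: "mrg rk xs ys = ds @ mrg rk xs' ys'"
     "lseg (arr t 7) (vars t 30) xs' 0" "lseg (arr t 7) (vars t 31) ys' 0"
     "\<And>r. lseg ((arr t 7)(vars t 33 := r)) (((arr t 7)(vars t 33 := r)) 0) ds r"
     "distinct (ds @ xs' @ ys')" "set (ds @ xs' @ ys') = set xs \<union> set ys"
     "vars t 33 \<in> insert 0 (set ds)"
     "\<forall>p. p \<notin> insert 0 (set xs \<union> set ys) \<longrightarrow> arr t 7 p = arr s 7 p"
     "frame {30..36} {7} s t"
     "time t + 60 * (length xs' + length ys') + (if xs' = [] then 0 else 20) \<le> ?T"
     "asked t + length xs' + length ys' \<le> asked s + length xs + length ys" unfolding I_def by blast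
    note c0 = c01[OF I(9)]
    obtain x xs'' where xs': "xs' = x # xs''" using I(2) ne c0 by (cases xs') auto
    have x30: "vars t 30 = x" using I(2) xs' by simp
    have xU: "x \<in> U" and ysU: "set ys' \<subseteq> U" using I(6) U xs' by auto
    have t33: "vars t 33 \<notin> set xs' \<union> set ys'" using I(5,6,7) zero by auto
    show ?thesis
    proof (cases ys')
      case Nil
      then have y31: "vars t 31 = 0" using I(3) by simp
      show ?thesis
        using c0 y31 x30 Upos[OF xU] M xs' Nil
        apply (simp add: wp_simps)
        unfolding I_def
        apply (rule exI[of _ ds], rule exI[of _ "[]"], rule exI[of _ xs'])
        using I xs' by (auto simp: frame_def)
    next
      case (Cons y ys'')
      have y31: "vars t 31 = y" using I(3) Cons by simp
      have yU: "y \<in> U" using ysU Cons by simp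
      have bef: "q (x - 1) (y - 1) \<longleftrightarrow> rk x < rk y" using U(1) xU yU by (auto simp: ranked_def)
      have seg: "\<forall>r. lseg ((arr t 7)(vars t 33 := z, z := r)) (((arr t 7)(vars t 33 := z, z := r)) 0) (ds @ [z]) r"
        if "z \<in> set xs' \<union> set ys'" for z
      proof
        fix r
        have z: "z \<notin> set ds" "z \<noteq> 0" "z \<noteq> vars t 33" using that I(5,6) zero t33 by auto
        have "lseg ((arr t 7)(vars t 33 := z, z := r)) (((arr t 7)(vars t 33 := z)) 0) ds z"
          using I(4)[of z] z lseg_upd by blast
        then show "lseg ((arr t 7)(vars t 33 := z, z := r)) (((arr t 7)(vars t 33 := z, z := r)) 0) (ds @ [z]) r"
          using z by (auto simp: lseg_append)
      qed
      show ?thesis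
      proof (cases "rk x < rk y")
        case True
        show ?thesis
          using c0 x30 y31 Upos[OF xU] Upos[OF yU] M bef True t33 xs'
          apply (simp add: wp_simps)
          unfolding I_def
          apply (rule exI[of _ "ds @ [x]"], rule exI[of _ xs''], rule exI[of _ ys'])
          using I xs' Cons t33 True seg[of x] by (auto simp: frame_def lseg_upd)
      next
        case False
        show ?thesis
          using c0 x30 y31 Upos[OF xU] Upos[OF yU] M bef False t33 xs' Cons
          apply (simp add: wp_simps)
          unfolding I_def
          apply (rule exI[of _ "ds @ [y]"], rule exI[of _ xs'], rule exI[of _ ys''])
          using I xs' Cons t33 False seg[of y] by (auto simp: frame_def lseg_upd)
      qed
    qed
  qed
  show ?thesis
    unfolding merge_code_def wp_Seq wp_Cst
  proof (intro conjI)
    show "0 < M" using M by simp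
    show "wp M b q (WhileNeq 30 0 (
      IfEq 31 0 (Plus 31 30 0 ;; Cst 30 0)
       (Minus 34 30 1 ;; Minus 35 31 1 ;; Ask 36 34 35 ;;
        IfEq 36 1 (Put 7 33 30 ;; Plus 33 30 0 ;; Get 30 7 30)
                  (Put 7 33 31 ;; Plus 33 31 0 ;; Get 31 7 31))))
       (wp M b q (Put 7 33 31) (wp M b q (Get 32 7 0) ?Q)) (s\<lparr>vars := (vars s)(33 := 0), time := Suc (time s)\<rparr>)"
    proof (rule wp_While[where I = I and B = ?T])
      show "time t \<le> ?T" if "I t" for t using that unfolding I_def by fastforce
      show "wp M b q (Put 7 33 31) (wp M b q (Get 32 7 0) ?Q) (t\<lparr>time := time t + 1\<rparr>)"
        if "I t" and eq: "vars t 30 = vars t 0" for t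
      proof -
        from \<open>I t\<close> obtain ds xs' ys' where I: "mrg rk xs ys = ds @ mrg rk xs' ys'"
         "lseg (arr t 7) (vars t 30) xs' 0" "lseg (arr t 7) (vars t 31) ys' 0"
         "\<And>r. lseg ((arr t 7)(vars t 33 := r)) (((arr t 7)(vars t 33 := r)) 0) ds r"
         "distinct (ds @ xs' @ ys')" "set (ds @ xs' @ ys') = set xs \<union> set ys"
         "vars t 33 \<in> insert 0 (set ds)"
         "\<forall>p. p \<notin> insert 0 (set xs \<union> set ys) \<longrightarrow> arr t 7 p = arr s 7 p"
         "frame {30..36} {7} s t"
         "time t + 60 * (length xs' + length ys') + (if xs' = [] then 0 else 20) \<le> ?T"
         "asked t + length xs' + length ys' \<le> asked s + length xs + length ys"
          unfolding I_def by blast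
        note c0 = c01[OF I(9)]
        have xs': "xs' = []"
          using I(2,6) eq c0 zero by (cases xs') auto
        have t33: "vars t 33 \<notin> set ys'" using I(5,6,7) zero by auto
        let ?nx = "(arr t 7)(vars t 33 := vars t 31)"
        have "lseg ?nx (?nx 0) (ds @ ys') 0"
          using I(3) I(4)[of "vars t 31"] t33 by (auto simp: lseg_append lseg_upd)
        then show ?thesis
          using I(1) I(6-11) c0 xs' by (simp add: wp_simps) (auto simp: frame_def)
      qed
    qed (use init body in auto)
  qed
qed

section \<open>The heap\<close>

type_synonym heap = "(bool \<times> nat list) list"

text \<open>Levels beyond the end count as empty with an unset bit. This matches arrays that are
  initially zero, so opening a new level takes no extra work.\<close>

definition run_at :: "heap \<Rightarrow> nat \<Rightarrow> nat list" where
  "run_at ls j = (if j < length ls then snd (ls ! j) else [])"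

definition bit_at :: "heap \<Rightarrow> nat \<Rightarrow> bool" where
  "bit_at ls j \<longleftrightarrow> j < length ls \<and> fst (ls ! j)"

definition upd :: "heap \<Rightarrow> nat \<Rightarrow> bool \<times> nat list \<Rightarrow> heap" where
  "upd ls j x = (if j < length ls then ls[j := x] else ls @ [x])"

definition elems :: "heap \<Rightarrow> nat set" where
  "elems ls = set (concat (map snd ls))"

lemma elems_simps [simp]: "elems [] = {}" "elems (l # ls) = set (snd l) \<union> elems ls"
  by (auto simp: elems_def)

lemma elems_append [simp]: "elems (ls @ ls') = elems ls \<union> elems ls'"
  by (auto simp: elems_def)

lemma run_at_Cons: "run_at (l # ls) j = (case j of 0 \<Rightarrow> snd l | Suc i \<Rightarrow> run_at ls i)"
  by (auto simp: run_at_def split: nat.split)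

lemma set_run_at: "set (run_at ls j) \<subseteq> elems ls"
  by (force simp: run_at_def elems_def in_set_conv_nth)

lemma run_at_upd: "j \<le> length ls \<Longrightarrow> run_at (upd ls j x) i = (if i = j then snd x else run_at ls i)"
  by (auto simp: run_at_def upd_def nth_append nth_list_update)

lemma bit_at_upd: "j \<le> length ls \<Longrightarrow> bit_at (upd ls j x) i = (if i = j then fst x else bit_at ls i)"
  by (auto simp: bit_at_def upd_def nth_append nth_list_update)

lemma run_at_disjoint:
  "distinct (concat (map snd ls)) \<Longrightarrow> i \<noteq> j \<Longrightarrow> set (run_at ls i) \<inter> set (run_at ls j) = {}"
proof (induction ls arbitrary: i j)
  case Nil
  then show ?case by (simp add: run_at_def)
next
  case (Cons l ls)
  have d: "set (snd l) \<inter> elems ls = {}" "distinct (concat (map snd ls))"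
    using Cons.prems by (auto simp: elems_def)
  have "set (snd l) \<inter> set (run_at ls k) = {}" for k using d(1) set_run_at[of ls k] by blast
  then show ?case using Cons.IH[OF d(2)] Cons.prems(2)
    by (cases i; cases j) (auto simp: run_at_Cons)
qed

text \<open>A binary counter that postpones merging. A carry passes through a set level by
  exchanging runs: \<open>c\<close> stays there with the bit cleared, and the old run moves up.
  Hence an unset level may hold a run, and an insertion merges only once, at the first unset level;
  the carries merely exchange pointers.\<close>

fun tick :: "(nat \<Rightarrow> nat) \<Rightarrow> nat list \<Rightarrow> heap \<Rightarrow> heap" where
  "tick rk c [] = [(True, c)]"
| "tick rk c ((False, R) # ls) = (True, mrg rk c R) # ls"
| "tick rk c ((True, R) # ls) = (False, c) # tick rk R ls"

fun merge_cost :: "nat list \<Rightarrow> heap \<Rightarrow> nat" where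
  "merge_cost c [] = length c"
| "merge_cost c ((False, R) # ls) = length c + length R"
| "merge_cost c ((True, R) # ls) = merge_cost R ls"

fun carries :: "heap \<Rightarrow> nat" where
  "carries [] = 0"
| "carries ((False, R) # ls) = 0"
| "carries ((True, R) # ls) = Suc (carries ls)"

text \<open>
  While an element stays in level \<open>j\<close>, it takes part in one merge, which happens when
  the bit of that level becomes set. Hence this potential pays exactly for all merges.
\<close>
fun potential :: "nat \<Rightarrow> heap \<Rightarrow> nat" where
  "potential j [] = 0"
| "potential j ((b, R) # ls) = (j + of_bool b) * length R + potential (Suc j) ls"

definition ones :: "heap \<Rightarrow> nat" where
  "ones ls = length (filter fst ls)"

lemma mset_tick [simp]:
  "mset (concat (map snd (tick rk c ls))) = mset c + mset (concat (map snd ls))"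
  by (induction rk c ls rule: tick.induct) auto

lemma elems_tick [simp]: "elems (tick rk c ls) = set c \<union> elems ls"
  by (induction rk c ls rule: tick.induct) auto

lemma distinct_tick [simp]:
  "distinct (concat (map snd (tick rk c ls))) \<longleftrightarrow> distinct (c @ concat (map snd ls))"
  by (rule mset_eq_imp_distinct_iff) simp

lemma length_mrg [simp]: "length (mrg rk xs ys) = length xs + length ys"
  by (metis mset_mrg size_mset size_union)

text \<open>A run leaving a set level \<open>j\<close> has weight \<open>j + 1\<close> per element,
  the weight with which it arrives at level \<open>j + 1\<close>. So carries are neutral, and the
  final merge raises the weight of each participant by one.\<close>

lemma potential_tick:
  "potential j (tick rk c ls) = potential j ls + j * length c + merge_cost c ls"
  by (induction rk c ls arbitrary: j rule: tick.induct) (auto simp: algebra_simps)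

text \<open>The usual account of a binary counter: every carry clears a bit, and exactly one bit
  becomes set.\<close>

lemma ones_tick: "ones (tick rk c ls) + carries ls = Suc (ones ls)"
  by (induction rk c ls rule: tick.induct) (auto simp: ones_def)

definition heap_sorted :: "(nat \<Rightarrow> nat) \<Rightarrow> heap \<Rightarrow> bool" where
  "heap_sorted rk ls \<longleftrightarrow> (\<forall>l \<in> set ls. sorted (map rk (snd l)))"

lemma heap_sorted_tick:
  "sorted (map rk c) \<Longrightarrow> heap_sorted rk ls \<Longrightarrow> heap_sorted rk (tick rk c ls)"
  by (induction rk c ls rule: tick.induct) (auto simp: heap_sorted_def sorted_mrg)

text \<open>An element \<open>x\<close> of level \<open>j\<close> has been in the heap for at least \<open>2 ^ j - 1\<close> insertions,
  where \<open>s x\<close> counts the insertions before that of \<open>x\<close>.\<close>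
fun aged :: "(nat \<Rightarrow> nat) \<Rightarrow> nat \<Rightarrow> nat \<Rightarrow> heap \<Rightarrow> bool" where
  "aged s t j [] \<longleftrightarrow> t = 0"
| "aged s t j ((b, R) # ls) \<longleftrightarrow> b = odd t \<and> (\<forall>x\<in>set R. s x + 2 ^ j \<le> 2 ^ j * t) \<and>
    aged s (t div 2) (Suc j) ls"

text \<open>At level \<open>j\<close>, \<open>t\<close> is the number of arrivals so far. A carry
  happens for \<open>t = 2 * r + 1\<close> and is arrival number \<open>r + 1\<close> one level up.
  There the bound for the moved run amounts to \<open>s x <= 2 ^ (j + 1) * r\<close>, which is the
  old bound rearranged.\<close>

lemma aged_tick:
  "aged s t j ls \<Longrightarrow> \<forall>x\<in>set c. s x + 2 ^ j \<le> 2 ^ j * Suc t \<Longrightarrow> aged s (Suc t) j (tick rk c ls)"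
proof (induction rk c ls arbitrary: t j rule: tick.induct)
  case (1 rk c)
  then show ?case by auto
next
  case (2 rk c R ls)
  then show ?case by (auto simp: add_increasing2)
next
  case (3 rk c R ls)
  then obtain r where t: "t = 2 * r + 1" by (auto elim: oddE)
  have "aged s (Suc r) (Suc j) (tick rk R ls)"
    using 3 t by (intro "3.IH") auto
  then show ?case using 3 t by auto
qed

lemma aged_cong: "aged s t j ls \<Longrightarrow> \<forall>x\<in>elems ls. s x = s' x \<Longrightarrow> aged s' t j ls"
  by (induction s t j ls rule: aged.induct) auto

lemma aged_upd:
  "aged s t j ls \<Longrightarrow> i < length ls \<Longrightarrow> set R \<subseteq> set (run_at ls i) \<Longrightarrow>
    aged s t j (upd ls i (bit_at ls i, R))"
proof (induction s t j ls arbitrary: i rule: aged.induct)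
  case (2 s t j b R' ls)
  then show ?case
    by (cases i) (auto simp: upd_def bit_at_def run_at_def)
qed simp

text \<open>For \<open>j = 0\<close> the level \<open>i\<close> of \<open>x\<close> satisfies
  \<open>2 ^ i <= t - s x\<close>. So work proportional to the level is logarithmic in the number of
  insertions from that of \<open>x\<close> on.\<close>

lemma aged_level:
  "aged s t j ls \<Longrightarrow> i < length ls \<Longrightarrow> x \<in> set (run_at ls i) \<Longrightarrow> s x + 2 ^ (j + i) \<le> 2 ^ j * t"
proof (induction s t j ls arbitrary: i rule: aged.induct)
  case (2 s t j b R ls)
  show ?case
  proof (cases i)
    case 0
    then show ?thesis using 2 by (auto simp: run_at_def)
  next
    case (Suc k)
    have "s x + 2 ^ (Suc j + k) \<le> 2 ^ Suc j * (t div 2)"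
      using 2 Suc by (intro "2.IH") (auto simp: run_at_def)
    also have "\<dots> = 2 ^ j * (2 * (t div 2))" by simp
    also have "\<dots> \<le> 2 ^ j * t" by (intro mult_le_mono) auto
    finally show ?thesis using Suc by simp
  qed
qed simp

definition better :: "(nat \<Rightarrow> nat) \<Rightarrow> nat \<Rightarrow> nat \<Rightarrow> nat" where
  "better rk h b = (if h = 0 then b else if b = 0 \<or> rk h < rk b then h else b)"

text \<open>Applied to the suffixes \<open>drop j ls\<close>, this gives the suffix minima kept in
  array 10. The overall minimum is entry 0, and a change at level \<open>j\<close> affects entries 0
  to \<open>j\<close> only, so neither reading nor repairing it involves higher levels.\<close>

fun best :: "(nat \<Rightarrow> nat) \<Rightarrow> heap \<Rightarrow> nat" where
  "best rk [] = 0"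
| "best rk (l # ls) = better rk (hd0 (snd l)) (best rk ls)"

lemma best_drop: "best rk (drop j ls) = better rk (hd0 (run_at ls j)) (best rk (drop (Suc j) ls))"
proof (cases "j < length ls")
  case True
  then show ?thesis using Cons_nth_drop_Suc[OF True, symmetric] by (simp add: run_at_def)
qed (simp add: run_at_def better_def)

lemma hd0_in: "hd0 xs \<in> insert 0 (set xs)"
  by (cases xs) auto

lemma best_in: "best rk ls \<in> insert 0 (elems ls)"
proof (induction ls)
  case (Cons l ls)
  then show ?case using hd0_in[of "snd l"] by (auto simp: better_def)
qed simp

lemma best_level: "best rk ls \<noteq> 0 \<Longrightarrow> \<exists>i < length ls. hd0 (run_at ls i) = best rk ls"
proof (induction ls)
  case (Cons l ls)
  show ?case
  proof (cases "best rk (l # ls) = hd0 (snd l)")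
    case True
    then show ?thesis by (auto simp: run_at_Cons)
  next
    case False
    then have "best rk (l # ls) = best rk ls" by (auto simp: better_def split: if_splits)
    then obtain i where "i < length ls" "hd0 (run_at ls i) = best rk (l # ls)"
      using Cons by auto
    then show ?thesis by (intro exI[of _ "Suc i"]) (auto simp: run_at_Cons)
  qed
qed simp

lemma best_le:
  "heap_sorted rk ls \<Longrightarrow> 0 \<notin> elems ls \<Longrightarrow> x \<in> elems ls \<Longrightarrow>
    best rk ls \<noteq> 0 \<and> rk (best rk ls) \<le> rk x"
proof (induction ls arbitrary: x)
  case (Cons l ls)
  have hd: "hd0 (snd l) \<noteq> 0 \<and> rk (hd0 (snd l)) \<le> rk y" if "y \<in> set (snd l)" for y
    using that Cons.prems(1,2) by (cases "snd l") (auto simp: heap_sorted_def)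
  have tl: "best rk ls \<noteq> 0 \<and> rk (best rk ls) \<le> rk y" if "y \<in> elems ls" for y
    using that Cons by (auto simp: heap_sorted_def)
  show ?case using Cons.prems(3) hd[of x] tl[of x] by (auto simp: better_def)
qed simp

definition levels :: "state \<Rightarrow> heap \<Rightarrow> bool" where
  "levels s ls \<longleftrightarrow> (\<forall>j. arr s 9 j = of_bool (bit_at ls j) \<and>
     lseg (arr s 7) (arr s 8 j) (run_at ls j) 0)"

lemma levels_upd:
  assumes "levels s ls" "j \<le> length ls" "arr s' 9 = (arr s 9)(j := of_bool b)"
    "arr s' 8 = (arr s 8)(j := h)" "lseg (arr s' 7) h R 0"
    "\<And>i x. i \<noteq> j \<Longrightarrow> x \<in> set (run_at ls i) \<Longrightarrow> arr s' 7 x = arr s 7 x"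
  shows "levels s' (upd ls j (b, R))"
  unfolding levels_def
proof
  fix i
  have "lseg (arr s' 7) (arr s 8 i) (run_at ls i) 0" if "i \<noteq> j"
    using assms(1) lseg_cong[of "run_at ls i" "arr s 7" "arr s' 7"] assms(6)[OF that]
    by (auto simp: levels_def)
  then show "arr s' 9 i = of_bool (bit_at (upd ls j (b, R)) i) \<and>
     lseg (arr s' 7) (arr s' 8 i) (run_at (upd ls j (b, R)) i) 0"
    using assms by (auto simp: run_at_upd bit_at_upd levels_def)
qed

definition heap_repr :: "(nat \<Rightarrow> nat) \<Rightarrow> state \<Rightarrow> heap \<Rightarrow> bool" where
  "heap_repr rk s ls \<longleftrightarrow> levels s ls \<and> (\<forall>j. arr s 10 j = best rk (drop j ls))"

text \<open>Variable 37 is the highest changed level. The entry above it is still valid and starts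
  the downward recomputation.\<close>

definition rebuild_code :: com where
  "rebuild_code =
    Plus 39 37 1 ;; Get 40 10 39 ;;
    WhileNeq 39 0 (
      Minus 39 39 1 ;; Get 41 8 39 ;;
      IfEq 41 0 Nop
        (IfEq 40 0 (Plus 40 41 0)
          (Minus 34 41 1 ;; Minus 35 40 1 ;; Ask 36 34 35 ;; IfEq 36 1 (Plus 40 41 0) Nop)) ;;
      Put 10 39 40)"

lemma wp_rebuild:
  assumes lv: "levels s ls" and U: "ranked M q rk U" "elems ls \<subseteq> U"
    and B: "\<And>j. vars s 37 < j \<Longrightarrow> arr s 10 j = best rk (drop j ls)"
    and c: "const_vars s" and M: "vars s 37 + 1 < M"
  shows "wp M b q rebuild_code (\<lambda>s'. heap_repr rk s' ls \<and>
      frame {34, 35, 36, 39, 40, 41} {10} s s' \<and>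
      time s' \<le> time s + 40 * vars s 37 + 60 \<and> asked s' \<le> asked s + vars s 37 + 1) s"
    (is "wp M b q rebuild_code ?Q s")
proof -
  let ?T = "time s + 40 * vars s 37 + 59"
  define I where "I = (\<lambda>t. (\<forall>j\<ge>vars t 39. arr t 10 j = best rk (drop j ls)) \<and>
    vars t 40 = best rk (drop (vars t 39) ls) \<and> vars t 39 \<le> vars s 37 + 1 \<and>
    frame {34, 35, 36, 39, 40, 41} {10} s t \<and>
    time t + 40 * vars t 39 \<le> ?T \<and> asked t + vars t 39 \<le> asked s + vars s 37 + 1)"
  have c01: "vars t 0 = 0 \<and> vars t (Suc 0) = 1" if "frame {34, 35, 36, 39, 40, 41} {10} s t" for t
    using that c by (auto simp: frame_def const_vars_def)
  have Upos: "p \<noteq> 0 \<and> p < M" if "p \<in> U" for p using U that by (auto simp: ranked_def)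
  have body: "wp M b q (Minus 39 39 1 ;; Get 41 8 39 ;;
      IfEq 41 0 Nop
        (IfEq 40 0 (Plus 40 41 0)
          (Minus 34 41 1 ;; Minus 35 40 1 ;; Ask 36 34 35 ;; IfEq 36 1 (Plus 40 41 0) Nop)) ;;
      Put 10 39 40) I (t\<lparr>time := time t + 2\<rparr>)"
    if "I t" and ne: "vars t 39 \<noteq> vars t 0" for t
  proof -
    have I: "\<forall>j\<ge>vars t 39. arr t 10 j = best rk (drop j ls)"
      "vars t 40 = best rk (drop (vars t 39) ls)" "vars t 39 \<le> vars s 37 + 1"
      "frame {34, 35, 36, 39, 40, 41} {10} s t"
      "time t + 40 * vars t 39 \<le> ?T" "asked t + vars t 39 \<le> asked s + vars s 37 + 1"
      using \<open>I t\<close> unfolding I_def by blast+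
    note c0 = c01[OF I(4)]
    obtain i where i: "vars t 39 = Suc i" using ne c0 by (cases "vars t 39") auto
    let ?h = "hd0 (run_at ls i)"
    let ?b = "best rk (drop (Suc i) ls)"
    have h: "arr t 8 i = ?h"
      using lv frame_arr[OF I(4), of 8] lseg_hd0 by (auto simp: levels_def)
    have hU: "?h \<in> insert 0 U" using hd0_in[of "run_at ls i"] set_run_at[of ls i] U(2) by auto
    have "elems (drop (Suc i) ls) \<subseteq> elems ls" by (auto simp: elems_def dest: in_set_dropD)
    then have bU: "?b \<in> insert 0 U" using best_in[of rk "drop (Suc i) ls"] U(2) by auto
    have bef: "q (?h - 1) (?b - 1) \<longleftrightarrow> rk ?h < rk ?b" if "?h \<noteq> 0" "?b \<noteq> 0"
      using U(1) that hU bU by (auto simp: ranked_def)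
    have new: "best rk (drop i ls) = better rk ?h ?b" by (rule best_drop)
    have B': "arr t 10 j = best rk (drop j ls)" if "Suc i \<le> j" for j
      using I(1) i that by auto
    \<comment> \<open>The four outcomes of the comparison leave states of the same shape, so one
      closing argument serves them all.\<close>
    have fin: "I t'" if "vars t' 39 = i" "vars t' 40 = better rk ?h ?b"
      "arr t' = (arr t)(10 := (arr t 10)(i := better rk ?h ?b))"
      "\<And>r. r \<notin> {34, 35, 36, 39, 40, 41} \<Longrightarrow> vars t' r = vars t r"
      "time t' \<le> time t + 40" "asked t' \<le> asked t + 1" for t'
      unfolding I_def
    proof (intro conjI allI impI)
      show "arr t' 10 j = best rk (drop j ls)" if j: "vars t' 39 \<le> j" for j
        using that \<open>vars t' 39 = i\<close> \<open>arr t' = _\<close> B'[of j] new by (cases "j = i") auto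
    qed (use that I i new in \<open>auto simp: frame_def\<close>)
    obtain h b' where hb: "h = ?h" "b' = ?b" by blast
    have h8: "arr t 8 i = h" and b40: "vars t 40 = b'" using h I(2) i hb by simp_all
    have bnd: "h < M" "b' < M" "Suc i < M" using hU bU Upos M I(3) i hb by auto
    note fin' = fin[folded hb]
    consider "h = 0" | "h \<noteq> 0" "b' = 0" | "h \<noteq> 0" "b' \<noteq> 0" "rk h < rk b'"
      | "h \<noteq> 0" "b' \<noteq> 0" "\<not> rk h < rk b'" by blast
    then show ?thesis
    proof cases
      case 1
      show ?thesis using c0 i h8 b40 bnd 1
        by (simp add: wp_simps) (rule fin'; simp add: better_def)
    next
      case 2
      show ?thesis using c0 i h8 b40 bnd 2
        by (simp add: wp_simps) (rule fin'; simp add: better_def)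
    next
      case 3
      then have "q (h - 1) (b' - 1)" using bef hb by simp
      then show ?thesis using c0 i h8 b40 bnd 3
        by (simp add: wp_simps) (rule fin'; simp add: better_def)
    next
      case 4
      then have "\<not> q (h - 1) (b' - 1)" using bef hb by simp
      then show ?thesis using c0 i h8 b40 bnd 4
        by (simp add: wp_simps) (rule fin'; simp add: better_def)
    qed
  qed
  show ?thesis
    unfolding rebuild_code_def wp_Seq wp_Plus wp_Get
  proof (intro conjI impI)
    show "vars s 37 + vars s 1 < M" using M c by (simp add: const_vars_def)
    show "wp M b q (WhileNeq 39 0 (
      Minus 39 39 1 ;; Get 41 8 39 ;;
      IfEq 41 0 Nop
        (IfEq 40 0 (Plus 40 41 0)
          (Minus 34 41 1 ;; Minus 35 40 1 ;; Ask 36 34 35 ;; IfEq 36 1 (Plus 40 41 0) Nop)) ;;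
      Put 10 39 40)) ?Q (s\<lparr>vars := (vars s)(39 := vars s 37 + vars s 1), time := Suc (time s),
        vars := (vars (s\<lparr>vars := (vars s)(39 := vars s 37 + vars s 1), time := Suc (time s)\<rparr>))
          (40 := arr (s\<lparr>vars := (vars s)(39 := vars s 37 + vars s 1), time := Suc (time s)\<rparr>) 10
            (vars (s\<lparr>vars := (vars s)(39 := vars s 37 + vars s 1), time := Suc (time s)\<rparr>) 39)),
        time := time (s\<lparr>vars := (vars s)(39 := vars s 37 + vars s 1), time := Suc (time s)\<rparr>) + access_cost 10\<rparr>)"
      (is "wp _ _ _ _ _ ?s1")
    proof (rule wp_While[where I = I and B = ?T])
      show "I ?s1" unfolding I_def
        using c B by (auto simp: frame_def const_vars_def access_cost_def)
      show "time t \<le> ?T" if "I t" for t using that unfolding I_def by linarith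
      show "?Q (t\<lparr>time := time t + 1\<rparr>)" if "I t" "vars t 39 = vars t 0" for t
      proof -
        have I: "\<forall>j\<ge>vars t 39. arr t 10 j = best rk (drop j ls)"
          "frame {34, 35, 36, 39, 40, 41} {10} s t"
          "time t + 40 * vars t 39 \<le> ?T" "asked t + vars t 39 \<le> asked s + vars s 37 + 1"
          using \<open>I t\<close> unfolding I_def by blast+
        have "levels t ls" using lv I(2) by (auto simp: levels_def frame_def)
        then show ?thesis using I c01[OF I(2)] that(2)
          by (auto simp: heap_repr_def frame_def levels_def)
      qed
    qed (use body in auto)
  qed simp_all
qed

lemma wp_state:
  assumes "wp M b q c Q s" "vars s = vars s'" "arr s = arr s'" "asked s = asked s'" "time s = time s'"
  shows "wp M b q c Q s'"
proof -
  have "s = s'" by (rule state.equality) (simp_all add: assms(2-5))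
  with assms(1) show ?thesis by (simp only:)
qed

definition insert_code :: com where
  "insert_code =
    Put 7 21 0 ;; Plus 30 21 0 ;; Cst 37 0 ;; Get 38 9 37 ;;
    WhileNeq 38 0 (
      Put 9 37 0 ;; Get 31 8 37 ;; Put 8 37 30 ;; Plus 30 31 0 ;; Plus 37 37 1 ;; Get 38 9 37) ;;
    Put 9 37 1 ;; Get 31 8 37 ;; merge_code ;; Put 8 37 32 ;; rebuild_code"

lemma upd_middle: "upd (pre @ l # rest) (length pre) x = pre @ x # rest"
  by (simp add: upd_def)

lemma upd_end: "upd pre (length pre) x = pre @ [x]"
  by (simp add: upd_def)

lemma run_at_append: "run_at (xs @ ys) j = (if j < length xs then run_at xs j else run_at ys (j - length xs))"
  by (auto simp: run_at_def nth_append)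

lemma bit_at_append: "bit_at (xs @ ys) j = (if j < length xs then bit_at xs j else bit_at ys (j - length xs))"
  by (auto simp: bit_at_def nth_append)

lemma drop_Cons_Suc: "drop j ls = l # rest \<Longrightarrow> drop (Suc j) ls = rest"
  by (metis drop_Suc list.sel(3) tl_drop)

text \<open>Where the carry stops, the tick is a single update; at the end of the list it opens a
  new level. Higher levels are untouched, so their suffix minima remain valid.\<close>

lemma tick_upd:
  assumes "\<not> bit_at rest 0"
  shows "pre @ tick rk c rest = upd (pre @ rest) (length pre) (True, mrg rk c (run_at rest 0))"
    "merge_cost c rest = length c + length (run_at rest 0)" "carries rest = 0"
    "j > 0 \<Longrightarrow> drop j (tick rk c rest) = drop j rest"
proof -
  consider "rest = []" | R ls where "rest = (False, R) # ls"
    using assms by (cases rest) (auto simp: bit_at_def)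
  then show "pre @ tick rk c rest = upd (pre @ rest) (length pre) (True, mrg rk c (run_at rest 0))"
    "merge_cost c rest = length c + length (run_at rest 0)" "carries rest = 0"
    "j > 0 \<Longrightarrow> drop j (tick rk c rest) = drop j rest"
    by (cases; auto simp: upd_middle upd_end run_at_def drop_Cons')+
qed

lemma length_tick: "length (tick rk c ls) \<le> Suc (length ls)"
  by (induction rk c ls rule: tick.induct) auto

text \<open>Per carry, 40 steps go to the exchange of runs and 40 to recomputing the suffix minimum
  of that level. The merge costs 60 per element.\<close>

lemma wp_insert:
  assumes hr: "heap_repr rk s ls" and U: "ranked M q rk U" "vars s 21 \<in> U" "elems ls \<subseteq> U"
    and d: "distinct (vars s 21 # concat (map snd ls))"
    and c: "const_vars s" and M: "length ls + 1 < M"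
  shows "wp M b q insert_code (\<lambda>s'. heap_repr rk s' (tick rk [vars s 21] ls) \<and>
      frame {30..41} {7, 8, 9, 10} s s' \<and>
      time s' \<le> time s + 80 * carries ls + 60 * merge_cost [vars s 21] ls + 200 \<and>
      asked s' \<le> asked s + carries ls + merge_cost [vars s 21] ls + 1) s"
    (is "wp M b q insert_code ?Q s")
proof -
  let ?p = "vars s 21"
  let ?T = "time s + 40 * carries ls + 20"
  have M1: "1 < M" using M by simp
  have c01: "vars t 0 = 0 \<and> vars t (Suc 0) = 1" if "frame {30..41} A s t" for t A
    using that c by (auto simp: frame_def const_vars_def)
  have zU: "0 \<notin> U" and UM: "x \<in> U \<Longrightarrow> x < M" for x using U(1) by (auto simp: ranked_def)
  have p0: "?p \<noteq> 0" using zU U(2) by metis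
  \<comment> \<open>\<open>pre\<close> holds the levels already passed, \<open>cl\<close> the run in
    transit to level \<open>vars t 37\<close>. What remains to be done is \<open>tick rk cl\<close>
    on the other levels, with the corresponding shares of \<open>merge_cost\<close> and
    \<open>carries\<close>.\<close>
  define I where "I = (\<lambda>t. \<exists>pre cl. length pre = vars t 37 \<and> vars t 37 \<le> length ls \<and>
    tick rk [?p] ls = pre @ tick rk cl (drop (vars t 37) ls) \<and>
    merge_cost [?p] ls = merge_cost cl (drop (vars t 37) ls) \<and>
    carries ls = vars t 37 + carries (drop (vars t 37) ls) \<and>
    levels t (pre @ drop (vars t 37) ls) \<and> lseg (arr t 7) (vars t 30) cl 0 \<and>
    mset (cl @ concat (map snd (pre @ drop (vars t 37) ls))) = mset (?p # concat (map snd ls)) \<and>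
    vars t 38 = arr t 9 (vars t 37) \<and> frame {30..41} {7, 8, 9} s t \<and>
    time t + 40 * carries (drop (vars t 37) ls) \<le> ?T \<and> asked t = asked s)"
  let ?body = "Put 9 37 0 ;; Get 31 8 37 ;; Put 8 37 30 ;; Plus 30 31 0 ;; Plus 37 37 1 ;; Get 38 9 37"
  let ?rest = "Put 9 37 1 ;; Get 31 8 37 ;; merge_code ;; Put 8 37 32 ;; rebuild_code"
  have facts: "distinct (cl @ concat (map snd L)) \<and> set cl \<subseteq> U \<and> elems L \<subseteq> U"
    if "mset (cl @ concat (map snd L)) = mset (?p # concat (map snd ls))" for cl L
  proof -
    have "distinct (cl @ concat (map snd L))" using mset_eq_imp_distinct_iff[OF that] d by simp
    moreover have "set cl \<union> elems L = insert ?p (elems ls)"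
      using mset_eq_setD[OF that] by (simp add: elems_def)
    ultimately show ?thesis using U by (metis insert_subset le_sup_iff)
  qed
  let ?s1 = "s\<lparr>vars := (vars s)(30 := ?p, 37 := 0, 38 := arr s 9 0),
      arr := (arr s)(7 := (arr s 7)(?p := 0)), time := time s + 14\<rparr>"
  have "I ?s1"
    unfolding I_def
  proof (rule exI[of _ "[]"], rule exI[of _ "[?p]"], intro conjI)
    have "levels s ls" using hr by (simp add: heap_repr_def)
    moreover have "lseg ((arr s 7)(?p := 0)) h (run_at ls j) 0 = lseg (arr s 7) h (run_at ls j) 0" for h j
      using d set_run_at[of ls j] by (intro lseg_upd) (auto simp: elems_def)
    ultimately show "levels ?s1 ([] @ drop (vars ?s1 37) ls)" by (simp add: levels_def)
  qed (use p0 in \<open>auto simp: frame_def\<close>)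
  have body: "wp M b q ?body I (t\<lparr>time := time t + 2\<rparr>)"
    if "I t" and ne: "vars t 38 \<noteq> vars t 0" for t
  proof -
    from \<open>I t\<close> obtain pre cl where I: "length pre = vars t 37" "vars t 37 \<le> length ls"
      "tick rk [?p] ls = pre @ tick rk cl (drop (vars t 37) ls)"
      "merge_cost [?p] ls = merge_cost cl (drop (vars t 37) ls)"
      "carries ls = vars t 37 + carries (drop (vars t 37) ls)"
      "levels t (pre @ drop (vars t 37) ls)" "lseg (arr t 7) (vars t 30) cl 0"
      "mset (cl @ concat (map snd (pre @ drop (vars t 37) ls))) = mset (?p # concat (map snd ls))"
      "vars t 38 = arr t 9 (vars t 37)" "frame {30..41} {7, 8, 9} s t"
      "time t + 40 * carries (drop (vars t 37) ls) \<le> ?T" "asked t = asked s" unfolding I_def by blast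
    note c0 = c01[OF I(10)]
    obtain j where j: "vars t 37 = j" by simp
    have "bit_at (pre @ drop j ls) j"
      using ne I(6,9) c0 j by (auto simp: levels_def split: if_splits)
    then obtain R rest where rest: "drop j ls = (True, R) # rest"
      using I(1) j by (cases "drop j ls") (auto simp: bit_at_append bit_at_def)
    have rest': "drop (Suc j) ls = rest" using drop_Cons_Suc[OF rest] .
    have jl: "j < length ls" using rest by (metis drop_all list.distinct(1) not_le)
    have R: "run_at (pre @ drop j ls) j = R" using I(1) j rest by (simp add: run_at_def nth_append)
    have lsegR: "lseg (arr t 7) (arr t 8 j) R 0" using I(6) R j unfolding levels_def by metis
    have clM: "vars t 30 < M"
      using facts[OF I(8)] UM lseg_hd0[OF I(7)] hd0_in[of cl] M1 by auto
    have hM: "arr t 8 j < M"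
    proof -
      have "set R \<subseteq> U" using facts[OF I(8)] j rest by auto
      then show ?thesis using UM lseg_hd0[OF lsegR] hd0_in[of R] M1 by auto
    qed
    let ?t = "t\<lparr>vars := (vars t)(31 := arr t 8 j, 30 := arr t 8 j, 37 := Suc j, 38 := arr t 9 (Suc j)),
        arr := (arr t)(9 := (arr t 9)(j := 0), 8 := (arr t 8)(j := vars t 30)), time := time t + 28\<rparr>"
    have "I ?t"
      unfolding I_def
    proof (rule exI[of _ "pre @ [(False, cl)]"], rule exI[of _ R], intro conjI)
      have "levels ?t (upd (pre @ drop j ls) j (False, cl))"
        by (rule levels_upd[where s = t and h = "vars t 30"]) (use I j in auto)
      then show "levels ?t ((pre @ [(False, cl)]) @ drop (vars ?t 37) ls)"
        using I(1) j rest upd_middle[of pre] by (auto simp: rest')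
      show "mset (R @ concat (map snd ((pre @ [(False, cl)]) @ drop (vars ?t 37) ls))) =
          mset (?p # concat (map snd ls))"
        using I(8) j rest by (simp add: rest' ac_simps)
    qed (use I j rest jl lsegR in \<open>auto simp: frame_def rest'\<close>)
    then show ?thesis
      using c0 j hM jl M
      by (simp add: wp_simps) (erule back_subst[of I]; rule state.equality; auto simp: fun_eq_iff)
  qed
  have exit: "wp M b q ?rest ?Q (t\<lparr>time := time t + 1\<rparr>)"
    if "I t" and eq: "vars t 38 = vars t 0" for t
  proof -
    from \<open>I t\<close> obtain pre cl where I: "length pre = vars t 37" "vars t 37 \<le> length ls"
      "tick rk [?p] ls = pre @ tick rk cl (drop (vars t 37) ls)"
      "merge_cost [?p] ls = merge_cost cl (drop (vars t 37) ls)"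
      "carries ls = vars t 37 + carries (drop (vars t 37) ls)"
      "levels t (pre @ drop (vars t 37) ls)" "lseg (arr t 7) (vars t 30) cl 0"
      "mset (cl @ concat (map snd (pre @ drop (vars t 37) ls))) = mset (?p # concat (map snd ls))"
      "vars t 38 = arr t 9 (vars t 37)" "frame {30..41} {7, 8, 9} s t"
      "time t + 40 * carries (drop (vars t 37) ls) \<le> ?T" "asked t = asked s" unfolding I_def by blast
    note c0 = c01[OF I(10)]
    obtain j where j: "vars t 37 = j" by simp
    let ?rest = "drop j ls"
    let ?L = "pre @ ?rest"
    let ?R = "run_at ?rest 0"
    have lp: "length pre = j" using I(1) j by simp
    have "\<not> bit_at ?L j" using eq I(6,9) c0 j by (auto simp: levels_def split: if_splits)
    then have nb: "\<not> bit_at ?rest 0" using lp by (simp add: bit_at_append)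
    note tu = tick_upd[OF nb]
    have R: "run_at ?L j = ?R" using lp by (simp add: run_at_append)
    have lsegR: "lseg (arr t 7) (arr t 8 j) ?R 0" using I(6) R j unfolding levels_def by metis
    note fc = facts[OF I(8)[unfolded j]]
    have dR: "distinct (cl @ ?R)" "set ?R \<subseteq> U" "set cl \<inter> elems ?L = {}"
    proof -
      have "distinct ?R"
        using fc by (cases ?rest) (auto simp: run_at_def)
      moreover have "set ?R \<subseteq> elems ?L" using set_run_at[of ?rest 0] by auto
      moreover show "set cl \<inter> elems ?L = {}" using fc by (auto simp: elems_def)
      ultimately show "distinct (cl @ ?R)" "set ?R \<subseteq> U" using fc by auto
    qed
    let ?t1 = "t\<lparr>vars := (vars t)(31 := arr t 8 j), arr := (arr t)(9 := (arr t 9)(j := 1)),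
        time := time t + 13\<rparr>"
    have mrg: "wp M b q merge_code (\<lambda>s'. lseg (arr s' 7) (vars s' 32) (mrg rk cl ?R) 0 \<and>
      (\<forall>p. p \<notin> insert 0 (set cl \<union> set ?R) \<longrightarrow> arr s' 7 p = arr ?t1 7 p) \<and>
      frame {30..36} {7} ?t1 s' \<and>
      time s' \<le> time ?t1 + 60 * (length cl + length ?R) + 60 \<and>
      asked s' \<le> asked ?t1 + (length cl + length ?R)) ?t1"
      by (rule wp_merge[where U = U])
         (use I(7) lsegR dR U(1) fc c0 M1 in \<open>auto simp: const_vars_def\<close>)
    have reb: "wp M b q (Put 8 37 32 ;; rebuild_code) ?Q t2"
      if t2: "lseg (arr t2 7) (vars t2 32) (mrg rk cl ?R) 0 \<and>
      (\<forall>p. p \<notin> insert 0 (set cl \<union> set ?R) \<longrightarrow> arr t2 7 p = arr ?t1 7 p) \<and>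
      frame {30..36} {7} ?t1 t2 \<and>
      time t2 \<le> time ?t1 + 60 * (length cl + length ?R) + 60 \<and>
      asked t2 \<le> asked ?t1 + (length cl + length ?R)" for t2
    proof -
      let ?t3 = "t2\<lparr>arr := (arr t2)(8 := (arr t2 8)(j := vars t2 32)), time := time t2 + 6\<rparr>"
      let ?N = "upd ?L j (True, mrg rk cl ?R)"
      have t2v: "vars t2 r = vars ?t1 r" if "r \<notin> {30..36}" for r
        using t2 frame_vars that by blast
      have t2a: "arr t2 k = arr ?t1 k" if "k \<noteq> 7" for k
        using t2 that unfolding frame_def by blast
      have N: "?N = tick rk [?p] ls" using tu(1)[of pre rk cl] I(3) lp j by simp
      have lv: "levels ?t3 ?N"
      proof (rule levels_upd[where s = t and h = "vars t2 32"])
        show "levels t ?L" using I(6) j by simp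
        show "j \<le> length ?L" using lp by simp
        show "arr ?t3 7 x = arr t 7 x" if "i \<noteq> j" "x \<in> set (run_at ?L i)" for i x
        proof -
          have "x \<in> elems ?L" using that set_run_at[of ?L i] by blast
          moreover have "x \<notin> set ?R"
            using run_at_disjoint[of ?L i j] fc that R by auto
          ultimately have "x \<notin> insert 0 (set cl \<union> set ?R)" using dR fc zU by auto
          then have "arr t2 7 x = arr ?t1 7 x" using t2 by blast
          then show ?thesis by simp
        qed
      qed (use t2 t2a in auto)
      have elN: "elems ?N \<subseteq> U" using U N by simp
      have fr3: "frame {30..41} {7, 8, 9} s ?t3"
        using I(10) t2v t2a by (auto simp: frame_def)
      have v37: "vars ?t3 37 = j" using t2v[of 37] j by simp
      have B: "arr ?t3 10 i = best rk (drop i ?N)" if "j < i" for i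
      proof -
        have "arr ?t3 10 i = arr s 10 i" using fr3 by (simp add: frame_def)
        also have "\<dots> = best rk (drop i ls)" using hr by (simp add: heap_repr_def)
        also have "drop i ls = drop (i - j) (drop j ls)" using that by simp
        also have "\<dots> = drop (i - j) (tick rk cl (drop j ls))"
          using tu(4)[of "i - j" rk cl] that by simp
        also have "\<dots> = drop i ?N" using that lp I(3) j N by simp
        finally show ?thesis .
      qed
      have "wp M b q rebuild_code (\<lambda>s'. heap_repr rk s' ?N \<and>
        frame {34, 35, 36, 39, 40, 41} {10} ?t3 s' \<and>
        time s' \<le> time ?t3 + 40 * vars ?t3 37 + 60 \<and> asked s' \<le> asked ?t3 + vars ?t3 37 + 1) ?t3"
      proof (rule wp_rebuild[OF lv U(1) elN])
        show "arr ?t3 10 i = best rk (drop i ?N)" if "vars ?t3 37 < i" for i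
          using B[of i] that v37 by simp
        show "const_vars ?t3" using c01[OF fr3] by (simp add: const_vars_def)
        show "vars ?t3 37 + 1 < M" using v37 I(2) j M by simp
      qed
      then have "wp M b q rebuild_code ?Q ?t3"
      proof (rule wp_mono)
        fix s' assume s': "heap_repr rk s' ?N \<and>
        frame {34, 35, 36, 39, 40, 41} {10} ?t3 s' \<and>
        time s' \<le> time ?t3 + 40 * vars ?t3 37 + 60 \<and> asked s' \<le> asked ?t3 + vars ?t3 37 + 1"
        have "frame {30..41} {7, 8, 9, 10} s s'"
          by (rule frame_trans[OF fr3]) (use s' in auto)
        then show "?Q s'"
          using s' t2 v37 I(4,5,11,12) tu(2,3) j N by auto
      qed
      then show ?thesis using v37 t2v[of 37] j by (simp add: wp_simps)
    qed
    have "wp M b q merge_code (wp M b q (Put 8 37 32 ;; rebuild_code) ?Q) ?t1"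
      by (rule wp_mono[OF mrg]) (rule reb)
    then show ?thesis
      using c0 j by (simp add: wp_simps) (erule wp_state; auto simp: fun_eq_iff)
  qed
  have loop: "wp M b q (WhileNeq 38 0 ?body) (wp M b q ?rest ?Q) ?s1"
  proof (rule wp_While[where I = I and B = ?T])
    show "I ?s1" by fact
    show "time t \<le> ?T" if "I t" for t using that unfolding I_def by fastforce
  qed (use body exit in auto)
  have "vars s 0 = 0" "?p < M" using c UM U(2) by (auto simp: const_vars_def)
  then show ?thesis
    using loop M1 p0 unfolding insert_code_def
    by (simp add: wp_simps) (erule wp_state; auto simp: fun_eq_iff)
qed

definition pop_code :: com where
  "pop_code =
    Get 42 10 0 ;; Cst 37 0 ;; Get 41 8 37 ;;
    WhileNeq 41 42 (Plus 37 37 1 ;; Get 41 8 37) ;;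
    Get 41 7 42 ;; Put 8 37 41 ;; rebuild_code"

text \<open>The scan for the level \<open>i\<close> of the minimum goes upwards from level 0, and
  the repair goes back down from \<open>i\<close>; higher levels cost nothing. The bit of the level
  is kept, as the counter records insertions and not the elements present.\<close>

lemma wp_pop:
  assumes hr: "heap_repr rk s ls" and U: "ranked M q rk U" "elems ls \<subseteq> U"
    and d: "distinct (concat (map snd ls))" and ne: "elems ls \<noteq> {}" and srt: "heap_sorted rk ls"
    and c: "const_vars s" and M: "length ls < M"
  shows "wp M b q pop_code (\<lambda>s'. \<exists>i R. i < length ls \<and> run_at ls i = vars s' 42 # R \<and>
      vars s' 42 = best rk ls \<and>
      heap_repr rk s' (upd ls i (bit_at ls i, R)) \<and>
      frame ({34..37} \<union> {39..42}) {8, 10} s s' \<and>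
      time s' \<le> time s + 60 * i + 120 \<and> asked s' \<le> asked s + i + 1) s"
    (is "wp M b q pop_code ?Q s")
proof -
  let ?p = "best rk ls"
  let ?V = "{34..37} \<union> {39..42} :: nat set"
  have zU: "0 \<notin> elems ls" and UM: "x \<in> U \<Longrightarrow> x < M" for x using U by (auto simp: ranked_def)
  have p: "?p \<noteq> 0" "?p \<in> elems ls"
    using ne best_le[OF srt zU] best_in[of rk ls] by auto
  \<comment> \<open>A level whose head is the minimum. The scan stops there at the latest, which
    bounds the index in \<open>I\<close>.\<close>
  obtain k where k: "k < length ls" "hd0 (run_at ls k) = ?p"
    using best_level[OF p(1)] by blast
  have lv: "levels s ls" and B: "arr s 10 j = best rk (drop j ls)" for j
    using hr by (auto simp: heap_repr_def)
  have H: "arr s 8 j = hd0 (run_at ls j)" for j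
    using lv lseg_hd0 by (auto simp: levels_def)
  have c01: "vars t 0 = 0 \<and> vars t (Suc 0) = 1" if "frame ?V A s t" for t A
    using that c by (auto simp: frame_def const_vars_def)
  define I where "I = (\<lambda>t. vars t 37 \<le> k \<and> vars t 42 = ?p \<and> vars t 41 = arr s 8 (vars t 37) \<and>
    frame ?V {} s t \<and> time t \<le> time s + 20 + 10 * vars t 37 \<and> asked t = asked s)"
  let ?rest = "Get 41 7 42 ;; Put 8 37 41 ;; rebuild_code"
  have loop: "wp M b q (WhileNeq 41 42 (Plus 37 37 1 ;; Get 41 8 37)) (wp M b q ?rest ?Q) t0" if "I t0" for t0
  proof (rule wp_While[where I = I and B = "time s + 20 + 10 * k"])
    show "I t0" by fact
    show "time t \<le> time s + 20 + 10 * k" if "I t" for t using that unfolding I_def by fastforce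
    show "wp M b q (Plus 37 37 1 ;; Get 41 8 37) I (t\<lparr>time := time t + 2\<rparr>)"
      if "I t" "vars t 41 \<noteq> vars t 42" for t
    proof -
      have I: "vars t 37 \<le> k" "vars t 42 = ?p" "vars t 41 = arr s 8 (vars t 37)"
        "frame ?V {} s t" "time t \<le> time s + 20 + 10 * vars t 37" "asked t = asked s"
        using \<open>I t\<close> unfolding I_def by blast+
      have "vars t 37 \<noteq> k" using that(2) I(2,3) H k by auto
      then show ?thesis using c01[OF I(4)] I k M frame_arr[OF I(4), of 8]
        by (simp add: wp_simps I_def) (auto simp: frame_def)
    qed
    show "wp M b q ?rest ?Q (t\<lparr>time := time t + 1\<rparr>)" if "I t" "vars t 41 = vars t 42" for t
    proof -
      have I: "vars t 37 \<le> k" "vars t 42 = ?p" "vars t 41 = arr s 8 (vars t 37)"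
        "frame ?V {} s t" "time t \<le> time s + 20 + 10 * vars t 37" "asked t = asked s"
        using \<open>I t\<close> unfolding I_def by blast+
      obtain i where i: "vars t 37 = i" by simp
      have il: "i < length ls" using i I(1) k by simp
      have "hd0 (run_at ls i) = ?p" using that(2) I(2,3) H i by auto
      then obtain R where R: "run_at ls i = ?p # R" using p(1) by (cases "run_at ls i") auto
      have at: "arr t = arr s" using I(4) by (auto simp: frame_def)
      let ?N = "upd ls i (bit_at ls i, R)"
      let ?t1 = "t\<lparr>vars := (vars t)(41 := arr s 7 ?p), arr := (arr t)(8 := (arr t 8)(i := arr s 7 ?p)),
        time := time t + 13\<rparr>"
      have "lseg (arr s 7) (arr s 8 i) (?p # R) 0" using lv R unfolding levels_def by metis
      then have lR: "lseg (arr s 7) (arr s 7 ?p) R 0" by simp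
      have lvN: "levels ?t1 ?N"
        by (rule levels_upd[where s = s and h = "arr s 7 ?p"])
           (use lv il at lR in \<open>auto simp: levels_def fun_upd_idem_iff\<close>)
      have elN: "elems ?N \<subseteq> U"
      proof
        fix x assume "x \<in> elems ?N"
        then obtain j where "x \<in> set (run_at ?N j)"
          by (force simp: elems_def run_at_def in_set_conv_nth)
        then have "x \<in> set (run_at ls j)" using R il by (auto simp: run_at_upd split: if_splits)
        then show "x \<in> U" using set_run_at[of ls j] U(2) by blast
      qed
      have fr: "frame ?V {8} s ?t1" using I(4) by (auto simp: frame_def)
      have "wp M b q rebuild_code (\<lambda>s'. heap_repr rk s' ?N \<and>
        frame {34, 35, 36, 39, 40, 41} {10} ?t1 s' \<and>
        time s' \<le> time ?t1 + 40 * vars ?t1 37 + 60 \<and> asked s' \<le> asked ?t1 + vars ?t1 37 + 1) ?t1"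
      proof (rule wp_rebuild[OF lvN U(1) elN])
        show "arr ?t1 10 j = best rk (drop j ?N)" if "vars ?t1 37 < j" for j
        proof -
          have "i < j" using that i by simp
          then have "drop j ?N = drop j ls" using il by (simp add: upd_def)
          then show ?thesis using B[of j] at by simp
        qed
        show "const_vars ?t1" using c01[OF fr] by (simp add: const_vars_def)
        show "vars ?t1 37 + 1 < M" using i il M by simp
      qed
      then have "wp M b q rebuild_code ?Q ?t1"
      proof (rule wp_mono)
        fix s' assume s': "heap_repr rk s' ?N \<and>
        frame {34, 35, 36, 39, 40, 41} {10} ?t1 s' \<and>
        time s' \<le> time ?t1 + 40 * vars ?t1 37 + 60 \<and> asked s' \<le> asked ?t1 + vars ?t1 37 + 1"
        have fr': "frame ?V {8, 10} s s'"
          by (rule frame_trans[OF fr]) (use s' in auto)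
        have "vars s' 42 = ?p" using s' I(2) by (auto simp: frame_def)
        then show "?Q s'"
          using s' fr' R il I i by (intro exI[of _ i] exI[of _ R]) auto
      qed
      then show ?thesis using i I(2) at by (simp add: wp_simps add.commute)
    qed
  qed
  have I0: "I (s\<lparr>vars := (vars s)(42 := ?p, 37 := 0, 41 := arr s 8 0), time := time s + 13\<rparr>)"
    unfolding I_def by (auto simp: frame_def)
  have "vars s 0 = 0" using c by (simp add: const_vars_def)
  then show ?thesis
    using loop[OF I0] M B[of 0] unfolding pop_code_def by (simp add: wp_simps add.commute)
qed

section \<open>Maximum cardinality search\<close>

text \<open>A visited neighbor gets its counter in array 2 increased by the difference of the two
  degrees. Variable 8 is the degree of the inserted vertex, because it is the bucket from which this
  vertex was taken. An unvisited neighbor gets a new bucket entry, and its old entries stay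
  behind.\<close>

definition visit_code :: com where
  "visit_code =
    WhileNeq 13 14 (
      Get 15 0 13 ;; Plus 13 13 1 ;;
      Get 16 1 15 ;; Plus 16 16 1 ;; Put 1 15 16 ;;
      Get 12 3 15 ;;
      IfEq 12 0
        (Put 5 7 15 ;; Get 12 4 16 ;; Put 6 7 12 ;; Put 4 16 7 ;; Plus 7 7 1)
        (Minus 16 16 8 ;; Get 12 2 15 ;; Plus 12 12 16 ;; Put 2 15 12))"

text \<open>An entry of the top bucket \<open>c\<close> belongs to a visited vertex and is skipped,
  or its vertex has exactly \<open>c\<close> visited neighbors: counts never fall below the bucket
  of an entry, and no unvisited vertex exceeds the top. So obsolete entries do no harm.\<close>

definition mcs_code :: com where
  "mcs_code =
    Plus 9 2 0 ;;
    WhileNeq 9 0 (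
      Get 10 4 8 ;;
      IfEq 10 0 (Minus 8 8 1) (
        Get 11 5 10 ;; Get 12 6 10 ;; Put 4 8 12 ;;
        Get 12 3 11 ;;
        IfEq 12 0 (
          Put 3 11 1 ;; Minus 9 9 1 ;;
          Plus 12 11 1 ;; Get 13 0 12 ;; Plus 12 12 1 ;; Get 14 0 12 ;;
          visit_code ;; Plus 8 8 1)
          Nop))"

section \<open>The input graph, its encoding and the search invariants\<close>

locale chordal_input =
  fixes G :: "nat graph" and adj :: "nat list list" and M :: nat
  assumes fin: "fin_graph G" and ch: "chordal G" and al: "adjacency_lists G adj"
    and M: "4 * (length adj + card (edges G) + 2) ^ 2 \<le> M"
begin

definition n :: nat where "n = length adj"
definition m :: nat where "m = card (edges G)"
definition E :: "nat set set" where "E = edges G"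
definition deg :: "nat \<Rightarrow> nat" where "deg v = length (adj ! v)"
definition off :: "nat \<Rightarrow> nat" where "off v = n + 2 + sum_list (map length (take v adj))"

lemma verts: "verts G = {..<n}"
  using al by (simp add: adjacency_lists_def n_def)

lemma irr: "{x} \<notin> E"
  using fin by (auto simp: fin_graph_def E_def)

lemma adj_iff: "v < n \<Longrightarrow> u \<in> set (adj ! v) \<longleftrightarrow> {u, v} \<in> E"
  using al by (simp add: adjacency_lists_def n_def E_def neighborhood_def)

lemma edge_less: "{u, v} \<in> E \<Longrightarrow> u < n \<and> v < n \<and> u \<noteq> v"
  using fin verts irr[of u] by (auto simp: fin_graph_def E_def)

lemma distinct_adj: "v < n \<Longrightarrow> distinct (adj ! v)"
  using al by (simp add: adjacency_lists_def n_def)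

lemma finite_E: "finite E"
  using fin verts unfolding E_def fin_graph_def
  by (intro finite_subset[of "edges G" "Pow (verts G)"]) auto

lemma sum_deg: "(\<Sum>v<n. deg v) \<le> 2 * m"
proof -
  have "deg v \<le> card {e \<in> E. v \<in> e}" if "v < n" for v
  proof -
    have "deg v = card (set (adj ! v))" using distinct_adj[OF that] by (simp add: deg_def distinct_card)
    also have "\<dots> \<le> card {e \<in> E. v \<in> e}"
      by (rule card_inj_on_le[where f = "\<lambda>u. {u, v}"])
         (use that adj_iff finite_E in \<open>auto simp: inj_on_def doubleton_eq_iff\<close>)
    finally show ?thesis .
  qed
  then have "(\<Sum>v<n. deg v) \<le> (\<Sum>v<n. card {e \<in> E. v \<in> e})" by (intro sum_mono) auto
  also have "\<dots> = 2 * card E"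
  proof (rule sum_multicount)
    show "\<forall>e\<in>E. card {v \<in> {..<n}. v \<in> e} = 2"
    proof
      fix e assume "e \<in> E"
      then have "e \<subseteq> {..<n}" "card e = 2" using fin verts by (auto simp: fin_graph_def E_def)
      moreover from this have "{v \<in> {..<n}. v \<in> e} = e" by auto
      ultimately show "card {v \<in> {..<n}. v \<in> e} = 2" by simp
    qed
  qed (use finite_E in auto)
  finally show ?thesis by (simp add: m_def E_def)
qed

lemma off_Suc: "v < n \<Longrightarrow> off (Suc v) = off v + deg v"
  by (simp add: off_def deg_def n_def take_Suc_conv_app_nth)

lemma off_eq: "v \<le> n \<Longrightarrow> off v = n + 2 + (\<Sum>u<v. deg u)"
proof (induction v)
  case 0 then show ?case by (simp add: off_def)
next
  case (Suc v) then show ?case by (simp add: off_Suc)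
qed

definition b :: nat where "b = off n"

lemma off_less: "v < n \<Longrightarrow> k < deg v \<Longrightarrow> off v + k < b"
proof -
  assume v: "v < n" and k: "k < deg v"
  have "(\<Sum>u<Suc v. deg u) \<le> (\<Sum>u<n. deg u)" using v by (intro sum_mono2) auto
  then show ?thesis using v k by (simp add: b_def off_eq)
qed

lemma b_bounds: "n + 2 \<le> b" "b \<le> n + 2 + 2 * m"
  using sum_deg by (auto simp: b_def off_eq)

text \<open>The quadratic size of \<open>M\<close> is due to the numbers of nonadjacent pairs;
  positions in the input and bucket entries only reach order \<open>n + m\<close>.\<close>

lemma M_bounds: "n * n + 4 * n + 4 * m + 8 < M" "n * n < M" "4 * n + 4 * m + 8 < M"
proof -
  have "4 * (n + m + 2) ^ 2 \<le> M" using M by (simp add: n_def m_def)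
  moreover have "4 * (n + m + 2) ^ 2 = 4 * (n * n) + 8 * (n * m) + 4 * (m * m) + 16 * n + 16 * m + 16"
    by (simp add: power2_eq_square algebra_simps)
  ultimately show "n * n + 4 * n + 4 * m + 8 < M" by simp
  then show "n * n < M" "4 * n + 4 * m + 8 < M" by simp_all
qed

definition raw_ok :: "state \<Rightarrow> bool" where
  "raw_ok s \<longleftrightarrow> arr s 0 0 = n \<and> (\<forall>v\<le>n. arr s 0 (Suc v) = off v) \<and>
     (\<forall>v<n. \<forall>k<deg v. arr s 0 (off v + k) = adj ! v ! k)"

text \<open>The counters of \<open>u\<close> currently refer to the subgraph induced by \<open>X u\<close>.\<close>
definition degrees :: "(nat \<Rightarrow> nat set) \<Rightarrow> state \<Rightarrow> bool" where
  "degrees X t \<longleftrightarrow> (\<forall>u<n. arr t 1 u = card (nb E (X u) u))"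

text \<open>Array 2 is 0 outside \<open>W\<close>, and 0 is also correct for a vertex that enters
  \<open>W\<close> as a simplicial one. So an insertion leaves the cell of the new vertex
  alone.\<close>

definition flaws :: "nat set \<Rightarrow> (nat \<Rightarrow> nat set) \<Rightarrow> state \<Rightarrow> bool" where
  "flaws W X t \<longleftrightarrow> (\<forall>u<n. 2 * arr t 2 u = (if u \<in> W then card (miss E (X u) u) else 0))"

definition marks :: "nat set \<Rightarrow> state \<Rightarrow> bool" where
  "marks W t \<longleftrightarrow> (\<forall>u<n. arr t 3 u = of_bool (u \<in> W))"

text \<open>An entry in bucket \<open>c\<close> only promises at least \<open>c\<close> neighbors in
  \<open>W\<close>, so it may be obsolete, but every vertex outside \<open>W\<close> also has an
  entry in its current bucket. That bucket is measured in \<open>X u\<close>, which may lag behind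
  \<open>W\<close> during a visit.\<close>

definition buckets :: "nat set \<Rightarrow> (nat \<Rightarrow> nat set) \<Rightarrow> (nat \<Rightarrow> nat list) \<Rightarrow> nat \<Rightarrow> state \<Rightarrow> bool" where
  "buckets W X L cmax t \<longleftrightarrow>
    (\<forall>c. lseg (arr t 6) (arr t 4 c) (L c) 0) \<and>
    (\<forall>c. \<forall>e\<in>set (L c). e < vars t 7 \<and> arr t 5 e < n \<and> c \<le> card (nb E W (arr t 5 e))) \<and>
    (\<forall>u<n. u \<notin> W \<longrightarrow> u \<in> arr t 5 ` set (L (card (nb E (X u) u)))) \<and>
    (\<forall>c>cmax. L c = [])"

lemma card_nb_less: "A \<subseteq> {..<n} \<Longrightarrow> card (nb E A u) \<le> card A"
  by (rule card_mono) (auto simp: nb_def intro: finite_subset)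

lemma card_miss_le: "A \<subseteq> {..<n} \<Longrightarrow> card (miss E A u) \<le> n * n"
proof -
  assume "A \<subseteq> {..<n}"
  then have "miss E A u \<subseteq> {..<n} \<times> {..<n}" by (auto simp: miss_def nb_def)
  then have "card (miss E A u) \<le> card ({..<n} \<times> {..<n})" by (intro card_mono) auto
  then show ?thesis by simp
qed

lemma sum_length_upd:
  "c \<le> n \<Longrightarrow> (\<Sum>i\<le>n. length ((L(c := x)) i)) + length (L c) = (\<Sum>i\<le>n. length (L i)) + length x"
  for L :: "nat \<Rightarrow> nat list"
proof -
  assume c: "c \<le> n"
  have "(\<Sum>i\<in>{..n} - {c}. length ((L(c := x)) i)) = (\<Sum>i\<in>{..n} - {c}. length (L i))"
    by (intro sum.cong) auto
  then show ?thesis using c by (simp add: sum.remove[of "{..n}" c])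
qed

text \<open>The middle of a visit: the counters of the neighbors in \<open>S\<close> already include
  \<open>v\<close>. At the end \<open>S\<close> is the whole adjacency list, and for nonneighbors of
  \<open>v\<close> both cases give the same counters.\<close>

definition partial :: "nat set \<Rightarrow> nat \<Rightarrow> nat set \<Rightarrow> nat \<Rightarrow> nat set" where
  "partial A v S u = (if u \<in> S then insert v A else A)"

lemma nb_insert_card: "A \<subseteq> {..<n} \<Longrightarrow> card (nb E A u) \<le> card (nb E (insert v A) u)"
  by (rule card_mono) (auto simp: nb_def intro: finite_subset)

text \<open>The counts of unvisited vertices are at most \<open>vars s 8\<close> and grow by one at
  most, so \<open>Suc (vars s 8)\<close> bounds the top bucket afterwards. For visited neighbors,
  \<open>card_nb_le\<close> makes the subtraction of degrees safe.\<close>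

lemma wp_visit:
  assumes A: "A \<subseteq> {..<n}" and v: "v < n" "v \<notin> A" and cl: "miss E A v = {}"
    and c: "vars s 8 = card (nb E A v)" and cur: "\<And>u. u < n \<Longrightarrow> u \<notin> A \<Longrightarrow> card (nb E A u) \<le> vars s 8"
    and cv: "const_vars s" and raw: "raw_ok s" and i: "vars s 13 = off v" "vars s 14 = off (Suc v)"
    and dg: "degrees (partial A v {}) s" and fl: "flaws (insert v A) (partial A v {}) s"
    and mk: "marks (insert v A) s" and bk: "buckets (insert v A) (partial A v {}) L (Suc (vars s 8)) s"
    and v7: "vars s 7 + deg v < M" "0 < vars s 7"
  shows "wp M b q visit_code (\<lambda>s'. \<exists>L'. degrees (\<lambda>_. insert v A) s' \<and>
      flaws (insert v A) (\<lambda>_. insert v A) s' \<and> marks (insert v A) s' \<and>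
      buckets (insert v A) (\<lambda>_. insert v A) L' (Suc (vars s 8)) s' \<and>
      (\<Sum>i\<le>n. length (L' i)) \<le> (\<Sum>i\<le>n. length (L i)) + deg v \<and>
      frame {7, 12, 13, 15, 16} {1, 2, 4, 5, 6} s s' \<and>
      vars s 7 \<le> vars s' 7 \<and> vars s' 7 \<le> vars s 7 + deg v \<and>
      time s' \<le> time s + 60 * deg v + 1 \<and> asked s' = asked s) s"
    (is "wp M b q visit_code ?Q s")
proof -
  let ?W = "insert v A"
  let ?S = "\<lambda>k. set (take k (adj ! v))"
  let ?V = "{7, 12, 13, 15, 16} :: nat set"
  let ?AR = "{1, 2, 4, 5, 6} :: nat set"
  have W: "?W \<subseteq> {..<n}" using A v by auto
  have finA: "finite A" using A by (rule finite_subset) simp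
  define I where "I = (\<lambda>t. \<exists>k L'. k \<le> deg v \<and> vars t 13 = off v + k \<and>
    degrees (partial A v (?S k)) t \<and> flaws ?W (partial A v (?S k)) t \<and>
    buckets ?W (partial A v (?S k)) L' (Suc (vars s 8)) t \<and>
    (\<Sum>i\<le>n. length (L' i)) \<le> (\<Sum>i\<le>n. length (L i)) + k \<and>
    frame ?V ?AR s t \<and> vars s 7 \<le> vars t 7 \<and> vars t 7 \<le> vars s 7 + k \<and>
    time t \<le> time s + 60 * k \<and> asked t = asked s)"
  have off1: "off (Suc v) = off v + deg v" using off_Suc v by simp
  have init: "I s"
    unfolding I_def by (rule exI[of _ 0], rule exI[of _ L]) (use i dg fl bk in auto)
  show ?thesis
    unfolding visit_code_def
  proof (rule wp_While[where I = I and B = "time s + 60 * deg v"])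
    show "I s" by fact
    show "time t \<le> time s + 60 * deg v" if "I t" for t using that unfolding I_def by fastforce
    show "?Q (t\<lparr>time := time t + 1\<rparr>)" if "I t" and eq: "vars t 13 = vars t 14" for t
    proof -
      from \<open>I t\<close> obtain k L' where I: "k \<le> deg v" "vars t 13 = off v + k"
        "degrees (partial A v (?S k)) t" "flaws ?W (partial A v (?S k)) t"
        "buckets ?W (partial A v (?S k)) L' (Suc (vars s 8)) t"
        "(\<Sum>i\<le>n. length (L' i)) \<le> (\<Sum>i\<le>n. length (L i)) + k"
        "frame ?V ?AR s t" "vars s 7 \<le> vars t 7" "vars t 7 \<le> vars s 7 + k"
        "time t \<le> time s + 60 * k" "asked t = asked s" unfolding I_def by blast
      have "k = deg v" using eq I(2) frame_vars[OF I(7), of 14] i off1 by simp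
      then have S: "?S k = set (adj ! v)" by (simp add: deg_def)
      have nbX: "nb E (partial A v (?S k) u) u = nb E ?W u" for u
        using S adj_iff[OF v(1), of u] nb_nonadj[of u v E A] by (auto simp: partial_def)
      have msX: "miss E (partial A v (?S k) u) u = miss E ?W u" for u
        using nbX by (simp add: miss_def)
      have "marks ?W t" using mk I(7) by (auto simp: marks_def frame_def)
      then show ?thesis
        using I \<open>k = deg v\<close> nbX msX
        by (intro exI[of _ L']) (auto simp: degrees_def flaws_def marks_def buckets_def frame_def)
    qed
    show "wp M b q (Get 15 0 13 ;; Plus 13 13 1 ;;
      Get 16 1 15 ;; Plus 16 16 1 ;; Put 1 15 16 ;;
      Get 12 3 15 ;;
      IfEq 12 0
        (Put 5 7 15 ;; Get 12 4 16 ;; Put 6 7 12 ;; Put 4 16 7 ;; Plus 7 7 1)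
        (Minus 16 16 8 ;; Get 12 2 15 ;; Plus 12 12 16 ;; Put 2 15 12)) I (t\<lparr>time := time t + 2\<rparr>)"
      if "I t" and ne: "vars t 13 \<noteq> vars t 14" for t
    proof -
      from \<open>I t\<close> obtain k L' where I: "k \<le> deg v" "vars t 13 = off v + k"
        "degrees (partial A v (?S k)) t" "flaws ?W (partial A v (?S k)) t"
        "buckets ?W (partial A v (?S k)) L' (Suc (vars s 8)) t"
        "(\<Sum>i\<le>n. length (L' i)) \<le> (\<Sum>i\<le>n. length (L i)) + k"
        "frame ?V ?AR s t" "vars s 7 \<le> vars t 7" "vars t 7 \<le> vars s 7 + k"
        "time t \<le> time s + 60 * k" "asked t = asked s" unfolding I_def by blast
      have kd: "k < deg v" using ne I(1,2) frame_vars[OF I(7), of 14] i off1 by simp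
      define u where "u = adj ! v ! k"
      define d where "d = card (nb E ?W u)"
      have u: "u \<in> set (adj ! v)" using kd by (simp add: u_def deg_def)
      then have uE: "{u, v} \<in> E" using adj_iff v by simp
      then have un: "u < n" "u \<noteq> v" using edge_less by auto
      have uS: "u \<notin> ?S k"
        using distinct_adj[OF v(1)] kd unfolding u_def deg_def
        by (auto simp: in_set_conv_nth nth_eq_iff_index_eq)
      have Sk: "?S (Suc k) = insert u (?S k)"
        using kd by (simp add: take_Suc_conv_app_nth u_def deg_def)
      have Du: "arr t 1 u = card (nb E A u)" using I(3) un uS by (simp add: degrees_def partial_def)
      have d: "d = Suc (card (nb E A u))"
        using nb_adj[OF uE, of A] v finA by (simp add: d_def nb_def)
      have c0: "vars t 0 = 0" "vars t (Suc 0) = 1" "vars t 8 = vars s 8"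
        using cv I(7) by (auto simp: const_vars_def frame_def)
      have a0: "arr t 0 = arr s 0" "arr t 3 = arr s 3" using I(7) by (auto simp: frame_def)
      have ad: "off v + k < b" "arr t 0 (off v + k) = u"
        using off_less[OF v(1) kd] raw v kd a0 by (auto simp: raw_ok_def u_def)
      have vis: "arr t 3 u = of_bool (u \<in> A)" using mk un a0 by (auto simp: marks_def)
      have dn: "d \<le> n"
        using card_nb_less[OF W, of u] card_mono[OF _ W] by (simp add: d_def)
      have Mb: "Suc (off v + k) < M" "d < M" "vars t 7 + 1 < M" "Suc 0 < M"
        using ad b_bounds M_bounds dn v7 I(9) kd by auto
      have Xu: "partial A v (?S (Suc k)) u = ?W" by (simp add: partial_def Sk)
      have Xo: "partial A v (?S (Suc k)) x = partial A v (?S k) x" if "x \<noteq> u" for x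
        using that by (simp add: partial_def Sk)
      have fin: "I t'" if t': "vars t' 13 = off v + Suc k"
        "\<And>r. r \<notin> ?V \<Longrightarrow> vars t' r = vars t r" "\<And>r. r \<notin> ?AR \<Longrightarrow> arr t' r = arr t r"
        "arr t' 1 = (arr t 1)(u := d)" "flaws ?W (partial A v (?S (Suc k))) t'"
        "buckets ?W (partial A v (?S (Suc k))) L'' (Suc (vars s 8)) t'"
        "(\<Sum>i\<le>n. length (L'' i)) \<le> Suc (\<Sum>i\<le>n. length (L' i))"
        "vars t 7 \<le> vars t' 7" "vars t' 7 \<le> Suc (vars t 7)"
        "time t' \<le> time t + 60" "asked t' = asked t" for t' L''
        unfolding I_def
      proof (rule exI[of _ "Suc k"], rule exI[of _ L''], intro conjI)
        show "degrees (partial A v (?S (Suc k))) t'"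
          unfolding degrees_def
        proof (intro allI impI)
          fix x assume "x < n"
          then show "arr t' 1 x = card (nb E (partial A v (?S (Suc k)) x) x)"
            using t'(4) I(3) Xu Xo[of x] by (cases "x = u") (auto simp: degrees_def d_def)
        qed
      qed (use t' I kd in \<open>auto simp: frame_def\<close>)
      show ?thesis
      proof (cases "u \<in> A")
        case True
        have unb: "u \<in> nb E A v" using True uE by (simp add: nb_def)
        have cd: "vars s 8 \<le> d" using card_nb_le[OF finA v(2) cl unb] c by (simp add: d_def)
        define f where "f = arr t 2 u"
        have f2: "2 * f = card (miss E A u)" using I(4) un uS True by (simp add: flaws_def partial_def f_def)
        have fnew: "2 * (f + (d - vars s 8)) = card (miss E ?W u)"
          using card_miss_insert[OF finA v(2) irr cl unb] f2 c by (simp add: d_def)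
        have fM: "f + (d - vars s 8) < M"
        proof -
          have "f + (d - vars s 8) \<le> 2 * (f + (d - vars s 8))" by simp
          also have "\<dots> \<le> n * n" unfolding fnew by (rule card_miss_le[OF W])
          also have "\<dots> < M" by (rule M_bounds(2))
          finally show ?thesis .
        qed
        have fl': "flaws ?W (partial A v (?S (Suc k))) t'"
          if "arr t' 2 = (arr t 2)(u := f + (d - vars s 8))" for t'
          unfolding flaws_def
        proof (intro allI impI)
          fix x assume "x < n"
          then show "2 * arr t' 2 x = (if x \<in> ?W then card (miss E (partial A v (?S (Suc k)) x) x) else 0)"
            using that I(4) fnew Xu Xo[of x] True by (cases "x = u") (auto simp: flaws_def)
        qed
        have bk': "buckets ?W (partial A v (?S (Suc k))) L' (Suc (vars s 8)) t'"
          if "vars t' 7 = vars t 7" "arr t' 4 = arr t 4" "arr t' 5 = arr t 5" "arr t' 6 = arr t 6" for t'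
        proof -
          have "x \<in> arr t 5 ` set (L' (card (nb E (partial A v (?S (Suc k)) x) x)))" if "x < n" "x \<notin> ?W" for x
          proof -
            have "x \<noteq> u" using that True by auto
            then show ?thesis using that I(5) Xo[of x] by (simp add: buckets_def)
          qed
          then show ?thesis using I(5) that by (simp add: buckets_def)
        qed
        show ?thesis
          using c0 I(2) ad Du d vis True Mb cd fM f_def
          by (simp add: wp_simps) (rule fin[where L'' = L']; (rule fl' bk')?; simp)
      next
        case False
        have dc: "d \<le> Suc (vars s 8)" using cur[OF un(1) False] d by simp
        let ?e = "vars t 7"
        let ?L = "L'(d := ?e # L' d)"
        have fl': "flaws ?W (partial A v (?S (Suc k))) t'" if "arr t' 2 = arr t 2" for t'
          unfolding flaws_def
        proof (intro allI impI)
          fix x assume "x < n"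
          then show "2 * arr t' 2 x = (if x \<in> ?W then card (miss E (partial A v (?S (Suc k)) x) x) else 0)"
            using that I(4) Xo[of x] False un by (cases "x = u") (auto simp: flaws_def)
        qed
        have bk': "buckets ?W (partial A v (?S (Suc k))) ?L (Suc (vars s 8)) t'"
          if t': "vars t' 7 = Suc ?e" "arr t' 4 = (arr t 4)(d := ?e)" "arr t' 5 = (arr t 5)(?e := u)"
            "arr t' 6 = (arr t 6)(?e := arr t 4 d)" for t'
          unfolding buckets_def
        proof (intro conjI allI impI ballI)
          have new: "e < ?e" if "e \<in> set (L' c)" for e c using that I(5) unfolding buckets_def by blast
          have seg: "lseg (arr t' 6) (arr t 4 c) (L' c) 0" for c
            using new[of _ c] I(5) lseg_upd[of ?e "L' c"] unfolding t'(4) buckets_def by blast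
          show "lseg (arr t' 6) (arr t' 4 c) (?L c) 0" for c
            using seg[of c] t' v7(2) I(8) by auto
          fix c e assume e: "e \<in> set (?L c)"
          have old: "e < ?e \<and> arr t 5 e < n \<and> c \<le> card (nb E ?W (arr t 5 e))" if "e \<in> set (L' c)"
            using I(5) that by (auto simp: buckets_def)
          show "e < vars t' 7" "arr t' 5 e < n" "c \<le> card (nb E ?W (arr t' 5 e))"
            using e old t' un by (auto simp: d_def split: if_splits)
        next
          fix x assume x: "x < n" "x \<notin> ?W"
          have old: "x \<in> arr t 5 ` set (L' (card (nb E (partial A v (?S k) x) x)))"
            using I(5) x by (auto simp: buckets_def)
          have less: "e < ?e" if "e \<in> set (L' c)" for e c using that I(5) unfolding buckets_def by blast
          show "x \<in> arr t' 5 ` set (?L (card (nb E (partial A v (?S (Suc k)) x) x)))"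
          proof (cases "x = u")
            case True
            then show ?thesis using Xu t' by (simp add: d_def)
          next
            case False
            obtain e where e: "e \<in> set (L' (card (nb E (partial A v (?S k) x) x)))" "arr t 5 e = x"
              using old by auto
            then have "arr t' 5 e = x" using less[OF e(1)] t' by auto
            then show ?thesis using e Xo[OF False] by (auto intro!: image_eqI[of _ _ e])
          qed
        next
          fix c assume "Suc (vars s 8) < c"
          then show "?L c = []" using I(5) dc by (auto simp: buckets_def)
        qed
        have sum: "(\<Sum>i\<le>n. length (?L i)) \<le> Suc (\<Sum>i\<le>n. length (L' i))"
          using sum_length_upd[OF dn, of L' "?e # L' d"] by simp
        show ?thesis
          using c0 I(2) ad Du d vis False Mb sum un
          by (simp add: wp_simps) (rule fin[where L'' = ?L]; (rule fl' bk')?; simp)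
      qed
    qed
  qed
qed


lemma mcs_snoc:
  assumes "mcs E V xs" "\<And>y. y \<in> V - set xs \<Longrightarrow> card (nb E (set xs) y) \<le> card (nb E (set xs) v)"
  shows "mcs E V (xs @ [v])"
  using assms by (auto simp: mcs_def nth_append less_Suc_eq)

lemma wp_mcs:
  assumes cv: "const_vars s" and raw: "raw_ok s" and v2: "vars s 2 = n" and v8: "vars s 8 = 0"
    and v7: "vars s 7 = n + 1"
    and dg: "degrees (\<lambda>_. {}) s" and fl: "flaws {} (\<lambda>_. {}) s" and mk: "marks {} s"
    and bk: "buckets {} (\<lambda>_. {}) L0 0 s" and L0: "(\<Sum>i\<le>n. length (L0 i)) \<le> n"
  shows "wp M b q mcs_code (\<lambda>s'. degrees (\<lambda>_. {..<n}) s' \<and> flaws {..<n} (\<lambda>_. {..<n}) s' \<and>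
      marks {..<n} s' \<and> frame {7..16} {1..6} s s' \<and>
      time s' \<le> time s + 180 * n + 240 * m + 2 \<and> asked s' = asked s) s"
    (is "wp M b q mcs_code ?Q s")
proof -
  \<comment> \<open>Amortization: 60 steps for each bucket entry and each unit of the top index, and
    \<open>2 * deg x + 2\<close> such shares for each unvisited \<open>x\<close>:
    \<open>deg x\<close> for its loop, \<open>deg x\<close> for the entries pushed, one for the rise
    of the top and one for the visit itself.\<close>
  let ?T = "time s + 1 + 60 * (n + (\<Sum>x<n. 2 * deg x + 2))"
  have sum2: "(\<Sum>x<n. 2 * deg x + 2) \<le> 4 * m + 2 * n"
  proof -
    have "(\<Sum>x<n. 2 * deg x + 2) = (\<Sum>x<n. 2 * deg x) + (\<Sum>x<n. 2)" by (rule sum.distrib)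
    also have "\<dots> = 2 * (\<Sum>x<n. deg x) + 2 * n" by (simp add: sum_distrib_left)
    finally show ?thesis using sum_deg by linarith
  qed
  define I where "I = (\<lambda>t. \<exists>xs L. distinct xs \<and> set xs \<subseteq> {..<n} \<and> mcs E {..<n} xs \<and>
    vars t 9 = n - length xs \<and> vars t 8 \<le> length xs \<and>
    degrees (\<lambda>_. set xs) t \<and> flaws (set xs) (\<lambda>_. set xs) t \<and> marks (set xs) t \<and>
    buckets (set xs) (\<lambda>_. set xs) L (vars t 8) t \<and>
    0 < vars t 7 \<and> vars t 7 \<le> n + 1 + (\<Sum>x\<in>set xs. deg x) \<and> frame {7..16} {1..6} s t \<and>
    time t + 60 * ((\<Sum>i\<le>n. length (L i)) + vars t 8 + (\<Sum>x\<in>{..<n} - set xs. 2 * deg x + 2)) \<le> ?T \<and>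
    asked t = asked s)"
  let ?visit = "Put 3 11 1 ;; Minus 9 9 1 ;;
          Plus 12 11 1 ;; Get 13 0 12 ;; Plus 12 12 1 ;; Get 14 0 12 ;;
          visit_code ;; Plus 8 8 1"
  let ?body = "Get 10 4 8 ;;
      IfEq 10 0 (Minus 8 8 1) (
        Get 11 5 10 ;; Get 12 6 10 ;; Put 4 8 12 ;;
        Get 12 3 11 ;;
        IfEq 12 0 (?visit)
          Nop)"
  have init: "I s1" if s1: "vars s1 = (vars s)(9 := n)" "arr s1 = arr s" "asked s1 = asked s"
    "time s1 = Suc (time s)" for s1
    unfolding I_def
  proof (rule exI[of _ "[]"], rule exI[of _ L0], intro conjI)
    show "degrees (\<lambda>_. set []) s1" using dg s1 by (simp add: degrees_def)
    show "flaws (set []) (\<lambda>_. set []) s1" using fl s1 by (simp add: flaws_def)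
    show "marks (set []) s1" using mk s1 by (simp add: marks_def)
    show "buckets (set []) (\<lambda>_. set []) L0 (vars s1 8) s1" using bk s1 v8 by (simp add: buckets_def)
  qed (use s1 v8 v7 L0 in \<open>auto simp: mcs_def frame_def\<close>)
  have body: "wp M b q ?body I (t\<lparr>time := time t + 2\<rparr>)"
    if "I t" and ne: "vars t 9 \<noteq> vars t 0" for t
  proof -
    from \<open>I t\<close> obtain xs L where I: "distinct xs" "set xs \<subseteq> {..<n}" "mcs E {..<n} xs"
      "vars t 9 = n - length xs" "vars t 8 \<le> length xs"
      "degrees (\<lambda>_. set xs) t" "flaws (set xs) (\<lambda>_. set xs) t" "marks (set xs) t"
      "buckets (set xs) (\<lambda>_. set xs) L (vars t 8) t"
      "0 < vars t 7" "vars t 7 \<le> n + 1 + (\<Sum>x\<in>set xs. deg x)" "frame {7..16} {1..6} s t"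
      "time t + 60 * ((\<Sum>i\<le>n. length (L i)) + vars t 8 + (\<Sum>x\<in>{..<n} - set xs. 2 * deg x + 2)) \<le> ?T"
      "asked t = asked s" unfolding I_def by blast
    let ?A = "set xs"
    have c0: "vars t 0 = 0" "vars t 1 = 1" using cv I(12) by (auto simp: const_vars_def frame_def)
    have a0: "arr t 0 = arr s 0" using I(12) by (auto simp: frame_def)
    obtain c where c: "vars t 8 = c" by simp
    have len: "length xs < n" using ne c0 I(4) by simp
    have cn: "c < n" using I(5) len c by simp
    have seg: "lseg (arr t 6) (arr t 4 i) (L i) 0" for i using I(9) by (simp add: buckets_def)
    have top: "L i = []" if "c < i" for i using I(9) that c by (simp add: buckets_def)
    have here: "u \<in> arr t 5 ` set (L (card (nb E ?A u)))" if "u < n" "u \<notin> ?A" for u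
      using I(9) that by (auto simp: buckets_def)
    \<comment> \<open>Every unvisited vertex has an entry in its current bucket, and the buckets
      above \<open>c\<close> are empty.\<close>
    have le_c: "card (nb E ?A u) \<le> c" if u: "u < n" "u \<notin> ?A" for u
      using here[OF u] top[of "card (nb E ?A u)"] by (cases "c < card (nb E ?A u)") auto
    show ?thesis
    proof (cases "L c")
      case Nil
      have "\<exists>u<n. u \<notin> ?A"
      proof (rule ccontr)
        assume "\<not> ?thesis"
        then have "{..<n} \<subseteq> ?A" by auto
        then have "n \<le> card ?A" using card_mono[of ?A "{..<n}"] by simp
        then show False using len I(1) by (simp add: distinct_card)
      qed
      then obtain u where u: "u < n" "u \<notin> ?A" by auto
      have "card (nb E ?A u) \<noteq> c" using here[OF u] Nil by auto
      \<comment> \<open>Some vertex is unvisited and its current bucket is nonempty, so that bucket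
        lies strictly below \<open>c\<close> and the top may be lowered.\<close>
      then have c1: "1 \<le> c" using le_c[OF u] by simp
      have h: "arr t 4 c = 0" using seg[of c] Nil by simp
      have fin: "I t'" if t': "vars t' 8 = c - 1" "\<And>r. r \<notin> {8, 10} \<Longrightarrow> vars t' r = vars t r"
        "arr t' = arr t" "asked t' = asked t" "time t' \<le> time t + 60" for t'
        unfolding I_def
      proof (rule exI[of _ xs], rule exI[of _ L], intro conjI)
        have "L i = []" if "vars t' 8 < i" for i
          using that t'(1) top[of i] Nil c1 by (cases "i = c") auto
        then show "buckets ?A (\<lambda>_. ?A) L (vars t' 8) t'" using I(9) t' by (simp add: buckets_def)
        show "time t' + 60 * ((\<Sum>i\<le>n. length (L i)) + vars t' 8 + (\<Sum>x\<in>{..<n} - set xs. 2 * deg x + 2)) \<le> ?T"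
          using t' I(13) c c1 by simp
        show "frame {7..16} {1..6} s t'" using I(12) t' by (auto simp: frame_def)
      qed (use t' I c in \<open>auto simp: degrees_def flaws_def marks_def\<close>)
      show ?thesis using c0 c c1 h
        by (simp add: wp_simps del: One_nat_def) (rule fin; simp)
    next
      case (Cons e es)
      define v where "v = arr t 5 e"
      let ?L = "L(c := es)"
      have e4: "arr t 4 c = e" "e \<noteq> 0" "lseg (arr t 6) (arr t 6 e) es 0" using seg[of c] Cons by auto
      have ent: "\<forall>e\<in>set (L i). e < vars t 7 \<and> arr t 5 e < n \<and> i \<le> card (nb E ?A (arr t 5 e))" for i
        using I(9) by (simp add: buckets_def)
      have v: "v < n" "c \<le> card (nb E ?A v)" using ent[of c] Cons by (auto simp: v_def)
      have sumL: "(\<Sum>i\<le>n. length (?L i)) + 1 = (\<Sum>i\<le>n. length (L i))"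
        using sum_length_upd[of c L es] cn Cons by simp
      have vis: "arr t 3 v = of_bool (v \<in> ?A)" using I(8) v by (simp add: marks_def)
      have segL: "lseg (arr t 6) (((arr t 4)(c := arr t 6 e)) i) (?L i) 0" for i
        using seg[of i] e4 by simp
      have entL: "e' < vars t 7 \<and> arr t 5 e' < n \<and> i \<le> card (nb E ?A (arr t 5 e'))"
        if "e' \<in> set (?L i)" for i e'
        using that ent[of i] Cons by (auto split: if_splits)
      have hereL: "u \<in> arr t 5 ` set (?L (card (nb E ?A u)))" if "u < n" "u \<notin> ?A" "u \<noteq> v" for u
        using here[OF that(1,2)] that(3) Cons by (cases "card (nb E ?A u) = c") (auto simp: v_def)
      have topL: "?L i = []" if "c < i" for i using top[OF that] that by simp
      show ?thesis
      proof (cases "v \<in> ?A")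
        case True
        have fin: "I t'" if t': "\<And>r. r \<notin> {10, 11, 12} \<Longrightarrow> vars t' r = vars t r"
          "arr t' = (arr t)(4 := (arr t 4)(c := arr t 6 e))" "asked t' = asked t" "time t' \<le> time t + 60" for t'
          unfolding I_def
        proof (rule exI[of _ xs], rule exI[of _ ?L], intro conjI)
          have "u \<in> arr t 5 ` set (?L (card (nb E ?A u)))" if "u < n" "u \<notin> ?A" for u
          proof -
            have "u \<noteq> v" using that True by auto
            then show ?thesis by (rule hereL[OF that])
          qed
          then show "buckets ?A (\<lambda>_. ?A) ?L (vars t' 8) t'"
            using segL entL topL t' c unfolding buckets_def by simp
          show "time t' + 60 * ((\<Sum>i\<le>n. length (?L i)) + vars t' 8 + (\<Sum>x\<in>{..<n} - set xs. 2 * deg x + 2)) \<le> ?T"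
            using t' I(13) c sumL by simp
          show "frame {7..16} {1..6} s t'" using I(12) t' by (auto simp: frame_def)
        qed (use t' I c in \<open>auto simp: degrees_def flaws_def marks_def\<close>)
        show ?thesis using c0 c e4(1,2) vis True
          by (simp add: wp_simps v_def[symmetric] del: One_nat_def) (rule fin; simp)
      next
        case False
        let ?W = "insert v ?A"
        let ?D = "{..<n} - ?A"
        have cd: "card (nb E ?A v) = c" using le_c[OF v(1) False] v(2) by simp
        have mcs': "mcs E {..<n} (xs @ [v])"
          using I(3) le_c cd by (intro mcs_snoc) auto
        \<comment> \<open>The list extended by \<open>v\<close> is again a maximum cardinality
          search, so chordality applies to its last entry.\<close>
        have cl: "miss E ?A v = {}"
          using mcs_simplicial[of G "xs @ [v]" "length xs"] ch irr I(1,2) False v(1) mcs' verts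
          by (auto simp: E_def nth_append)
        have offs: "arr t 0 (Suc v) = off v" "arr t 0 (Suc (Suc v)) = off (Suc v)" "Suc (Suc v) < b"
          using raw v(1) a0 b_bounds by (auto simp: raw_ok_def)
        have sumA: "(\<Sum>x\<in>?W. deg x) = deg v + (\<Sum>x\<in>?A. deg x)" using False by simp
        have "(\<Sum>x\<in>?W. deg x) \<le> (\<Sum>x<n. deg x)" using I(2) v by (intro sum_mono2) auto
        then have le7: "vars t 7 + deg v \<le> n + 1 + 2 * m" using I(11) sumA sum_deg by simp
        have sumD: "(\<Sum>x\<in>?D. 2 * deg x + 2) = 2 * deg v + 2 + (\<Sum>x\<in>{..<n} - ?W. 2 * deg x + 2)"
        proof -
          have "?D - {v} = {..<n} - ?W" by auto
          then show ?thesis using v False by (simp add: sum.remove[of ?D v])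
        qed
        have vst: "wp M b q visit_code (wp M b q (Plus 8 8 1) I) t1"
          if t1: "vars t1 13 = off v" "vars t1 14 = off (Suc v)" "vars t1 9 = vars t 9 - 1"
            "\<And>r. r \<notin> {9, 10, 11, 12, 13, 14} \<Longrightarrow> vars t1 r = vars t r"
            "arr t1 = (arr t)(4 := (arr t 4)(c := arr t 6 e), 3 := (arr t 3)(v := 1))"
            "asked t1 = asked t" "time t1 \<le> time t + 58" for t1
        proof (rule wp_mono[OF wp_visit[where A = ?A and v = v and L = ?L]])
          show "set xs \<subseteq> {..<n}" "v < n" "v \<notin> ?A" "miss E ?A v = {}" by fact+
          show "vars t1 8 = card (nb E ?A v)" using t1 c cd by simp
          show "card (nb E ?A u) \<le> vars t1 8" if "u < n" "u \<notin> ?A" for u using le_c[OF that] t1 c by simp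
          show "const_vars t1" using t1 c0 by (simp add: const_vars_def)
          show "raw_ok t1" using raw a0 t1 by (simp add: raw_ok_def)
          show "vars t1 13 = off v" "vars t1 14 = off (Suc v)" by fact+
          show "degrees (partial ?A v {}) t1" using I(6) t1 by (simp add: degrees_def partial_def)
          show "flaws ?W (partial ?A v {}) t1"
            using I(7) t1 cl False by (auto simp: flaws_def partial_def)
          show "marks ?W t1" using I(8) t1 by (auto simp: marks_def)
          show "buckets ?W (partial ?A v {}) ?L (Suc (vars t1 8)) t1"
            unfolding buckets_def
          proof (intro conjI allI ballI impI)
            show "lseg (arr t1 6) (arr t1 4 i) (?L i) 0" for i using segL[of i] t1 by simp
            show "e' < vars t1 7" "arr t1 5 e' < n" "i \<le> card (nb E ?W (arr t1 5 e'))"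
              if "e' \<in> set (?L i)" for i e'
              using entL[OF that] t1 nb_insert_card[OF I(2), of "arr t 5 e'" v] by simp_all
            show "u \<in> arr t1 5 ` set (?L (card (nb E (partial ?A v {} u) u)))" if "u < n" "u \<notin> ?W" for u
              using hereL[of u] that t1 by (simp add: partial_def)
            show "?L i = []" if "Suc (vars t1 8) < i" for i using topL[of i] that t1 c by simp
          qed
          show "vars t1 7 + deg v < M" using le7 t1 M_bounds by simp
          show "0 < vars t1 7" using t1 I(10) by simp
          fix t2
          assume "\<exists>L'. degrees (\<lambda>_. ?W) t2 \<and> flaws ?W (\<lambda>_. ?W) t2 \<and> marks ?W t2 \<and>
            buckets ?W (\<lambda>_. ?W) L' (Suc (vars t1 8)) t2 \<and>
            (\<Sum>i\<le>n. length (L' i)) \<le> (\<Sum>i\<le>n. length (?L i)) + deg v \<and>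
            frame {7, 12, 13, 15, 16} {1, 2, 4, 5, 6} t1 t2 \<and>
            vars t1 7 \<le> vars t2 7 \<and> vars t2 7 \<le> vars t1 7 + deg v \<and>
            time t2 \<le> time t1 + 60 * deg v + 1 \<and> asked t2 = asked t1"
          then obtain L' where t2: "degrees (\<lambda>_. ?W) t2" "flaws ?W (\<lambda>_. ?W) t2" "marks ?W t2"
            "buckets ?W (\<lambda>_. ?W) L' (Suc (vars t1 8)) t2"
            "(\<Sum>i\<le>n. length (L' i)) \<le> (\<Sum>i\<le>n. length (?L i)) + deg v"
            "frame {7, 12, 13, 15, 16} {1, 2, 4, 5, 6} t1 t2"
            "vars t1 7 \<le> vars t2 7" "vars t2 7 \<le> vars t1 7 + deg v"
            "time t2 \<le> time t1 + 60 * deg v + 1" "asked t2 = asked t1" by blast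
          have t2v: "vars t2 0 = 0" "vars t2 1 = 1" "vars t2 8 = c" "vars t2 9 = n - length (xs @ [v])"
            using t2(6) t1 c0 c I(4) by (auto simp: frame_def)
          have fr: "frame {7..16} {1..6} s t2"
            using I(12) t1(4,5) t2(6) by (auto simp: frame_def)
          have "I t3" if t3: "vars t3 8 = Suc c" "\<And>r. r \<noteq> 8 \<Longrightarrow> vars t3 r = vars t2 r" "arr t3 = arr t2"
            "asked t3 = asked t2" "time t3 = Suc (time t2)" for t3
            unfolding I_def
          proof (rule exI[of _ "xs @ [v]"], rule exI[of _ L'], intro conjI)
            have W: "set (xs @ [v]) = ?W" by simp
            show "degrees (\<lambda>_. set (xs @ [v])) t3" using t2(1) t3 by (simp add: degrees_def)
            show "flaws (set (xs @ [v])) (\<lambda>_. set (xs @ [v])) t3" using t2(2) t3 by (simp add: flaws_def)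
            show "marks (set (xs @ [v])) t3" using t2(3) t3 by (simp add: marks_def)
            show "buckets (set (xs @ [v])) (\<lambda>_. set (xs @ [v])) L' (vars t3 8) t3"
              using t2(4) t3 t1(4)[of 8] c by (simp add: buckets_def)
            show "vars t3 9 = n - length (xs @ [v])" using t3 t2v by simp
            show "vars t3 7 \<le> n + 1 + (\<Sum>x\<in>set (xs @ [v]). deg x)"
              using t3 t2(8) t1(4)[of 7] I(11) sumA by simp
            show "0 < vars t3 7" using t3 t2(7) t1(4)[of 7] I(10) by simp
            show "frame {7..16} {1..6} s t3" using fr t3 by (auto simp: frame_def)
            show "time t3 + 60 * ((\<Sum>i\<le>n. length (L' i)) + vars t3 8 +
                (\<Sum>x\<in>{..<n} - set (xs @ [v]). 2 * deg x + 2)) \<le> ?T"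
              using t3 t2(5,9) t1(7) I(13) c sumL sumD by simp
          qed (use t3 t2 t1 I False v mcs' c in auto)
          then show "wp M b q (Plus 8 8 1) I t2"
            using t2v cn M_bounds by (simp add: wp_simps del: One_nat_def)
        qed
        have Mb: "Suc v < M" "Suc (Suc v) < M" "Suc v < b" using v(1) M_bounds offs by auto
        have offs': "arr t 0 (v + 1) = off v" "arr t 0 (v + 1 + 1) = off (Suc v)"
          "v + 1 < M" "v + 1 + 1 < M" "v + 1 < b" "v + 1 + 1 < b" "1 \<le> n - length xs"
          using offs Mb len by auto
        show ?thesis using c0 c e4(1,2) vis False offs' I(4)
          by (simp add: wp_simps v_def[symmetric] del: One_nat_def) (rule vst; simp)
      qed
    qed
  qed
  have exit: "?Q (t\<lparr>time := time t + 1\<rparr>)" if "I t" "vars t 9 = vars t 0" for t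
  proof -
    from \<open>I t\<close> obtain xs L where I: "distinct xs" "set xs \<subseteq> {..<n}" "mcs E {..<n} xs"
      "vars t 9 = n - length xs" "vars t 8 \<le> length xs"
      "degrees (\<lambda>_. set xs) t" "flaws (set xs) (\<lambda>_. set xs) t" "marks (set xs) t"
      "buckets (set xs) (\<lambda>_. set xs) L (vars t 8) t"
      "0 < vars t 7" "vars t 7 \<le> n + 1 + (\<Sum>x\<in>set xs. deg x)" "frame {7..16} {1..6} s t"
      "time t + 60 * ((\<Sum>i\<le>n. length (L i)) + vars t 8 + (\<Sum>x\<in>{..<n} - set xs. 2 * deg x + 2)) \<le> ?T"
      "asked t = asked s" unfolding I_def by blast
    have "vars t 0 = 0" using cv I(12) by (auto simp: const_vars_def frame_def)
    then have "card {..<n} \<le> card (set xs)" using that(2) I(1,4) by (simp add: distinct_card)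
    then have "set xs = {..<n}" using I(2) by (intro card_seteq) auto
    then show ?thesis
      using I sum2 by (simp add: degrees_def flaws_def marks_def frame_def)
  qed
  have "wp M b q (WhileNeq 9 0 ?body) ?Q s1" if s1: "vars s1 = (vars s)(9 := n)" "arr s1 = arr s"
    "asked s1 = asked s" "time s1 = Suc (time s)" for s1
  proof (rule wp_While[where I = I and B = ?T])
    show "I s1" using s1 by (rule init)
    show "time t \<le> ?T" if "I t" for t using that unfolding I_def by fastforce
  qed (use body exit in auto)
  then show ?thesis
    using cv v2 M_bounds unfolding mcs_code_def
    by (simp add: wp_Seq wp_Plus const_vars_def del: One_nat_def)
qed

end

section \<open>Heap operations and their amortized cost\<close>

lemma potential_le: "potential j ls \<le> (j + length ls) * length (concat (map snd ls))"
proof (induction j ls rule: potential.induct)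
  case (2 j b R ls)
  have "(j + of_bool b) * length R \<le> (j + Suc (length ls)) * length R"
    by (intro mult_le_mono) (auto simp: of_bool_def)
  then show ?case using 2 by (simp add: algebra_simps)
qed simp

text \<open>The potential records the merges in which the present elements have taken part. A
  removed element withdraws its share, at most \<open>i + 1\<close> for level \<open>i\<close> when
  levels are numbered from 0, and the removal has to account for it.\<close>

lemma potential_upd:
  "i < length ls \<Longrightarrow> run_at ls i = p # R \<Longrightarrow>
    potential j ls \<le> potential j (upd ls i (bit_at ls i, R)) + (j + i + 1)"
proof (induction j ls arbitrary: i rule: potential.induct)
  case (2 j b R' ls)
  show ?case
  proof (cases i)
    case 0
    then show ?thesis using 2 by (auto simp: upd_def run_at_def bit_at_def)
  next
    case (Suc k)
    then have "potential (Suc j) ls \<le> potential (Suc j) (upd ls k (bit_at ls k, R)) + (Suc j + k + 1)"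
      using 2 by (intro "2.IH") (auto simp: run_at_Cons)
    then show ?thesis using Suc 2(2) by (simp add: upd_def bit_at_def)
  qed
qed simp

lemma ones_upd: "i < length ls \<Longrightarrow> ones (upd ls i (bit_at ls i, R)) = ones ls"
proof (induction ls arbitrary: i)
  case (Cons l ls)
  then show ?case by (cases i) (auto simp: upd_def ones_def bit_at_def)
qed simp

lemma length_upd: "i < length ls \<Longrightarrow> length (upd ls i x) = length ls"
  by (simp add: upd_def)

lemma heap_sorted_upd:
  "heap_sorted rk ls \<Longrightarrow> i < length ls \<Longrightarrow> run_at ls i = p # R \<Longrightarrow>
    heap_sorted rk (upd ls i (x, R))"
proof -
  assume *: "heap_sorted rk ls" "i < length ls" "run_at ls i = p # R"
  then have "ls ! i \<in> set ls" "snd (ls ! i) = p # R" by (auto simp: run_at_def)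
  then have "sorted (map rk (p # R))" using *(1) unfolding heap_sorted_def by metis
  then have "sorted (map rk R)" by simp
  then show ?thesis
    using * set_update_subset_insert[of ls i "(x, R)"] unfolding heap_sorted_def upd_def by fastforce
qed

lemma mset_upd:
  "i < length ls \<Longrightarrow> run_at ls i = p # R \<Longrightarrow>
    mset (concat (map snd ls)) = add_mset p (mset (concat (map snd (upd ls i (x, R)))))"
proof (induction ls arbitrary: i)
  case (Cons l ls)
  show ?case
  proof (cases i)
    case 0
    then show ?thesis using Cons by (simp add: upd_def run_at_def)
  next
    case (Suc k)
    then have "mset (concat (map snd ls)) = add_mset p (mset (concat (map snd (upd ls k (x, R)))))"
      using Cons by (intro Cons.IH) (auto simp: run_at_Cons)
    then show ?thesis using Suc Cons(2) by (simp add: upd_def)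
  qed
qed simp

section \<open>Elimination order, ranks and the heap invariant\<close>

locale elimination_input = chordal_input +
  fixes \<pi> :: "nat list"
  assumes elim: "elim (edges G) (verts G) \<pi>"
begin

lemma elim': "elim E {..<n} \<pi>"
  using elim verts by (simp add: E_def)

lemma pi: "distinct \<pi>" "set \<pi> = {..<n}" "length \<pi> = n"
  "i < n \<Longrightarrow> miss E ({..<n} - set (take i \<pi>)) (\<pi> ! i) = {}"
proof -
  show d: "distinct \<pi>" "set \<pi> = {..<n}" using elim' by (simp_all add: elim_iff)
  then show l: "length \<pi> = n" using distinct_card[of \<pi>] by simp
  show "i < n \<Longrightarrow> miss E ({..<n} - set (take i \<pi>)) (\<pi> ! i) = {}"
    using elim' l by (simp add: elim_iff)
qed

definition rk :: "nat \<Rightarrow> nat" where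
  "rk p = (LEAST i. \<pi> ! i = p - 1)"

lemma rk: "i < n \<Longrightarrow> rk (Suc (\<pi> ! i)) = i"
proof -
  assume i: "i < n"
  show ?thesis unfolding rk_def
  proof (rule Least_equality)
    show "i \<le> j" if "\<pi> ! j = Suc (\<pi> ! i) - 1" for j
      using that pi i by (cases "j < n") (auto simp: nth_eq_iff_index_eq)
  qed simp
qed

lemma ranked_pi: "ranked M (precedes \<pi>) rk (Suc ` {..<n})"
proof -
  have "precedes \<pi> x y \<longleftrightarrow> rk (Suc x) < rk (Suc y)" if xy: "x < n" "y < n" for x y
  proof -
    obtain i j where ij: "i < n" "\<pi> ! i = x" "j < n" "\<pi> ! j = y"
      using xy pi(2,3) by (metis in_set_conv_nth lessThan_iff)
    have "precedes \<pi> x y \<longleftrightarrow> i < j"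
      using ij pi(1,3) unfolding precedes_def
      by (metis nth_eq_iff_index_eq order.strict_trans)
    then show ?thesis using rk[OF ij(1)] rk[OF ij(3)] ij by simp
  qed
  moreover have "Suc ` {..<n} \<subseteq> {1..<M}" using M_bounds by auto
  ultimately show ?thesis by (auto simp: ranked_def)
qed

abbreviation q :: "nat \<Rightarrow> nat \<Rightarrow> bool" where "q \<equiv> precedes \<pi>"

text \<open>
  \<open>Ins\<close> is the set of vertices inserted so far and \<open>ps\<close> the set of removed ones. Times are
  measured in insertions: \<open>v\<close> is inserted at time \<open>s v\<close> and removed at time \<open>e v\<close>, at level \<open>lg v\<close>.
\<close>
definition heap_inv :: "nat set \<Rightarrow> nat set \<Rightarrow> nat \<Rightarrow> nat \<Rightarrow> state \<Rightarrow> bool" where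
  "heap_inv Ins ps tb ab t \<longleftrightarrow> (\<exists>ls s e lg.
    heap_repr rk t ls \<and> heap_sorted rk ls \<and> distinct (concat (map snd ls)) \<and>
    elems ls = Suc ` (Ins - ps) \<and> ps \<subseteq> Ins \<and> Ins \<subseteq> {..<n} \<and>
    aged (\<lambda>p. s (p - 1)) (card Ins) 0 ls \<and> length ls \<le> card Ins \<and>
    (\<forall>v\<in>Ins. s v < card Ins \<and> miss E ({..<n} - {u \<in> ps. e u < s v}) v = {}) \<and>
    (\<forall>v\<in>ps. s v \<le> e v \<and> e v < card Ins \<and> 2 ^ lg v \<le> Suc (e v - s v)) \<and>
    time t + 80 * ones ls \<le> tb + 60 * potential 0 ls + 280 * card Ins + (\<Sum>v\<in>ps. 120 * lg v + 180) \<and>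
    asked t + ones ls \<le> ab + potential 0 ls + 2 * card Ins + (\<Sum>v\<in>ps. 2 * lg v + 2))"

text \<open>A crude quadratic bound that supplies the termination premise of
  \<open>wp_While\<close>. The estimate for the theorem comes from
  \<open>heap_inv_final\<close>.\<close>

definition time_limit :: nat where
  "time_limit = 60 * (n * n) + 280 * n + n * (120 * n + 180)"

lemma heap_inv_time: "heap_inv Ins ps tb ab t \<Longrightarrow> time t \<le> tb + time_limit"
proof -
  assume "heap_inv Ins ps tb ab t"
  then obtain ls s e lg where h: "distinct (concat (map snd ls))"
    "elems ls = Suc ` (Ins - ps)" "ps \<subseteq> Ins" "Ins \<subseteq> {..<n}" "length ls \<le> card Ins"
    "\<forall>v\<in>ps. s v \<le> e v \<and> e v < card Ins \<and> 2 ^ lg v \<le> Suc (e v - s v)"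
    "time t + 80 * ones ls \<le> tb + 60 * potential 0 ls + 280 * card Ins + (\<Sum>v\<in>ps. 120 * lg v + 180)"
    unfolding heap_inv_def by (elim exE conjE) (rule that)
  have In: "card Ins \<le> n" using card_mono[OF _ h(4)] by simp
  have "length (concat (map snd ls)) = card (elems ls)"
    by (simp only: elems_def distinct_card[OF h(1)])
  also have "\<dots> \<le> card (Suc ` {..<n})" using h(2,4) by (intro card_mono) auto
  also have "\<dots> = n" by (simp add: card_image)
  finally have len: "length (concat (map snd ls)) \<le> n" .
  have "potential 0 ls \<le> length ls * length (concat (map snd ls))"
    using potential_le[of 0 ls] by simp
  also have "\<dots> \<le> n * n" using len h(5) In by (intro mult_le_mono) auto
  finally have "potential 0 ls \<le> n * n" .
  moreover have "(\<Sum>v\<in>ps. 120 * lg v + 180) \<le> (\<Sum>v\<in>ps. 120 * n + 180)"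
  proof (rule sum_mono)
    fix v assume "v \<in> ps"
    then have "2 ^ lg v \<le> Suc (e v - s v)" "e v < card Ins" using h(6) by auto
    then have "2 ^ lg v \<le> n" using In by linarith
    then have "lg v \<le> n" using less_exp[of "lg v"] by linarith
    then show "120 * lg v + 180 \<le> 120 * n + 180" by simp
  qed
  moreover have "(\<Sum>v\<in>ps. 120 * n + 180) \<le> n * (120 * n + 180)"
    using card_mono[of "{..<n}" ps] h(3,4) by simp
  ultimately show ?thesis using h(7) In unfolding time_limit_def by linarith
qed

text \<open>Steps spent outside the heap operations are moved into the base \<open>tb\<close>, so
  they are accounted for separately.\<close>

lemma heap_inv_mono:
  assumes "heap_inv Ins ps tb ab t" "\<And>k. k \<in> {7, 8, 9, 10} \<Longrightarrow> arr t' k = arr t k"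
    "time t' + tb \<le> time t + tb'" "asked t' = asked t"
  shows "heap_inv Ins ps tb' ab t'"
proof -
  from assms(1) obtain ls s e lg where h: "heap_repr rk t ls" "heap_sorted rk ls" "distinct (concat (map snd ls))"
    "elems ls = Suc ` (Ins - ps)" "ps \<subseteq> Ins" "Ins \<subseteq> {..<n}"
    "aged (\<lambda>p. s (p - 1)) (card Ins) 0 ls" "length ls \<le> card Ins"
    "\<forall>v\<in>Ins. s v < card Ins \<and> miss E ({..<n} - {u \<in> ps. e u < s v}) v = {}"
    "\<forall>v\<in>ps. s v \<le> e v \<and> e v < card Ins \<and> 2 ^ lg v \<le> Suc (e v - s v)"
    "time t + 80 * ones ls \<le> tb + 60 * potential 0 ls + 280 * card Ins + (\<Sum>v\<in>ps. 120 * lg v + 180)"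
    "asked t + ones ls \<le> ab + potential 0 ls + 2 * card Ins + (\<Sum>v\<in>ps. 2 * lg v + 2)"
    unfolding heap_inv_def by (elim exE conjE) (rule that)
  have "heap_repr rk t' ls"
    using h(1) assms(2) by (simp add: heap_repr_def levels_def)
  moreover have "time t' + 80 * ones ls \<le> tb' + 60 * potential 0 ls + 280 * card Ins + (\<Sum>v\<in>ps. 120 * lg v + 180)"
    using h(11) assms(3) by linarith
  ultimately show ?thesis
    unfolding heap_inv_def using h assms(4)
    by (intro exI[of _ ls] exI[of _ s] exI[of _ e] exI[of _ lg] conjI) simp_all
qed

text \<open>The new vertex gets \<open>s v = card Ins\<close>, the number of earlier insertions. All
  removals so far have \<open>e u < card Ins\<close>, so the vertices with \<open>e u < s v\<close>
  are exactly \<open>ps\<close>, after whose removal \<open>v\<close> is simplicial. The 280 steps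
  per insertion are 200 for the operation and 80 for the bit that becomes set.\<close>

lemma wp_heap_insert:
  assumes hi: "heap_inv Ins ps tb ab t" and v: "v < n" "v \<notin> Ins" "vars t 21 = Suc v"
    and smp: "miss E ({..<n} - ps) v = {}" and cv: "const_vars t"
  shows "wp M b q insert_code (\<lambda>t'. heap_inv (insert v Ins) ps tb ab t' \<and>
    frame {30..41} {7, 8, 9, 10} t t') t"
proof -
  from hi obtain ls s e lg where h: "heap_repr rk t ls" "heap_sorted rk ls" "distinct (concat (map snd ls))"
    "elems ls = Suc ` (Ins - ps)" "ps \<subseteq> Ins" "Ins \<subseteq> {..<n}"
    "aged (\<lambda>p. s (p - 1)) (card Ins) 0 ls" "length ls \<le> card Ins"
    "\<forall>v\<in>Ins. s v < card Ins \<and> miss E ({..<n} - {u \<in> ps. e u < s v}) v = {}"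
    "\<forall>v\<in>ps. s v \<le> e v \<and> e v < card Ins \<and> 2 ^ lg v \<le> Suc (e v - s v)"
    "time t + 80 * ones ls \<le> tb + 60 * potential 0 ls + 280 * card Ins + (\<Sum>v\<in>ps. 120 * lg v + 180)"
    "asked t + ones ls \<le> ab + potential 0 ls + 2 * card Ins + (\<Sum>v\<in>ps. 2 * lg v + 2)"
    unfolding heap_inv_def by (elim exE conjE) (rule that)
  let ?p = "Suc v"
  let ?T = "card Ins"
  have finI: "finite Ins" using h(6) by (rule finite_subset) simp
  have In: "?T \<le> n" using card_mono[OF _ h(6)] by simp
  have cI: "card (insert v Ins) = Suc ?T" using finI v by simp
  have pnot: "?p \<notin> elems ls" using h(4) v by auto
  have U: "vars t 21 \<in> Suc ` {..<n}" "elems ls \<subseteq> Suc ` {..<n}" using v h(4,6) by auto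
  have d: "distinct (vars t 21 # concat (map snd ls))" using h(3) pnot v by (simp add: elems_def)
  have lenM: "length ls + 1 < M" using h(8) In M_bounds by simp
  show ?thesis
  proof (rule wp_mono[OF wp_insert[OF h(1) ranked_pi U d cv lenM]])
    fix t'
    assume "heap_repr rk t' (tick rk [vars t 21] ls) \<and>
      frame {30..41} {7, 8, 9, 10} t t' \<and>
      time t' \<le> time t + 80 * carries ls + 60 * merge_cost [vars t 21] ls + 200 \<and>
      asked t' \<le> asked t + carries ls + merge_cost [vars t 21] ls + 1"
    then have t': "heap_repr rk t' (tick rk [?p] ls)" "frame {30..41} {7, 8, 9, 10} t t'"
      "time t' \<le> time t + 80 * carries ls + 60 * merge_cost [?p] ls + 200"
      "asked t' \<le> asked t + carries ls + merge_cost [?p] ls + 1" using v by auto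
    let ?ls = "tick rk [?p] ls"
    let ?s = "s(v := ?T)"
    have pot: "potential 0 ?ls = potential 0 ls + merge_cost [?p] ls" by (simp add: potential_tick)
    have on: "ones ?ls + carries ls = Suc (ones ls)" by (rule ones_tick)
    have "heap_inv (insert v Ins) ps tb ab t'"
      unfolding heap_inv_def cI
    proof (rule exI[of _ ?ls], rule exI[of _ ?s], rule exI[of _ e], rule exI[of _ lg], intro conjI ballI)
      show "heap_sorted rk ?ls" using h(2) by (intro heap_sorted_tick) auto
      show "distinct (concat (map snd ?ls))" using d v by simp
      show "elems ?ls = Suc ` (insert v Ins - ps)" using h(4,5) v by auto
      have "aged (\<lambda>p. ?s (p - 1)) ?T 0 ls"
        using h(7) by (rule aged_cong) (use h(4) v in auto)
      then show "aged (\<lambda>p. ?s (p - 1)) (Suc ?T) 0 ?ls" by (rule aged_tick) simp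
      show "length ?ls \<le> Suc ?T" using length_tick[of rk "[?p]" ls] h(8) by simp
      fix x assume x: "x \<in> insert v Ins"
      show "?s x < Suc ?T" using h(9) x v by (auto simp: less_Suc_eq)
      show "miss E ({..<n} - {u \<in> ps. e u < ?s x}) x = {}"
      proof (cases "x = v")
        case True
        then have "{u \<in> ps. e u < ?s x} = ps" using h(10) by auto
        then show ?thesis using smp True by simp
      qed (use h(9) x in auto)
    next
      fix x assume x: "x \<in> ps"
      then have "x \<noteq> v" using h(5) v by auto
      then show "?s x \<le> e x" "e x < Suc ?T" "2 ^ lg x \<le> Suc (e x - ?s x)" using h(10) x by (auto simp: less_Suc_eq)
    next
      have "a + 80 * o' \<le> X + 60 * p' + 280 * Suc k + S"
        if "a \<le> a0 + 80 * c + 60 * w + 200" "p' = p + w" "o' + c = Suc o0"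
          "a0 + 80 * o0 \<le> X + 60 * p + 280 * k + S" for a a0 c w p p' o' o0 X k S :: nat
      proof -
        have "80 * o' + 80 * c = 80 * o0 + 80" using that(3) by simp
        then show ?thesis using that(1,2,4) by simp
      qed
      from this[OF t'(3) pot on h(11)]
      show "time t' + 80 * ones ?ls \<le> tb + 60 * potential 0 ?ls + 280 * Suc ?T + (\<Sum>v\<in>ps. 120 * lg v + 180)" .
      show "asked t' + ones ?ls \<le> ab + potential 0 ?ls + 2 * Suc ?T + (\<Sum>v\<in>ps. 2 * lg v + 2)"
      proof -
        have "asked t' + ones ?ls \<le> asked t + merge_cost [?p] ls + Suc (Suc (ones ls))"
          using t'(4) on by simp
        then show ?thesis using pot h(12) by simp
      qed
    qed (use t' h v in auto)
    then show "heap_inv (insert v Ins) ps tb ab t' \<and> frame {30..41} {7, 8, 9, 10} t t'"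
      using t'(2) by simp
  qed
qed

text \<open>At level \<open>i\<close> the removal costs \<open>60 * i + 120\<close> steps and
  withdraws at most \<open>60 * (i + 1)\<close> from the potential term. Together these make up the
  summand \<open>120 * lg v + 180\<close>, and likewise \<open>2 * lg v + 2\<close> for the
  queries.\<close>

lemma wp_heap_pop:
  assumes hi: "heap_inv Ins ps tb ab t" and ne: "Ins - ps \<noteq> {}" and cv: "const_vars t"
  shows "wp M b q pop_code (\<lambda>t'. \<exists>v. vars t' 42 = Suc v \<and> v \<in> Ins - ps \<and>
    (\<forall>u \<in> Ins - ps. rk (Suc v) \<le> rk (Suc u)) \<and>
    heap_inv Ins (insert v ps) tb ab t' \<and> frame ({34..37} \<union> {39..42}) {8, 10} t t') t"
proof -
  from hi obtain ls s e lg where h: "heap_repr rk t ls" "heap_sorted rk ls" "distinct (concat (map snd ls))"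
    "elems ls = Suc ` (Ins - ps)" "ps \<subseteq> Ins" "Ins \<subseteq> {..<n}"
    "aged (\<lambda>p. s (p - 1)) (card Ins) 0 ls" "length ls \<le> card Ins"
    "\<forall>v\<in>Ins. s v < card Ins \<and> miss E ({..<n} - {u \<in> ps. e u < s v}) v = {}"
    "\<forall>v\<in>ps. s v \<le> e v \<and> e v < card Ins \<and> 2 ^ lg v \<le> Suc (e v - s v)"
    "time t + 80 * ones ls \<le> tb + 60 * potential 0 ls + 280 * card Ins + (\<Sum>v\<in>ps. 120 * lg v + 180)"
    "asked t + ones ls \<le> ab + potential 0 ls + 2 * card Ins + (\<Sum>v\<in>ps. 2 * lg v + 2)"
    unfolding heap_inv_def by (elim exE conjE) (rule that)
  let ?T = "card Ins"
  have finI: "finite Ins" using h(6) by (rule finite_subset) simp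
  have In: "?T \<le> n" using card_mono[OF _ h(6)] by simp
  have U: "elems ls \<subseteq> Suc ` {..<n}" using h(4,6) by auto
  have nel: "elems ls \<noteq> {}" using ne h(4) by simp
  have zero: "0 \<notin> elems ls" using h(4) by auto
  have lenM: "length ls < M" using h(8) In M_bounds by simp
  show ?thesis
  proof (rule wp_mono[OF wp_pop[OF h(1) ranked_pi U h(3) nel h(2) cv lenM]])
    fix t'
    assume "\<exists>i R. i < length ls \<and> run_at ls i = vars t' 42 # R \<and>
      vars t' 42 = best rk ls \<and>
      heap_repr rk t' (upd ls i (bit_at ls i, R)) \<and>
      frame ({34..37} \<union> {39..42}) {8, 10} t t' \<and>
      time t' \<le> time t + 60 * i + 120 \<and> asked t' \<le> asked t + i + 1"
    then obtain i R where t': "i < length ls" "run_at ls i = vars t' 42 # R"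
      "vars t' 42 = best rk ls" "heap_repr rk t' (upd ls i (bit_at ls i, R))"
      "frame ({34..37} \<union> {39..42}) {8, 10} t t'"
      "time t' \<le> time t + 60 * i + 120" "asked t' \<le> asked t + i + 1" by blast
    let ?p = "vars t' 42"
    let ?ls = "upd ls i (bit_at ls i, R)"
    have "?p \<in> set (run_at ls i)" using t'(2) by simp
    then have "?p \<in> elems ls" using set_run_at[of ls i] by blast
    then obtain v where v: "?p = Suc v" "v \<in> Ins" "v \<notin> ps" using h(4) by auto
    have min: "rk (Suc v) \<le> rk (Suc u)" if "u \<in> Ins - ps" for u
      using best_le[OF h(2) zero, of "Suc u"] that h(4) t'(3) v(1) by auto
    have ms: "mset (concat (map snd ls)) = add_mset ?p (mset (concat (map snd ?ls)))"
      by (rule mset_upd[OF t'(1,2)])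
    have dls: "distinct (?p # concat (map snd ?ls))"
      using h(3) mset_eq_imp_distinct_iff[of "concat (map snd ls)" "?p # concat (map snd ?ls)"] ms by simp
    have els: "elems ls = insert ?p (elems ?ls)"
      using mset_eq_setD[of "concat (map snd ls)" "?p # concat (map snd ?ls)"] ms by (simp add: elems_def)
    have pot: "potential 0 ls \<le> potential 0 ?ls + (i + 1)"
      using potential_upd[OF t'(1,2), of 0] by simp
    have lev: "s v + 2 ^ i \<le> ?T"
      using aged_level[OF h(7) t'(1), of ?p] t'(2) v(1) by simp
    \<comment> \<open>The number of the last insertion, not \<open>?T\<close>: vertices inserted
      later have \<open>s x >= ?T\<close> and see \<open>v\<close> as removed, while those already
      inserted have \<open>s x < ?T\<close> and are unaffected.\<close>
    let ?e = "e(v := ?T - 1)"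
    let ?lg = "lg(v := i)"
    have finp: "finite ps" using h(5) finI finite_subset by blast
    have sumt: "(\<Sum>x\<in>insert v ps. 120 * ?lg x + 180) = 120 * i + 180 + (\<Sum>x\<in>ps. 120 * lg x + 180)"
    proof -
      have "(\<Sum>x\<in>ps. 120 * ?lg x + 180) = (\<Sum>x\<in>ps. 120 * lg x + 180)"
        using v by (intro sum.cong) auto
      then show ?thesis using finp v by simp
    qed
    have suma: "(\<Sum>x\<in>insert v ps. 2 * ?lg x + 2) = 2 * i + 2 + (\<Sum>x\<in>ps. 2 * lg x + 2)"
    proof -
      have "(\<Sum>x\<in>ps. 2 * ?lg x + 2) = (\<Sum>x\<in>ps. 2 * lg x + 2)"
        using v by (intro sum.cong) auto
      then show ?thesis using finp v by simp
    qed
    have Tpos: "0 < ?T" using v(2) finI by (auto simp: card_gt_0_iff)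
    have "heap_inv Ins (insert v ps) tb ab t'"
      unfolding heap_inv_def
    proof (rule exI[of _ ?ls], rule exI[of _ s], rule exI[of _ ?e], rule exI[of _ ?lg], intro conjI ballI)
      show "heap_repr rk t' ?ls" by fact
      show "heap_sorted rk ?ls" by (rule heap_sorted_upd[OF h(2) t'(1,2)])
      show "distinct (concat (map snd ?ls))" using dls by simp
      have "?p \<notin> elems ?ls" using dls by (simp add: elems_def)
      then show "elems ?ls = Suc ` (Ins - insert v ps)" using els h(4) v by auto
      show "insert v ps \<subseteq> Ins" using h(5) v by simp
      show "Ins \<subseteq> {..<n}" by fact
      show "aged (\<lambda>p. s (p - 1)) ?T 0 ?ls"
        by (rule aged_upd[OF h(7) t'(1)]) (use t'(2) in auto)
      show "length ?ls \<le> ?T" using h(8) t'(1) by (simp add: length_upd)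
      fix x assume x: "x \<in> Ins"
      show "s x < ?T" using h(9) x by simp
      have "{u \<in> insert v ps. ?e u < s x} = {u \<in> ps. e u < s x}"
        using v \<open>s x < ?T\<close> by auto
      then show "miss E ({..<n} - {u \<in> insert v ps. ?e u < s x}) x = {}" using h(9) x by simp
    next
      fix x assume x: "x \<in> insert v ps"
      have "s v < ?T" using h(9) v(2) by simp
      then show "s x \<le> ?e x" "?e x < ?T" "2 ^ ?lg x \<le> Suc (?e x - s x)"
        using x h(10) v lev Tpos by auto
    next
      show "time t' + 80 * ones ?ls \<le> tb + 60 * potential 0 ?ls + 280 * ?T + (\<Sum>v\<in>insert v ps. 120 * ?lg v + 180)"
        unfolding sumt ones_upd[OF t'(1)] using t'(6) pot h(11) by linarith
      show "asked t' + ones ?ls \<le> ab + potential 0 ?ls + 2 * ?T + (\<Sum>v\<in>insert v ps. 2 * ?lg v + 2)"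
        unfolding suma ones_upd[OF t'(1)] using t'(7) pot h(12) by linarith
    qed
    then show "\<exists>v. vars t' 42 = Suc v \<and> v \<in> Ins - ps \<and>
      (\<forall>u \<in> Ins - ps. rk (Suc v) \<le> rk (Suc u)) \<and>
      heap_inv Ins (insert v ps) tb ab t' \<and> frame ({34..37} \<union> {39..42}) {8, 10} t t'"
      using v min t'(5) by blast
  qed
qed

text \<open>With an empty heap the potential is 0, and \<open>S\<close> is the sum of the levels
  \<open>lg v\<close>. As \<open>2 ^ lg v\<close> is at most the number of times in the interval of
  \<open>v\<close>, \<open>prod_intervals_le\<close> bounds \<open>2 ^ S\<close>.\<close>

lemma heap_inv_final:
  assumes "heap_inv {..<n} {..<n} tb ab t"
  shows "\<exists>S. time t \<le> tb + 460 * n + 120 * S \<and> asked t \<le> ab + 4 * n + 2 * S \<and>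
    2 ^ S \<le> card {vs. elim E {..<n} vs} * 4 ^ n"
proof -
  from assms obtain ls s e lg where h: "elems ls = Suc ` ({..<n} - {..<n})"
    "\<forall>v\<in>{..<n}. s v < card {..<n} \<and> miss E ({..<n} - {u \<in> {..<n}. e u < s v}) v = {}"
    "\<forall>v\<in>{..<n}. s v \<le> e v \<and> e v < card {..<n} \<and> 2 ^ lg v \<le> Suc (e v - s v)"
    "time t + 80 * ones ls \<le> tb + 60 * potential 0 ls + 280 * card {..<n} + (\<Sum>v\<in>{..<n}. 120 * lg v + 180)"
    "asked t + ones ls \<le> ab + potential 0 ls + 2 * card {..<n} + (\<Sum>v\<in>{..<n}. 2 * lg v + 2)"
    unfolding heap_inv_def by (elim exE conjE) (rule that)
  have "concat (map snd ls) = []" using h(1) by (simp add: elems_def)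
  then have pot: "potential 0 ls = 0" using potential_le[of 0 ls] by (simp del: concat_eq_Nil_conv)
  let ?S = "\<Sum>v<n. lg v"
  have "(\<Sum>v<n. 120 * lg v + 180) = (\<Sum>v<n. 120 * lg v) + (\<Sum>v<n. 180)" by (rule sum.distrib)
  then have t: "(\<Sum>v<n. 120 * lg v + 180) = 120 * ?S + 180 * n" by (simp add: sum_distrib_left)
  have "(\<Sum>v<n. 2 * lg v + 2) = (\<Sum>v<n. 2 * lg v) + (\<Sum>v<n. 2)" by (rule sum.distrib)
  then have a: "(\<Sum>v<n. 2 * lg v + 2) = 2 * ?S + 2 * n" by (simp add: sum_distrib_left)
  have "2 ^ ?S = (\<Prod>v<n. 2 ^ lg v)" by (rule power_sum)
  also have "\<dots> \<le> (\<Prod>v<n. Suc (e v - s v))" using h(3) by (intro prod_mono) auto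
  also have "\<dots> \<le> card {vs. elim E {..<n} vs} * 4 ^ card {..<n}"
    using h(2,3) by (intro prod_intervals_le) auto
  finally show ?thesis using h(4,5) pot unfolding t a by (intro exI[of _ ?S]) auto
qed

end

section \<open>Elimination in the given order\<close>

definition fill_heap_code :: com where
  "fill_heap_code =
    WhileNeq 20 2 (
      Get 12 2 20 ;; IfEq 12 0 (Plus 21 20 1 ;; insert_code) Nop ;; Plus 20 20 1)"

text \<open>The mark in array 3 now means that a vertex is still present. A neighbor whose counter
  in array 2 was 0 before is already in the heap; skipping it prevents a second insertion. Variable
  23 keeps the degree of the removed vertex.\<close>

definition remove_code :: com where
  "remove_code =
    WhileNeq 13 14 (
      Get 15 0 13 ;; Plus 13 13 1 ;;
      Get 12 3 15 ;;
      IfEq 12 0 Nop (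
        Get 16 1 15 ;; Minus 12 16 1 ;; Put 1 15 12 ;;
        Get 17 2 15 ;;
        IfEq 17 0 Nop (
          Minus 16 16 23 ;; Minus 17 17 16 ;; Put 2 15 17 ;;
          IfEq 17 0 (Plus 21 15 1 ;; insert_code) Nop)))"

definition eliminate_code :: com where
  "eliminate_code =
    WhileNeq 22 2 (
      pop_code ;; Minus 11 42 1 ;; Put 11 22 11 ;; Plus 22 22 1 ;;
      Put 3 11 0 ;; Get 23 1 11 ;;
      Plus 12 11 1 ;; Get 13 0 12 ;; Plus 12 12 1 ;; Get 14 0 12 ;;
      remove_code)"

definition copy_code :: com where
  "copy_code = WhileNeq 24 2 (Get 12 11 24 ;; Plus 24 24 1 ;; Put 0 24 12)"

context elimination_input
begin

lemma wp_fill_heap: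
  assumes cv: "const_vars s" and v2: "vars s 2 = n" and v20: "vars s 20 = 0"
    and fl: "flaws {..<n} (\<lambda>_. {..<n}) s" and hi: "heap_inv {} {} (time s) ab s"
  shows "wp M b q fill_heap_code (\<lambda>s'.
      heap_inv {v. v < n \<and> miss E {..<n} v = {}} {} (time s + 20 * n + 1) ab s' \<and>
      frame ({12, 20, 21} \<union> {30..41}) {7, 8, 9, 10} s s') s"
    (is "wp M b q fill_heap_code ?Q s")
proof -
  let ?V = "{12, 20, 21} \<union> {30..41} :: nat set"
  let ?S = "\<lambda>i. {v. v < i \<and> miss E {..<n} v = {}}"
  define I where "I = (\<lambda>t. vars t 20 \<le> n \<and> heap_inv (?S (vars t 20)) {} (time s + 20 * vars t 20) ab t \<and>
    frame ?V {7, 8, 9, 10} s t)"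
  show ?thesis
    unfolding fill_heap_code_def
  proof (rule wp_While[where I = I and B = "time s + 20 * n + time_limit"])
    show "I s" using hi v20 by (simp add: I_def)
    show "time t \<le> time s + 20 * n + time_limit" if "I t" for t
    proof -
      have k: "vars t 20 \<le> n" "heap_inv (?S (vars t 20)) {} (time s + 20 * vars t 20) ab t"
        using that unfolding I_def by blast+
      show ?thesis using heap_inv_time[OF k(2)] k(1) by simp
    qed
    show "?Q (t\<lparr>time := time t + 1\<rparr>)" if "I t" "vars t 20 = vars t 2" for t
    proof -
      have I: "heap_inv (?S (vars t 20)) {} (time s + 20 * vars t 20) ab t" "frame ?V {7, 8, 9, 10} s t"
        using that(1) unfolding I_def by blast+
      have "vars t 20 = n" using that(2) v2 I(2) by (simp add: frame_def)
      then show ?thesis using I by (auto simp: frame_def intro: heap_inv_mono)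
    qed
    show "wp M b q (Get 12 2 20 ;; IfEq 12 0 (Plus 21 20 1 ;; insert_code) Nop ;; Plus 20 20 1) I
        (t\<lparr>time := time t + 2\<rparr>)"
      if "I t" "vars t 20 \<noteq> vars t 2" for t
    proof -
      have I: "vars t 20 \<le> n" "heap_inv (?S (vars t 20)) {} (time s + 20 * vars t 20) ab t"
        "frame ?V {7, 8, 9, 10} s t"
        using that(1) unfolding I_def by blast+
      obtain i where i: "vars t 20 = i" by simp
      have c0: "vars t 0 = 0" "vars t 1 = 1" "vars t 2 = n"
        using cv v2 I(3) by (auto simp: const_vars_def frame_def)
      have "i < n" using that(2) I(1) i c0 by simp
      have f2: "2 * arr t 2 i = card (miss E {..<n} i)"
        using fl \<open>i < n\<close> I(3) by (auto simp: flaws_def frame_def)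
      have Mb: "i + 1 < M" using \<open>i < n\<close> M_bounds by simp
      show ?thesis
      proof (cases "arr t 2 i = 0")
        case True
        then have ms: "miss E {..<n} i = {}" using f2 by simp
        have S: "?S (Suc i) = insert i (?S i)" using ms by (auto simp: less_Suc_eq)
        have ins: "wp M b q insert_code (wp M b q (Plus 20 20 1) I) t1"
          if t1: "vars t1 21 = Suc i" "\<And>r. r \<notin> {12, 21} \<Longrightarrow> vars t1 r = vars t r" "arr t1 = arr t"
            "time t1 \<le> time t + 15" "asked t1 = asked t" for t1
        proof -
          have hi1: "heap_inv (?S i) {} (time s + 20 * i + 15) ab t1"
            by (rule heap_inv_mono[OF I(2)[unfolded i]]) (use t1 in auto)
          have cv1: "const_vars t1" using c0 t1(2) by (simp add: const_vars_def)
          have ms': "miss E ({..<n} - {}) i = {}" using ms by simp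
          show ?thesis
          proof (rule wp_mono[OF wp_heap_insert[OF hi1 \<open>i < n\<close> _ t1(1) ms' cv1]])
            show "i \<notin> ?S i" by simp
            fix t2 assume "heap_inv (insert i (?S i)) {} (time s + 20 * i + 15) ab t2 \<and>
              frame {30..41} {7, 8, 9, 10} t1 t2"
            then have t2: "heap_inv (?S (Suc i)) {} (time s + 20 * i + 15) ab t2"
              "frame {30..41} {7, 8, 9, 10} t1 t2" using S by auto
            have v: "vars t2 20 = i" "vars t2 1 = 1" using t2(2) t1(2) i c0 by (auto simp: frame_def)
            have "I t3" if t3: "vars t3 = (vars t2)(20 := i + 1)" "arr t3 = arr t2" "asked t3 = asked t2"
              "time t3 = Suc (time t2)" for t3
            proof -
              have "heap_inv (?S (Suc i)) {} (time s + 20 * Suc i) ab t3"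
                by (rule heap_inv_mono[OF t2(1)]) (use t3 in auto)
              moreover have "frame ?V {7, 8, 9, 10} s t3"
                using I(3) t2(2) t1(2,3) t3 by (auto simp: frame_def)
              ultimately show ?thesis using t3 \<open>i < n\<close> unfolding I_def by simp
            qed
            then show "wp M b q (Plus 20 20 1) I t2"
              using v Mb by (simp add: wp_Plus del: One_nat_def)
          qed
        qed
        show ?thesis using c0 i True Mb
          by (simp add: wp_simps del: One_nat_def) (rule ins; simp)
      next
        case False
        then have "miss E {..<n} i \<noteq> {}" using f2 by auto
        then have S: "?S (Suc i) = ?S i" by (auto simp: less_Suc_eq)
        have fin: "I t3" if t3: "\<And>r. r \<notin> {12, 20} \<Longrightarrow> vars t3 r = vars t r" "vars t3 20 = i + 1"
          "arr t3 = arr t" "asked t3 = asked t" "time t3 \<le> time t + 20" for t3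
        proof -
          have "heap_inv (?S (Suc i)) {} (time s + 20 * Suc i) ab t3"
            unfolding S by (rule heap_inv_mono[OF I(2)[unfolded i]]) (use t3 in auto)
          moreover have "frame ?V {7, 8, 9, 10} s t3"
            using I(3) t3 by (auto simp: frame_def)
          ultimately show ?thesis using t3 \<open>i < n\<close> unfolding I_def by simp
        qed
        show ?thesis using c0 i False Mb
          by (simp add: wp_simps del: One_nat_def) (rule fin; simp)
      qed
    qed
  qed
qed

definition degrees_on :: "nat set \<Rightarrow> (nat \<Rightarrow> nat set) \<Rightarrow> state \<Rightarrow> bool" where
  "degrees_on D X t \<longleftrightarrow> (\<forall>u\<in>D. arr t 1 u = card (nb E (X u) u))"

definition flaws_on :: "nat set \<Rightarrow> (nat \<Rightarrow> nat set) \<Rightarrow> state \<Rightarrow> bool" where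
  "flaws_on D X t \<longleftrightarrow> (\<forall>u\<in>D. 2 * arr t 2 u = card (miss E (X u) u))"

definition shrink :: "nat set \<Rightarrow> nat \<Rightarrow> nat set \<Rightarrow> nat \<Rightarrow> nat set" where
  "shrink A v S u = (if u \<in> S then A - {v} else A)"

text \<open>\<open>card_miss_insert\<close> read backwards, with \<open>A - {v}\<close> as the
  smaller set. During the loop the vertices inserted so far form \<open>?H k\<close>: those of
  \<open>ps\<close>, which already contains \<open>v\<close>, and those whose counters, as updated
  so far, show no nonadjacent pair.\<close>

lemma wp_remove:
  assumes A: "A \<subseteq> {..<n}" and v: "v \<in> A" and cl: "miss E A v = {}"
    and ps: "{..<n} - ps = A - {v}" and v23: "vars s 23 = card (nb E A v)"
    and cv: "const_vars s" and raw: "raw_ok s" and i: "vars s 13 = off v" "vars s 14 = off (Suc v)"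
    and dg: "degrees_on (A - {v}) (\<lambda>_. A) s" and fl: "flaws_on (A - {v}) (\<lambda>_. A) s"
    and mk: "marks (A - {v}) s"
    and hi: "heap_inv (ps \<union> {u \<in> A - {v}. miss E A u = {}}) ps tb ab s"
  shows "wp M b q remove_code (\<lambda>s'. degrees_on (A - {v}) (\<lambda>_. A - {v}) s' \<and>
      flaws_on (A - {v}) (\<lambda>_. A - {v}) s' \<and>
      heap_inv (ps \<union> {u \<in> A - {v}. miss E (A - {v}) u = {}}) ps (tb + 60 * deg v + 1) ab s' \<and>
      frame ({12, 13, 15, 16, 17, 21} \<union> {30..41}) {1, 2, 7, 8, 9, 10} s s') s"
    (is "wp M b q remove_code ?Q s")
proof -
  let ?W = "A - {v}"
  let ?S = "\<lambda>k. set (take k (adj ! v))"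
  let ?X = "\<lambda>k. shrink A v (?S k)"
  let ?H = "\<lambda>k. ps \<union> {u \<in> ?W. miss E (?X k u) u = {}}"
  let ?V = "{12, 13, 15, 16, 17, 21} \<union> {30..41} :: nat set"
  let ?AR = "{1, 2, 7, 8, 9, 10} :: nat set"
  have vn: "v < n" using A v by auto
  have finA: "finite A" using A by (rule finite_subset) simp
  have insA: "insert v ?W = A" using v by auto
  have finW: "finite ?W" using finA by simp
  have clW: "miss E ?W v = {}" using cl miss_mono[of ?W A E v] by auto
  have nbv: "nb E ?W v = nb E A v" using irr by (auto simp: nb_def)
  have off1: "off (Suc v) = off v + deg v" using off_Suc vn by simp
  define I where "I = (\<lambda>t. \<exists>k. k \<le> deg v \<and> vars t 13 = off v + k \<and>
    degrees_on ?W (?X k) t \<and> flaws_on ?W (?X k) t \<and> heap_inv (?H k) ps (tb + 60 * k) ab t \<and>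
    frame ?V ?AR s t)"
  show ?thesis
    unfolding remove_code_def
  proof (rule wp_While[where I = I and B = "tb + 60 * deg v + time_limit"])
    show "I s"
      unfolding I_def
      by (rule exI[of _ 0]) (use i dg fl hi in \<open>auto simp: shrink_def degrees_on_def flaws_on_def\<close>)
    show "time t \<le> tb + 60 * deg v + time_limit" if "I t" for t
    proof -
      from \<open>I t\<close> obtain k where I: "k \<le> deg v" "vars t 13 = off v + k"
        "degrees_on ?W (?X k) t" "flaws_on ?W (?X k) t" "heap_inv (?H k) ps (tb + 60 * k) ab t"
        "frame ?V ?AR s t" unfolding I_def by blast
      show ?thesis using heap_inv_time[OF I(5)] I(1) by simp
    qed
    show "?Q (t\<lparr>time := time t + 1\<rparr>)" if "I t" and eq: "vars t 13 = vars t 14" for t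
    proof -
      from \<open>I t\<close> obtain k where I: "k \<le> deg v" "vars t 13 = off v + k"
        "degrees_on ?W (?X k) t" "flaws_on ?W (?X k) t" "heap_inv (?H k) ps (tb + 60 * k) ab t"
        "frame ?V ?AR s t" unfolding I_def by blast
      have k: "k = deg v" using eq I(2) frame_vars[OF I(6), of 14] i off1 by simp
      then have S: "?S k = set (adj ! v)" by (simp add: deg_def)
      have nbX: "nb E (?X k u) u = nb E ?W u" for u
        using S adj_iff[OF vn, of u] nb_nonadj[of u v E ?W] insA by (auto simp: shrink_def)
      have msX: "miss E (?X k u) u = miss E ?W u" for u
        using nbX by (simp add: miss_def)
      have "heap_inv (?H k) ps (tb + 60 * deg v + 1) ab (t\<lparr>time := time t + 1\<rparr>)"
        by (rule heap_inv_mono[OF I(5)]) (use k in auto)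
      then show ?thesis
        using I nbX msX by (simp add: degrees_on_def flaws_on_def frame_def)
    qed
    show "wp M b q (Get 15 0 13 ;; Plus 13 13 1 ;;
      Get 12 3 15 ;;
      IfEq 12 0 Nop (
        Get 16 1 15 ;; Minus 12 16 1 ;; Put 1 15 12 ;;
        Get 17 2 15 ;;
        IfEq 17 0 Nop (
          Minus 16 16 23 ;; Minus 17 17 16 ;; Put 2 15 17 ;;
          IfEq 17 0 (Plus 21 15 1 ;; insert_code) Nop))) I (t\<lparr>time := time t + 2\<rparr>)"
      if "I t" and ne: "vars t 13 \<noteq> vars t 14" for t
    proof -
      from \<open>I t\<close> obtain k where I: "k \<le> deg v" "vars t 13 = off v + k"
        "degrees_on ?W (?X k) t" "flaws_on ?W (?X k) t" "heap_inv (?H k) ps (tb + 60 * k) ab t"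
        "frame ?V ?AR s t" unfolding I_def by blast
      have kd: "k < deg v" using ne I(1,2) frame_vars[OF I(6), of 14] i off1 by simp
      define u where "u = adj ! v ! k"
      have u: "u \<in> set (adj ! v)" using kd by (simp add: u_def deg_def)
      then have uE: "{u, v} \<in> E" using adj_iff vn by simp
      then have un: "u < n" "u \<noteq> v" using edge_less by auto
      have uS: "u \<notin> ?S k"
        using distinct_adj[OF vn] kd unfolding u_def deg_def
        by (auto simp: in_set_conv_nth nth_eq_iff_index_eq)
      have Sk: "?S (Suc k) = insert u (?S k)"
        using kd by (simp add: take_Suc_conv_app_nth u_def deg_def)
      have c0: "vars t 0 = 0" "vars t 1 = 1" "vars t 23 = card (nb E A v)"
        using cv v23 I(6) by (auto simp: const_vars_def frame_def)
      have a0: "arr t 0 = arr s 0" "arr t 3 = arr s 3" using I(6) by (auto simp: frame_def)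
      have ad: "off v + k < b" "arr t 0 (off v + k) = u"
        using off_less[OF vn kd] raw vn kd a0 by (auto simp: raw_ok_def u_def)
      have vis: "arr t 3 u = of_bool (u \<in> ?W)" using mk un a0 by (auto simp: marks_def)
      have Mb: "off v + k + 1 < M" "u + 1 < M" using ad b_bounds M_bounds un by auto
      have Xu: "?X (Suc k) u = ?W" "?X k u = A" using uS by (simp_all add: shrink_def Sk)
      have Xo: "?X (Suc k) x = ?X k x" if "x \<noteq> u" for x
        using that by (simp add: shrink_def Sk)
      have fin: "I t'" if t': "vars t' 13 = off v + k + 1"
        "\<And>r. r \<notin> ?V \<Longrightarrow> vars t' r = vars t r" "\<And>r. r \<notin> ?AR \<Longrightarrow> arr t' r = arr t r"
        "degrees_on ?W (?X (Suc k)) t'" "flaws_on ?W (?X (Suc k)) t'"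
        "heap_inv (?H (Suc k)) ps (tb + 60 * Suc k) ab t'" for t'
        unfolding I_def by (rule exI[of _ "Suc k"]) (use t' I kd in \<open>auto simp: frame_def\<close>)
      show ?thesis
      proof (cases "u \<in> ?W")
        case False
        have X: "?X (Suc k) x = ?X k x" if "x \<in> ?W" for x using that False Xo by metis
        have H: "?H (Suc k) = ?H k" using X by auto
        have fin1: "I t'" if t': "vars t' 13 = off v + k + 1"
          "\<And>r. r \<notin> {12, 13, 15} \<Longrightarrow> vars t' r = vars t r" "arr t' = arr t"
          "time t' \<le> time t + 60" "asked t' = asked t" for t'
        proof (rule fin)
          show "heap_inv (?H (Suc k)) ps (tb + 60 * Suc k) ab t'"
            unfolding H by (rule heap_inv_mono[OF I(5)]) (use t' in auto)
        qed (use t' I(3,4) X in \<open>auto simp: degrees_on_def flaws_on_def\<close>)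
        show ?thesis using c0 I(2) ad vis False Mb
          by (simp add: wp_simps del: One_nat_def Diff_iff) (rule fin1; simp)
      next
        case True
        have unb: "u \<in> nb E ?W v" using True uE by (simp add: nb_def)
        define d where "d = card (nb E A u)"
        have d1: "card (nb E ?W u) = d - 1" "1 \<le> d"
        proof -
          have "nb E A u = insert v (nb E ?W u)" using nb_adj[OF uE, of ?W] insA by simp
          moreover have "v \<notin> nb E ?W u" by (simp add: nb_def)
          ultimately show "card (nb E ?W u) = d - 1" "1 \<le> d" using finW by (simp_all add: d_def)
        qed
        have Du: "arr t 1 u = d" using I(3) True Xu by (auto simp: degrees_on_def d_def)
        define c where "c = card (nb E A v)"
        have cd: "c \<le> d" using card_nb_le[OF finW _ clW unb] insA nbv by (simp add: c_def d_def)
        define f where "f = arr t 2 u"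
        have f2: "2 * f = card (miss E A u)" using I(4) True Xu by (auto simp: flaws_on_def f_def)
        have ms: "card (miss E A u) = card (miss E ?W u) + 2 * (d - c)"
          using card_miss_insert[OF finW _ irr clW unb] insA nbv by (simp add: c_def d_def)
        have dgn: "degrees_on ?W (?X (Suc k)) t'" if "arr t' 1 = (arr t 1)(u := d - 1)" for t'
          unfolding degrees_on_def
        proof
          fix x assume "x \<in> ?W"
          then show "arr t' 1 x = card (nb E (?X (Suc k) x) x)"
            using that I(3) Xu Xo[of x] d1 by (cases "x = u") (auto simp: degrees_on_def)
        qed
        have fln: "flaws_on ?W (?X (Suc k)) t'" if "arr t' 2 = (arr t 2)(u := f')"
          "2 * f' = card (miss E ?W u)" for t' f'
          unfolding flaws_on_def
        proof
          fix x assume "x \<in> ?W"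
          then show "2 * arr t' 2 x = card (miss E (?X (Suc k) x) x)"
            using that I(4) Xu Xo[of x] by (cases "x = u") (auto simp: flaws_on_def)
        qed
        \<comment> \<open>Only the status of \<open>u\<close> can change; a vertex of
          \<open>ps\<close> stays in the set whatever its counter says.\<close>
        have H: "?H (Suc k) = (if miss E ?W u = {} then insert u (?H k) else ?H k - (if u \<in> ps then {} else {u}))"
        proof -
          have "miss E (?X (Suc k) x) x = {} \<longleftrightarrow> (if x = u then miss E ?W u = {} else miss E (?X k x) x = {})" for x
            using Xu Xo[of x] by auto
          then show ?thesis using True by auto
        qed
        have ups: "u \<notin> ps" using True ps by auto
        show ?thesis
        proof (cases "f = 0")
          case f0: True
          then have m0: "miss E A u = {}" using f2 finA by simp
          then have mW: "miss E ?W u = {}" using miss_mono[of ?W A E u] by auto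
          have Hk: "?H (Suc k) = ?H k" using H mW m0 Xu True by auto
          have fin2: "I t'" if t': "vars t' 13 = off v + k + 1"
            "\<And>r. r \<notin> {12, 13, 15, 16, 17} \<Longrightarrow> vars t' r = vars t r"
            "arr t' = (arr t)(1 := (arr t 1)(u := d - 1))"
            "time t' \<le> time t + 60" "asked t' = asked t" for t'
          proof (rule fin)
            show "heap_inv (?H (Suc k)) ps (tb + 60 * Suc k) ab t'"
              unfolding Hk by (rule heap_inv_mono[OF I(5)]) (use t' in auto)
            show "degrees_on ?W (?X (Suc k)) t'" by (rule dgn) (use t' in auto)
            show "flaws_on ?W (?X (Suc k)) t'" 
              by (rule fln[of _ 0]) (use t' f0 f_def mW in auto)
          qed (use t' in auto)
          show ?thesis using c0 I(2) ad vis True Mb Du d1 f0 f_def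
            by (simp add: wp_simps del: One_nat_def Diff_iff) (rule fin2; simp)
        next
          case f0: False
          then have mA: "miss E A u \<noteq> {}" using f2 by auto
          define f' where "f' = f - (d - c)"
          have f': "2 * f' = card (miss E ?W u)" "d - c \<le> f" using f2 ms by (simp_all add: f'_def)
          have f'': "arr t 2 u + c - d = f'" "arr t 2 u + c \<le> d \<longleftrightarrow> f' = 0"
            using cd by (auto simp: f'_def f_def)
          have uH: "u \<notin> ?H k" using mA Xu ups by auto
          have part: "degrees_on ?W (?X (Suc k)) t'" "flaws_on ?W (?X (Suc k)) t'"
            if "arr t' 1 = (arr t 1)(u := d - 1)" "arr t' 2 = (arr t 2)(u := f')" for t'
            using dgn fln f'(1) that by auto
          show ?thesis
          proof (cases "f' = 0")
            case g0: False
            then have "miss E ?W u \<noteq> {}" using f' by auto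
            then have Hk: "?H (Suc k) = ?H k" using H uH by auto
            have fin3: "I t'" if t': "vars t' 13 = off v + k + 1"
              "\<And>r. r \<notin> {12, 13, 15, 16, 17} \<Longrightarrow> vars t' r = vars t r"
              "arr t' = (arr t)(1 := (arr t 1)(u := d - 1), 2 := (arr t 2)(u := f'))"
              "time t' \<le> time t + 60" "asked t' = asked t" for t'
            proof (rule fin)
              show "heap_inv (?H (Suc k)) ps (tb + 60 * Suc k) ab t'"
                unfolding Hk by (rule heap_inv_mono[OF I(5)]) (use t' in auto)
            qed (use t' part[of t'] in auto)
            show ?thesis using c0 I(2) ad vis True Mb Du d1 f0 f_def f' f'' g0 cd
              by (simp add: wp_simps c_def[symmetric] del: One_nat_def Diff_iff) (rule fin3; simp)
          next
            case g0: True
            then have mW: "miss E ?W u = {}" using f' finW by simp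
            then have Hk: "?H (Suc k) = insert u (?H k)" using H by simp
            have ins: "wp M b q insert_code I t1" if t1: "vars t1 13 = off v + k + 1" "vars t1 21 = Suc u"
              "\<And>r. r \<notin> {12, 13, 15, 16, 17, 21} \<Longrightarrow> vars t1 r = vars t r"
              "arr t1 = (arr t)(1 := (arr t 1)(u := d - 1), 2 := (arr t 2)(u := f'))"
              "time t1 \<le> time t + 60" "asked t1 = asked t" for t1
            proof -
              have hi1: "heap_inv (?H k) ps (tb + 60 * Suc k) ab t1"
                by (rule heap_inv_mono[OF I(5)]) (use t1 in auto)
              have cv1: "const_vars t1" using c0 t1(3) by (simp add: const_vars_def)
              have ms': "miss E ({..<n} - ps) u = {}" using mW ps by simp
              show ?thesis
              proof (rule wp_mono[OF wp_heap_insert[OF hi1 un(1) uH t1(2) ms' cv1]])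
                fix t2 assume t2: "heap_inv (insert u (?H k)) ps (tb + 60 * Suc k) ab t2 \<and>
                  frame {30..41} {7, 8, 9, 10} t1 t2"
                show "I t2"
                proof (rule fin)
                  show "vars t2 13 = off v + k + 1" using t1 t2 by (simp add: frame_def)
                  show "vars t2 r = vars t r" if "r \<notin> ?V" for r
                    using that t1(3)[of r] t2 by (auto simp: frame_def)
                  show "arr t2 r = arr t r" if "r \<notin> ?AR" for r
                    using that t1(4) t2 by (auto simp: frame_def)
                  have "arr t2 1 = (arr t 1)(u := d - 1)" "arr t2 2 = (arr t 2)(u := f')"
                    using t1(4) t2 by (auto simp: frame_def)
                  then show "degrees_on ?W (?X (Suc k)) t2" "flaws_on ?W (?X (Suc k)) t2"
                    by (rule part)+
                  show "heap_inv (?H (Suc k)) ps (tb + 60 * Suc k) ab t2" using t2 Hk by simp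
                qed
              qed
            qed
            show ?thesis using c0 I(2) ad vis True Mb Du d1 f0 f_def f' f'' g0 cd
              by (simp add: wp_simps c_def[symmetric] del: One_nat_def Diff_iff) (rule ins; simp)
          qed
        qed
      qed
    qed
  qed
qed

end

context elimination_input
begin

text \<open>The vertex \<open>\<pi> ! k\<close> is simplicial in what remains, so it is in the heap.
  Every other heap element is a remaining vertex and has a larger rank. So the minimum is the next
  vertex of the order.\<close>

lemma wp_eliminate:
  assumes cv: "const_vars s" and raw: "raw_ok s" and v2: "vars s 2 = n" and v22: "vars s 22 = 0"
    and dg: "degrees_on {..<n} (\<lambda>_. {..<n}) s" and fl: "flaws_on {..<n} (\<lambda>_. {..<n}) s"
    and mk: "marks {..<n} s"
    and hi: "heap_inv {v. v < n \<and> miss E {..<n} v = {}} {} tb ab s"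
  shows "wp M b q eliminate_code (\<lambda>s'.
      heap_inv {..<n} {..<n} (tb + 120 * m + 60 * n + 1) ab s' \<and>
      (\<forall>i<n. arr s' 11 i = \<pi> ! i) \<and>
      frame ({11..17} \<union> {21, 22, 23} \<union> {30..42}) {1, 2, 3, 7, 8, 9, 10, 11} s s') s"
    (is "wp M b q eliminate_code ?Q s")
proof -
  let ?V = "{11..17} \<union> {21, 22, 23} \<union> {30..42} :: nat set"
  let ?AR = "{1, 2, 3, 7, 8, 9, 10, 11} :: nat set"
  let ?ps = "\<lambda>k. set (take k \<pi>)"
  let ?A = "\<lambda>k. {..<n} - ?ps k"
  let ?H = "\<lambda>k. ?ps k \<union> {u \<in> ?A k. miss E (?A k) u = {}}"
  let ?tb = "\<lambda>k. tb + 60 * (\<Sum>x\<in>?ps k. deg x) + 60 * k"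
  have sub: "(\<Sum>x\<in>?ps k. deg x) \<le> 2 * m" for k
  proof -
    have "(\<Sum>x\<in>?ps k. deg x) \<le> (\<Sum>x<n. deg x)"
      using pi(2) set_take_subset[of k \<pi>] by (intro sum_mono2) auto
    then show ?thesis using sum_deg by simp
  qed
  define I where "I = (\<lambda>t. \<exists>k. k \<le> n \<and> vars t 22 = k \<and> heap_inv (?H k) (?ps k) (?tb k) ab t \<and>
    degrees_on (?A k) (\<lambda>_. ?A k) t \<and> flaws_on (?A k) (\<lambda>_. ?A k) t \<and> marks (?A k) t \<and>
    (\<forall>i<k. arr t 11 i = \<pi> ! i) \<and> frame ?V ?AR s t)"
  show ?thesis
    unfolding eliminate_code_def
  proof (rule wp_While[where I = I and B = "tb + 60 * (2 * m) + 60 * n + time_limit"])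
    have H0: "?H 0 = {v. v < n \<and> miss E {..<n} v = {}}" by auto
    show "I s"
      unfolding I_def
    proof (rule exI[of _ 0], intro conjI)
      show "heap_inv (?H 0) (?ps 0) (?tb 0) ab s" unfolding H0 using hi by simp
    qed (use v22 dg fl mk in auto)
    show "time t \<le> tb + 60 * (2 * m) + 60 * n + time_limit" if "I t" for t
    proof -
      from \<open>I t\<close> obtain k where I: "k \<le> n" "vars t 22 = k" "heap_inv (?H k) (?ps k) (?tb k) ab t"
        "degrees_on (?A k) (\<lambda>_. ?A k) t" "flaws_on (?A k) (\<lambda>_. ?A k) t" "marks (?A k) t"
        "\<forall>i<k. arr t 11 i = \<pi> ! i" "frame ?V ?AR s t" unfolding I_def by (elim exE conjE) (rule that)
      show ?thesis using heap_inv_time[OF I(3)] I(1) sub[of k] by linarith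
    qed
    show "?Q (t\<lparr>time := time t + 1\<rparr>)" if "I t" and eq: "vars t 22 = vars t 2" for t
    proof -
      from \<open>I t\<close> obtain k where I: "k \<le> n" "vars t 22 = k" "heap_inv (?H k) (?ps k) (?tb k) ab t"
        "degrees_on (?A k) (\<lambda>_. ?A k) t" "flaws_on (?A k) (\<lambda>_. ?A k) t" "marks (?A k) t"
        "\<forall>i<k. arr t 11 i = \<pi> ! i" "frame ?V ?AR s t" unfolding I_def by (elim exE conjE) (rule that)
      have k: "k = n" using eq I(2,8) v2 by (simp add: frame_def)
      have "?ps k = {..<n}" using k pi by simp
      then have "heap_inv {..<n} {..<n} (?tb k) ab t" using I(3) by simp
      then have "heap_inv {..<n} {..<n} (tb + 120 * m + 60 * n + 1) ab (t\<lparr>time := time t + 1\<rparr>)"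
        by (rule heap_inv_mono) (use sub[of k] k in auto)
      then show ?thesis using I(7,8) k by (simp add: frame_def)
    qed
    show "wp M b q (pop_code ;; Minus 11 42 1 ;; Put 11 22 11 ;; Plus 22 22 1 ;;
      Put 3 11 0 ;; Get 23 1 11 ;;
      Plus 12 11 1 ;; Get 13 0 12 ;; Plus 12 12 1 ;; Get 14 0 12 ;;
      remove_code) I (t\<lparr>time := time t + 2\<rparr>)"
      if "I t" and ne: "vars t 22 \<noteq> vars t 2" for t
    proof -
      from \<open>I t\<close> obtain k where I: "k \<le> n" "vars t 22 = k" "heap_inv (?H k) (?ps k) (?tb k) ab t"
        "degrees_on (?A k) (\<lambda>_. ?A k) t" "flaws_on (?A k) (\<lambda>_. ?A k) t" "marks (?A k) t"
        "\<forall>i<k. arr t 11 i = \<pi> ! i" "frame ?V ?AR s t" unfolding I_def by (elim exE conjE) (rule that)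
      have kn: "k < n" using ne I(1,2,8) v2 by (simp add: frame_def)
      let ?v = "\<pi> ! k"
      let ?t0 = "t\<lparr>time := time t + 2\<rparr>"
      have vA: "?v \<in> ?A k" and vn: "?v < n"
        using kn pi nth_mem[of k \<pi>] by (auto simp: in_set_conv_nth nth_eq_iff_index_eq)
      have ps': "?ps (Suc k) = insert ?v (?ps k)" using kn pi(3) by (simp add: take_Suc_conv_app_nth)
      have A': "?A (Suc k) = ?A k - {?v}" unfolding ps' by auto
      have cl: "miss E (?A k) ?v = {}" using pi(4)[OF kn] .
      have vH: "?v \<in> ?H k - ?ps k" using vA cl by simp
      have hi0: "heap_inv (?H k) (?ps k) (?tb k + 2) ab ?t0"
        by (rule heap_inv_mono[OF I(3)]) auto
      have ne0: "?H k - ?ps k \<noteq> {}" using vH by blast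
      have cv0: "const_vars ?t0" using cv I(8) by (simp add: const_vars_def frame_def)
      let ?rest = "Minus 11 42 1 ;; Put 11 22 11 ;; Plus 22 22 1 ;;
        Put 3 11 0 ;; Get 23 1 11 ;;
        Plus 12 11 1 ;; Get 13 0 12 ;; Plus 12 12 1 ;; Get 14 0 12 ;;
        remove_code"
      have sumd: "(\<Sum>x\<in>?ps (Suc k). deg x) = deg ?v + (\<Sum>x\<in>?ps k. deg x)"
        unfolding ps' using vA by simp
      have rm: "wp M b q remove_code I t2"
        if t2: "vars t2 13 = off ?v" "vars t2 14 = off (Suc ?v)" "vars t2 23 = arr t 1 ?v"
          "vars t2 22 = k + 1" "\<And>r. r \<notin> ?V \<Longrightarrow> vars t2 r = vars t r"
          "\<And>r. r \<notin> {3, 8, 10, 11} \<Longrightarrow> arr t2 r = arr t r" "arr t2 3 = (arr t 3)(?v := 0)"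
          "arr t2 11 = (arr t 11)(k := ?v)"
          "heap_inv (?H k) (?ps (Suc k)) (?tb k + 50) ab t2" for t2
      proof (rule wp_mono[OF wp_remove[where A = "?A k" and v = ?v and ps = "?ps (Suc k)" and tb = "?tb k + 50" and ab = ab]])
        show "?A k \<subseteq> {..<n}" by auto
        show "?v \<in> ?A k" "miss E (?A k) ?v = {}" by fact+
        show "{..<n} - ?ps (Suc k) = ?A k - {?v}" by (rule A')
        show "vars t2 23 = card (nb E (?A k) ?v)" using t2(3) I(4) vA by (simp add: degrees_on_def)
        show "const_vars t2" using t2(5)[of 0] t2(5)[of 1] cv0 by (simp add: const_vars_def)
        show "raw_ok t2" using raw t2(6)[of 0] frame_arr[OF I(8), of 0] by (simp add: raw_ok_def)
        show "vars t2 13 = off ?v" "vars t2 14 = off (Suc ?v)" by fact+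
        show "degrees_on (?A k - {?v}) (\<lambda>_. ?A k) t2" using I(4) t2(6)[of 1] by (simp add: degrees_on_def)
        show "flaws_on (?A k - {?v}) (\<lambda>_. ?A k) t2" using I(5) t2(6)[of 2] by (simp add: flaws_on_def)
        show "marks (?A k - {?v}) t2" using I(6) t2(7) by (auto simp: marks_def)
        have "?ps (Suc k) \<union> {u \<in> ?A k - {?v}. miss E (?A k) u = {}} = ?H k"
          unfolding ps' using vA cl by auto
        then show "heap_inv (?ps (Suc k) \<union> {u \<in> ?A k - {?v}. miss E (?A k) u = {}})
            (?ps (Suc k)) (?tb k + 50) ab t2" using t2(9) by simp
        fix t3
        assume "degrees_on (?A k - {?v}) (\<lambda>_. ?A k - {?v}) t3 \<and>
          flaws_on (?A k - {?v}) (\<lambda>_. ?A k - {?v}) t3 \<and>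
          heap_inv (?ps (Suc k) \<union> {u \<in> ?A k - {?v}. miss E (?A k - {?v}) u = {}}) (?ps (Suc k))
            (?tb k + 50 + 60 * deg ?v + 1) ab t3 \<and>
          frame ({12, 13, 15, 16, 17, 21} \<union> {30..41}) {1, 2, 7, 8, 9, 10} t2 t3"
        then have t3: "degrees_on (?A (Suc k)) (\<lambda>_. ?A (Suc k)) t3"
          "flaws_on (?A (Suc k)) (\<lambda>_. ?A (Suc k)) t3"
          "heap_inv (?H (Suc k)) (?ps (Suc k)) (?tb k + 50 + 60 * deg ?v + 1) ab t3"
          "frame ({12, 13, 15, 16, 17, 21} \<union> {30..41}) {1, 2, 7, 8, 9, 10} t2 t3"
          unfolding A' by blast+
        show "I t3"
          unfolding I_def
        proof (rule exI[of _ "Suc k"], intro conjI)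
          show "Suc k \<le> n" using kn by simp
          show "vars t3 22 = Suc k" using t3(4) t2(4) by (simp add: frame_def)
          show "heap_inv (?H (Suc k)) (?ps (Suc k)) (?tb (Suc k)) ab t3"
            unfolding sumd by (rule heap_inv_mono[OF t3(3)]) auto
          have "arr t3 3 = (arr t 3)(?v := 0)" using t3(4) t2(7) by (simp add: frame_def)
          then show "marks (?A (Suc k)) t3" unfolding A' using I(6) by (auto simp: marks_def)
          have "arr t3 11 = (arr t 11)(k := ?v)" using t3(4) t2(8) by (simp add: frame_def)
          then show "\<forall>i<Suc k. arr t3 11 i = \<pi> ! i" using I(7) by (auto simp: less_Suc_eq)
          have "vars t3 r = vars s r" if "r \<notin> ?V" for r
          proof -
            have "vars t3 r = vars t2 r" using t3(4) that by (intro frame_vars[OF t3(4)]) auto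
            then show ?thesis using t2(5)[OF that] frame_vars[OF I(8) that] by simp
          qed
          moreover have "arr t3 r = arr s r" if "r \<notin> ?AR" for r
          proof -
            have "arr t3 r = arr t2 r" using that by (intro frame_arr[OF t3(4)]) auto
            then show ?thesis using t2(6)[of r] that frame_arr[OF I(8) that] by simp
          qed
          ultimately show "frame ?V ?AR s t3" by (simp add: frame_def)
        qed (use t3 in auto)
      qed
      have "wp M b q pop_code (wp M b q ?rest I) ?t0"
      proof (rule wp_mono[OF wp_heap_pop[OF hi0 ne0 cv0]])
        fix t1
        assume "\<exists>v. vars t1 42 = Suc v \<and> v \<in> ?H k - ?ps k \<and>
          (\<forall>u \<in> ?H k - ?ps k. rk (Suc v) \<le> rk (Suc u)) \<and>
          heap_inv (?H k) (insert v (?ps k)) (?tb k + 2) ab t1 \<and>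
          frame ({34..37} \<union> {39..42}) {8, 10} ?t0 t1"
        then obtain w where w: "vars t1 42 = Suc w" "w \<in> ?H k - ?ps k"
          "rk (Suc w) \<le> rk (Suc ?v)" "heap_inv (?H k) (insert w (?ps k)) (?tb k + 2) ab t1"
          "frame ({34..37} \<union> {39..42}) {8, 10} ?t0 t1" using vH by blast
        have "w < n" "w \<notin> ?ps k" using w(2) by auto
        then obtain j where j: "j < n" "\<pi> ! j = w" using pi(2,3) by (metis in_set_conv_nth lessThan_iff)
        have "j \<le> k" using w(3) rk[OF j(1)] rk[OF kn] j(2) by simp
        moreover have "\<not> j < k" using \<open>w \<notin> ?ps k\<close> j kn pi(3) by (auto simp: in_set_conv_nth)
        ultimately have wv: "w = ?v" using j by simp
        have c0: "vars t1 0 = 0" "vars t1 1 = 1" "vars t1 22 = k"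
          using cv0 I(2) w(5) by (auto simp: const_vars_def frame_def)
        have a0: "arr t1 0 = arr s 0" "arr t1 1 = arr t 1" "arr t1 3 = arr t 3" "arr t1 11 = arr t 11"
          using w(5) I(8) by (auto simp: frame_def)
        have offs: "arr t1 0 (?v + 1) = off ?v" "arr t1 0 (?v + 1 + 1) = off (Suc ?v)"
          "?v + 1 < M" "?v + 1 + 1 < M" "?v + 1 < b" "?v + 1 + 1 < b" "k + 1 < M"
          using raw vn kn a0 b_bounds M_bounds by (auto simp: raw_ok_def)
        have rm': "wp M b q remove_code I t2"
          if t2: "vars t2 13 = off ?v" "vars t2 14 = off (Suc ?v)" "vars t2 23 = arr t 1 ?v"
            "vars t2 22 = k + 1" "\<And>r. r \<notin> {11, 12, 13, 14, 22, 23} \<Longrightarrow> vars t2 r = vars t1 r"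
            "arr t2 = (arr t1)(11 := (arr t1 11)(k := ?v), 3 := (arr t1 3)(?v := 0))"
            "time t2 \<le> time t1 + 48" "asked t2 = asked t1" for t2
        proof (rule rm)
          show "vars t2 r = vars t r" if "r \<notin> ?V" for r
            using t2(5)[of r] that frame_vars[OF w(5), of r] by auto
          show "arr t2 r = arr t r" if "r \<notin> {3, 8, 10, 11}" for r
            using t2(6) that frame_arr[OF w(5), of r] by auto
          show "arr t2 3 = (arr t 3)(?v := 0)" "arr t2 11 = (arr t 11)(k := ?v)"
            using t2(6) a0 by auto
          show "heap_inv (?H k) (?ps (Suc k)) (?tb k + 50) ab t2"
            unfolding ps' by (rule heap_inv_mono[OF w(4)[unfolded wv]]) (use t2(6-8) in auto)
        qed fact+
        show "wp M b q ?rest I t1"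
          using c0 w(1) wv offs a0(2)
          by (simp add: wp_simps del: One_nat_def) (rule rm'; simp)
      qed
      then show ?thesis by (simp only: wp_Seq)
    qed
  qed
qed

text \<open>The output overwrites cells 1 to \<open>n\<close> of the input, which the elimination
  has finished reading. There is room because \<open>n + 2 <= b\<close>.\<close>

lemma wp_copy:
  assumes cv: "const_vars s" and v2: "vars s 2 = n" and v24: "vars s 24 = 0"
    and out: "\<And>i. i < n \<Longrightarrow> arr s 11 i = \<pi> ! i"
  shows "wp M b q copy_code (\<lambda>s'. (\<forall>i<n. arr s' 0 (Suc i) = \<pi> ! i) \<and>
      time s' \<le> time s + 20 * n + 1 \<and> asked s' = asked s) s"
    (is "wp M b q copy_code ?Q s")
proof -
  define I where "I = (\<lambda>t. vars t 24 \<le> n \<and> (\<forall>i<vars t 24. arr t 0 (Suc i) = \<pi> ! i) \<and>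
    time t \<le> time s + 20 * vars t 24 \<and> asked t = asked s \<and> frame {12, 24} {0} s t)"
  show ?thesis
    unfolding copy_code_def
  proof (rule wp_While[where I = I and B = "time s + 20 * n"])
    show "I s" using v24 by (simp add: I_def)
    show "time t \<le> time s + 20 * n" if "I t" for t using that unfolding I_def by linarith
    show "?Q (t\<lparr>time := time t + 1\<rparr>)" if "I t" "vars t 24 = vars t 2" for t
    proof -
      have I: "\<forall>i<vars t 24. arr t 0 (Suc i) = \<pi> ! i" "time t \<le> time s + 20 * vars t 24"
        "asked t = asked s" "frame {12, 24} {0} s t" using that(1) unfolding I_def by blast+
      then show ?thesis using that(2) v2 by (simp add: frame_def)
    qed
    show "wp M b q (Get 12 11 24 ;; Plus 24 24 1 ;; Put 0 24 12) I (t\<lparr>time := time t + 2\<rparr>)"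
      if "I t" "vars t 24 \<noteq> vars t 2" for t
    proof -
      have I: "vars t 24 \<le> n" "\<forall>i<vars t 24. arr t 0 (Suc i) = \<pi> ! i" "time t \<le> time s + 20 * vars t 24"
        "asked t = asked s" "frame {12, 24} {0} s t" using that(1) unfolding I_def by blast+
      obtain k where k: "vars t 24 = k" by simp
      have c0: "vars t 0 = 0" "vars t 1 = 1" "vars t 2 = n" "arr t 11 = arr s 11"
        using cv v2 I(5) by (auto simp: const_vars_def frame_def)
      have kn: "k < n" using that(2) I(1) k c0 by simp
      have bd: "k + 1 < M" "k + 1 < b" using kn M_bounds b_bounds by auto
      have "I t'" if t': "vars t' 24 = k + 1" "\<And>r. r \<notin> {12, 24} \<Longrightarrow> vars t' r = vars t r"
        "arr t' = (arr t)(0 := (arr t 0)(k + 1 := \<pi> ! k))" "time t' \<le> time t + 20" "asked t' = asked t" for t'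
        using t' I k kn unfolding I_def by (auto simp: frame_def less_Suc_eq)
      then show ?thesis using c0 k bd out[OF kn]
        by (simp add: wp_simps del: One_nat_def)
    qed
  qed
qed

end

text \<open>Entry \<open>e\<close> stands for vertex \<open>e - 1\<close> and is followed by entry
  \<open>e - 1\<close>, so arrays 5 and 6 receive the same number; 0 is null. The list starting at
  \<open>n\<close> becomes bucket 0.\<close>

definition fill_bucket_code :: com where
  "fill_bucket_code =
    WhileNeq 4 2 (Plus 5 4 1 ;; Put 5 5 4 ;; Put 6 5 4 ;; Plus 4 5 0) ;;
    Put 4 0 2 ;; Plus 7 2 1"

lemma lseg_rev_upt: "\<forall>e. 0 < e \<and> e \<le> k \<longrightarrow> nx e = e - 1 \<Longrightarrow> lseg nx k (rev [1..<Suc k]) 0"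
proof (induction k)
  case (Suc k)
  then have "lseg nx k (rev [1..<Suc k]) 0" by simp
  then show ?case using Suc.prems by simp
qed simp

context chordal_input
begin

lemma wp_fill_bucket:
  assumes cv: "const_vars s" and v2: "vars s 2 = n" and v4: "vars s 4 = 0"
    and a4: "\<And>i. arr s 4 i = 0"
  shows "wp M b q fill_bucket_code (\<lambda>s'. \<exists>L. buckets {} (\<lambda>_. {}) L 0 s' \<and>
      (\<Sum>i\<le>n. length (L i)) \<le> n \<and> vars s' 7 = n + 1 \<and> frame {4, 5, 7} {4, 5, 6} s s' \<and>
      time s' \<le> time s + 20 * n + 8 \<and> asked s' = asked s) s"
    (is "wp M b q fill_bucket_code ?Q s")
proof -
  define I where "I = (\<lambda>t. vars t 4 \<le> n \<and>
    (\<forall>e. 0 < e \<and> e \<le> vars t 4 \<longrightarrow> arr t 5 e = e - 1 \<and> arr t 6 e = e - 1) \<and>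
    time t \<le> time s + 20 * vars t 4 \<and> asked t = asked s \<and> frame {4, 5} {5, 6} s t)"
  have "wp M b q (WhileNeq 4 2 (Plus 5 4 1 ;; Put 5 5 4 ;; Put 6 5 4 ;; Plus 4 5 0))
      (wp M b q (Put 4 0 2 ;; Plus 7 2 1) ?Q) s"
  proof (rule wp_While[where I = I and B = "time s + 20 * n"])
    show "I s" using v4 by (simp add: I_def)
    show "time t \<le> time s + 20 * n" if "I t" for t using that unfolding I_def by linarith
    show "wp M b q (Plus 5 4 1 ;; Put 5 5 4 ;; Put 6 5 4 ;; Plus 4 5 0) I (t\<lparr>time := time t + 2\<rparr>)"
      if "I t" "vars t 4 \<noteq> vars t 2" for t
    proof -
      have I: "vars t 4 \<le> n"
        "\<forall>e. 0 < e \<and> e \<le> vars t 4 \<longrightarrow> arr t 5 e = e - 1 \<and> arr t 6 e = e - 1"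
        "time t \<le> time s + 20 * vars t 4" "asked t = asked s" "frame {4, 5} {5, 6} s t"
        using that(1) unfolding I_def by blast+
      obtain i where i: "vars t 4 = i" by simp
      have c0: "vars t 0 = 0" "vars t 1 = 1" "vars t 2 = n"
        using cv v2 I(5) by (auto simp: const_vars_def frame_def)
      have ln: "i < n" using that(2) I(1) i c0 by simp
      have bd: "i + 1 < M" using ln M_bounds by simp
      have "I t'" if t': "vars t' 4 = i + 1" "\<And>r. r \<notin> {4, 5} \<Longrightarrow> vars t' r = vars t r"
        "arr t' = (arr t)(5 := (arr t 5)(i + 1 := i), 6 := (arr t 6)(i + 1 := i))"
        "time t' \<le> time t + 20" "asked t' = asked t" for t'
        using t' I i ln unfolding I_def by (auto simp: frame_def le_Suc_eq)
      then show ?thesis using c0 i bd by (simp add: wp_simps del: One_nat_def)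
    qed
    show "wp M b q (Put 4 0 2 ;; Plus 7 2 1) ?Q (t\<lparr>time := time t + 1\<rparr>)"
      if "I t" "vars t 4 = vars t 2" for t
    proof -
      have I: "\<forall>e. 0 < e \<and> e \<le> vars t 4 \<longrightarrow> arr t 5 e = e - 1 \<and> arr t 6 e = e - 1"
        "time t \<le> time s + 20 * vars t 4" "asked t = asked s" "frame {4, 5} {5, 6} s t"
        using that(1) unfolding I_def by blast+
      have c0: "vars t 0 = 0" "vars t 1 = 1" "vars t 2 = n"
        using cv v2 I(4) by (auto simp: const_vars_def frame_def)
      have v4n: "vars t 4 = n" using that(2) c0 by simp
      let ?L = "\<lambda>c. if c = 0 then rev [1..<Suc n] else []"
      have Q: "?Q t'" if t': "vars t' 7 = n + 1" "\<And>r. r \<noteq> 7 \<Longrightarrow> vars t' r = vars t r"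
        "arr t' = (arr t)(4 := (arr t 4)(0 := n))" "time t' \<le> time t + 8" "asked t' = asked t" for t'
      proof (rule exI[of _ ?L], intro conjI)
        have a4': "arr t 4 i = 0" for i using a4 I(4) by (simp add: frame_def)
        have "lseg (arr t 6) n (rev [1..<Suc n]) 0"
          by (rule lseg_rev_upt) (use I(1) v4n in auto)
        moreover have "u \<in> arr t 5 ` set (rev [1..<Suc n])" if "u < n" for u
          using I(1) v4n that by (intro image_eqI[of _ _ "Suc u"]) auto
        moreover have "arr t 5 e < n" if "e \<in> set (rev [1..<Suc n])" for e
          using I(1) v4n that by auto
        moreover have "card (nb E {} u) = 0" for u by (simp add: nb_def)
        ultimately show "buckets {} (\<lambda>_. {}) ?L 0 t'"
          using t' a4' by (auto simp: buckets_def simp del: upt_Suc)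
        have "(\<Sum>i\<le>n. length (?L i)) = length (?L 0)"
          by (subst sum.remove[of _ 0]) auto
        then show "(\<Sum>i\<le>n. length (?L i)) \<le> n" by simp
      qed (use t' I v4n in \<open>auto simp: frame_def\<close>)
      have bd: "n + 1 < M" using M_bounds by simp
      obtain Q where Qdef: "Q = ?Q" by blast
      have Q': "Q t'" if "vars t' 7 = n + 1" "\<And>r. r \<noteq> 7 \<Longrightarrow> vars t' r = vars t r"
        "arr t' = (arr t)(4 := (arr t 4)(0 := n))" "time t' \<le> time t + 8" "asked t' = asked t" for t'
        unfolding Qdef by (rule Q) (fact that)+
      have "wp M b q (Put 4 0 2 ;; Plus 7 2 1) Q (t\<lparr>time := time t + 1\<rparr>)"
        using c0 bd by (simp add: wp_simps del: One_nat_def) (rule Q'; simp)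
      then show ?thesis unfolding Qdef .
    qed
  qed
  then show ?thesis unfolding fill_bucket_code_def by (simp only: wp_Seq)
qed

end

text \<open>For a single vertex log |P| is 0 and no query is allowed, while the general bound
  \<open>4 * n + 2 * S\<close> is positive. The branch outputs the vertex 0 directly.\<close>

definition main_code :: com where
  "main_code =
    Get 2 0 0 ;; Cst 1 1 ;;
    IfEq 2 1 (Put 0 1 0)
      (fill_bucket_code ;; mcs_code ;; fill_heap_code ;; eliminate_code ;; copy_code)"

context elimination_input
begin

lemma wp_main:
  assumes v: "\<And>r. vars s r = 0" and raw: "raw_ok s" and a: "\<And>k i. 1 \<le> k \<Longrightarrow> arr s k i = 0"
    and t0: "time s = 0" "asked s = 0"
  shows "wp M b q main_code (\<lambda>s'. (\<forall>i<n. arr s' 0 (Suc i) = \<pi> ! i) \<and>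
      (\<exists>S. time s' \<le> 1000 * (n + m + S + 1) \<and> asked s' \<le> 4 * n + 2 * S \<and> (n = 1 \<longrightarrow> asked s' = 0) \<and>
        2 ^ S \<le> card {vs. elim E {..<n} vs} * 4 ^ n)) s"
    (is "wp M b q main_code ?Q s")
proof -
  have Mb: "1 < M" "0 < b" "1 < b" using M_bounds b_bounds by auto
  have r0: "arr s 0 0 = n" using raw by (simp add: raw_ok_def)
  let ?s1 = "s\<lparr>vars := (vars s)(2 := n, 1 := 1), time := 2\<rparr>"
  have s1: "vars ?s1 0 = 0" "vars ?s1 1 = 1" "vars ?s1 2 = n" using v by simp_all
  have main: "wp M b q (fill_bucket_code ;; mcs_code ;; fill_heap_code ;; eliminate_code ;; copy_code) ?Q t"
    if t: "vars t = (vars s)(2 := n, 1 := 1)" "arr t = arr s" "time t = 4" "asked t = 0" and n1: "n \<noteq> 1" for t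
  proof -
    have cvt: "const_vars t" using t v by (simp add: const_vars_def)
    have 1: "wp M b q fill_bucket_code (\<lambda>s'. \<exists>L. buckets {} (\<lambda>_. {}) L 0 s' \<and>
      (\<Sum>i\<le>n. length (L i)) \<le> n \<and> vars s' 7 = n + 1 \<and> frame {4, 5, 7} {4, 5, 6} t s' \<and>
      time s' \<le> time t + 20 * n + 8 \<and> asked s' = asked t) t"
      by (rule wp_fill_bucket) (use cvt t v a in auto)
    have 2: "wp M b q (mcs_code ;; fill_heap_code ;; eliminate_code ;; copy_code) ?Q t1"
      if "\<exists>L. buckets {} (\<lambda>_. {}) L 0 t1 \<and>
      (\<Sum>i\<le>n. length (L i)) \<le> n \<and> vars t1 7 = n + 1 \<and> frame {4, 5, 7} {4, 5, 6} t t1 \<and>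
      time t1 \<le> time t + 20 * n + 8 \<and> asked t1 = asked t" for t1
    proof -
      from that obtain L where L: "buckets {} (\<lambda>_. {}) L 0 t1"
        "(\<Sum>i\<le>n. length (L i)) \<le> n" "vars t1 7 = n + 1" "frame {4, 5, 7} {4, 5, 6} t t1"
        "time t1 \<le> time t + 20 * n + 8" "asked t1 = asked t" by blast
      have tv: "vars t1 r = vars t r" if "r \<notin> {4, 5, 7}" for r using frame_vars[OF L(4) that] .
      have ta: "arr t1 k = arr s k" if "k \<notin> {4, 5, 6}" for k using frame_arr[OF L(4) that] t(2) by simp
      have cv1: "const_vars t1" using const_vars_frame[OF L(4)] cvt by simp
      have raw1: "raw_ok t1" using raw ta[of 0] by (simp add: raw_ok_def)
      have mcs: "wp M b q mcs_code (\<lambda>s'. degrees (\<lambda>_. {..<n}) s' \<and> flaws {..<n} (\<lambda>_. {..<n}) s' \<and>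
        marks {..<n} s' \<and> frame {7..16} {1..6} t1 s' \<and>
        time s' \<le> time t1 + 180 * n + 240 * m + 2 \<and> asked s' = asked t1) t1"
      proof (rule wp_mcs[OF cv1 raw1 _ _ L(3) _ _ _ L(1,2)])
        show "vars t1 2 = n" "vars t1 8 = 0" using tv[of 2] tv[of 8] t(1) v by simp_all
        show "degrees (\<lambda>_. {}) t1" "flaws {} (\<lambda>_. {}) t1" "marks {} t1"
          using ta[of 1] ta[of 2] ta[of 3] a by (simp_all add: degrees_def flaws_def marks_def nb_def)
      qed
      have 3: "wp M b q (fill_heap_code ;; eliminate_code ;; copy_code) ?Q t2"
        if t2: "degrees (\<lambda>_. {..<n}) t2 \<and> flaws {..<n} (\<lambda>_. {..<n}) t2 \<and>
        marks {..<n} t2 \<and> frame {7..16} {1..6} t1 t2 \<and>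
        time t2 \<le> time t1 + 180 * n + 240 * m + 2 \<and> asked t2 = asked t1" for t2
      proof -
        have fr2: "frame {7..16} {1..6} t1 t2" using t2 by blast
        have cv2: "const_vars t2" by (rule const_vars_frame[OF fr2 _ _ cv1]) auto
        have t2v: "vars t2 2 = n" "vars t2 20 = 0" "vars t2 22 = 0" "vars t2 24 = 0"
          using frame_vars[OF fr2] tv t(1) v by auto
        have t2a: "arr t2 k = arr s k" if "k \<notin> {1..6}" for k
          using frame_arr[OF fr2 that] ta[of k] that by auto
        have hi2: "heap_inv {} {} (time t2) 0 t2"
          unfolding heap_inv_def
        proof (rule exI[of _ "[]"], rule exI[of _ "\<lambda>_. 0"], rule exI[of _ "\<lambda>_. 0"], rule exI[of _ "\<lambda>_. 0"], intro conjI)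
          show "heap_repr rk t2 []"
            using t2a[of 8] t2a[of 9] t2a[of 10] a
            by (simp add: heap_repr_def levels_def run_at_def bit_at_def)
        qed (use t2 L t in \<open>auto simp: heap_sorted_def ones_def\<close>)
        have fl2: "flaws {..<n} (\<lambda>_. {..<n}) t2" and mk2: "marks {..<n} t2"
          and dg2: "degrees (\<lambda>_. {..<n}) t2" using t2 by blast+
        have 4: "wp M b q (eliminate_code ;; copy_code) ?Q t3"
          if t3: "heap_inv {v. v < n \<and> miss E {..<n} v = {}} {} (time t2 + 20 * n + 1) 0 t3 \<and>
            frame ({12, 20, 21} \<union> {30..41}) {7, 8, 9, 10} t2 t3" for t3
        proof -
          have fr3: "frame ({12, 20, 21} \<union> {30..41}) {7, 8, 9, 10} t2 t3" using t3 by blast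
          have cv3: "const_vars t3" by (rule const_vars_frame[OF fr3 _ _ cv2]) auto
          have t3v: "vars t3 2 = n" "vars t3 22 = 0" "vars t3 24 = 0"
            using frame_vars[OF fr3] t2v by auto
          have t3a: "arr t3 0 = arr s 0" "arr t3 1 = arr t2 1" "arr t3 2 = arr t2 2" "arr t3 3 = arr t2 3"
            using frame_arr[OF fr3] t2a[of 0] by auto
          have elm: "wp M b q eliminate_code (\<lambda>s'.
            heap_inv {..<n} {..<n} (time t2 + 20 * n + 1 + 120 * m + 60 * n + 1) 0 s' \<and>
            (\<forall>i<n. arr s' 11 i = \<pi> ! i) \<and>
            frame ({11..17} \<union> {21, 22, 23} \<union> {30..42}) {1, 2, 3, 7, 8, 9, 10, 11} t3 s') t3"
          proof (rule wp_eliminate[OF cv3 _ t3v(1,2)])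
            show "raw_ok t3" using raw t3a by (simp add: raw_ok_def)
            show "degrees_on {..<n} (\<lambda>_. {..<n}) t3" using dg2 t3a by (simp add: degrees_on_def degrees_def)
            show "flaws_on {..<n} (\<lambda>_. {..<n}) t3" using fl2 t3a by (simp add: flaws_on_def flaws_def)
            show "marks {..<n} t3" using mk2 t3a by (simp add: marks_def)
          qed (use t3 in blast)
          have 5: "wp M b q copy_code ?Q t4"
            if t4: "heap_inv {..<n} {..<n} (time t2 + 20 * n + 1 + 120 * m + 60 * n + 1) 0 t4 \<and>
            (\<forall>i<n. arr t4 11 i = \<pi> ! i) \<and>
            frame ({11..17} \<union> {21, 22, 23} \<union> {30..42}) {1, 2, 3, 7, 8, 9, 10, 11} t3 t4" for t4
          proof -
            have fr4: "frame ({11..17} \<union> {21, 22, 23} \<union> {30..42}) {1, 2, 3, 7, 8, 9, 10, 11} t3 t4"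
              using t4 by blast
            have cv4: "const_vars t4" by (rule const_vars_frame[OF fr4 _ _ cv3]) auto
            have t4v: "vars t4 2 = n" "vars t4 24 = 0"
              using frame_vars[OF fr4] t3v by auto
            obtain S where S: "time t4 \<le> time t2 + 20 * n + 1 + 120 * m + 60 * n + 1 + 460 * n + 120 * S"
              "asked t4 \<le> 0 + 4 * n + 2 * S" "2 ^ S \<le> card {vs. elim E {..<n} vs} * 4 ^ n"
              using heap_inv_final t4 by blast
            show ?thesis
            proof (rule wp_mono[OF wp_copy[OF cv4 t4v]])
              show "arr t4 11 i = \<pi> ! i" if "i < n" for i using t4 that by blast
              fix t5 :: state assume t5: "(\<forall>i<n. arr t5 0 (Suc i) = \<pi> ! i) \<and>
                time t5 \<le> time t4 + 20 * n + 1 \<and> asked t5 = asked t4"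
              have "time t5 \<le> 1000 * (n + m + S + 1)"
                using t5 S(1) t2 L(5) t(3) by simp
              then show "?Q t5" using t5 S n1 by auto
            qed
          qed
          show ?thesis unfolding wp_Seq[of _ _ _ eliminate_code] by (rule wp_mono[OF elm 5])
        qed
        show ?thesis unfolding wp_Seq[of _ _ _ fill_heap_code]
          by (rule wp_mono[OF wp_fill_heap[OF cv2 t2v(1,2) fl2 hi2] 4])
      qed
      show ?thesis unfolding wp_Seq[of _ _ _ mcs_code] by (rule wp_mono[OF mcs 3])
    qed
    show ?thesis unfolding wp_Seq[of _ _ _ fill_bucket_code] by (rule wp_mono[OF 1 2])
  qed
  show ?thesis
  proof (cases "n = 1")
    case True
    have "\<pi> ! 0 = 0" using pi(2,3) True nth_mem[of 0 \<pi>] by simp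
    moreover have "elim E {..<n} \<pi>" by (rule elim')
    then have "card {vs. elim E {..<n} vs} \<noteq> 0" using finite_elim[of "{..<n}" E] by auto
    ultimately show ?thesis
      unfolding main_code_def using True v r0 Mb t0
      by (simp add: wp_simps) (intro exI[of _ 0], simp)
  next
    case False
    obtain Q where Qdef: "Q = ?Q" by blast
    note main' = main[folded Qdef]
    have "wp M b q main_code Q s"
      unfolding main_code_def using False v r0 Mb t0
      by (simp add: wp_Seq[of _ _ _ "Get _ _ _"] wp_Seq[of _ _ _ "Cst _ _"] wp_IfEq wp_Cst wp_Get access_cost_def
          del: One_nat_def) (rule main'; simp)
    then show ?thesis unfolding Qdef .
  qed
qed

end

section \<open>The program\<close>

text \<open>Cell \<open>n + 1\<close> of the input stores the end of the last adjacency list, which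
  is the input length \<open>b\<close>; the prelude loads it into register 1. The last instruction
  announces the output address 1.\<close>

definition sorting_program :: program where
  "sorting_program =
    [Load 2 0, Const 0 1, Arith Add 2 2 0, Load 1 2] @ comp 4 main_code @ [Const 0 1]"

lemma nth_concat_offset:
  "v < length xss \<Longrightarrow> k < length (xss ! v) \<Longrightarrow>
    concat xss ! (sum_list (map length (take v xss)) + k) = xss ! v ! k"
proof (induction xss arbitrary: v)
  case (Cons xs xss)
  then show ?case by (cases v) (auto simp: nth_append)
qed simp

context chordal_input
begin

definition start :: state where
  "start = \<lparr>vars = \<lambda>_. 0,
     arr = (\<lambda>k i. if k = 0 \<and> i < length (graph_input adj) then graph_input adj ! i else 0),
     asked = 0, time = 0\<rparr>"

lemma length_input: "length (graph_input adj) = b"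
  by (simp add: graph_input_def b_def off_def n_def length_concat)

lemma nth_input:
  "graph_input adj ! 0 = n"
  "v \<le> n \<Longrightarrow> graph_input adj ! Suc v = off v"
  "v < n \<Longrightarrow> k < deg v \<Longrightarrow> graph_input adj ! (off v + k) = adj ! v ! k"
proof -
  show "graph_input adj ! 0 = n" by (simp add: graph_input_def n_def)
  show "graph_input adj ! Suc v = off v" if "v \<le> n"
    using that by (simp add: graph_input_def nth_append off_def n_def del: upt_Suc)
  show "graph_input adj ! (off v + k) = adj ! v ! k" if "v < n" "k < deg v"
    using that nth_concat_offset[of v adj k]
    by (simp add: graph_input_def nth_append off_def n_def deg_def del: upt_Suc)
qed

lemma raw_ok_start: "raw_ok start"
  using nth_input off_less b_bounds by (auto simp: raw_ok_def start_def length_input)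

lemma input_less:
  assumes "i < b" shows "graph_input adj ! i < M"
proof -
  have "x < M" if "x \<in> set (graph_input adj)" for x
  proof -
    have "off v \<le> b" if "v \<le> n" for v
    proof -
      have "(\<Sum>u<v. deg u) \<le> (\<Sum>u<n. deg u)" using that by (intro sum_mono2) auto
      then show ?thesis using that by (simp add: b_def off_eq)
    qed
    moreover have "y < n" if "ys \<in> set adj" "y \<in> set ys" for y ys
    proof -
      obtain v where v: "v < length adj" "adj ! v = ys"
        using \<open>ys \<in> set adj\<close> unfolding in_set_conv_nth by blast
      then have "{y, v} \<in> E" using that(2) adj_iff[of v y] by (simp add: n_def)
      then show ?thesis using edge_less by simp
    qed
    moreover have "b < M" "n < M" using b_bounds M_bounds by auto
    moreover have "x = n \<or> (\<exists>v\<le>n. x = off v) \<or> (\<exists>ys\<in>set adj. x \<in> set ys)"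
      using that by (auto simp: graph_input_def n_def off_def less_Suc_eq_le simp del: upt_Suc)
    ultimately show ?thesis by (meson le_less_trans less_trans)
  qed
  then show ?thesis using assms length_input nth_mem by metis
qed

end

section \<open>From elimination orderings back to the graph notions, and the final estimates\<close>

lemma simplicial_del_verts:
  assumes "fin_graph G"
  shows "simplicial (del_verts G S) v \<longleftrightarrow>
    v \<in> verts G - S \<and> miss (edges G) (verts G - S) v = {}"
proof (cases "v \<in> verts G - S")
  case True
  have "neighborhood (del_verts G S) v = nb (edges G) (verts G - S) v"
    using assms True by (auto simp: neighborhood_def del_verts_def nb_def fin_graph_def)
  then show ?thesis
    using True by (auto simp: simplicial_def clique_def del_verts_def miss_def nb_def)
qed (auto simp: simplicial_def del_verts_def)

lemma peo_iff_elim: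
  assumes "fin_graph G"
  shows "peo G vs \<longleftrightarrow> elim (edges G) (verts G) vs"
proof -
  have "vs ! i \<in> verts G - set (take i vs)" if "distinct vs" "set vs = verts G" "i < length vs" for i
    using that nth_mem[of i vs] by (auto simp: in_set_conv_nth nth_eq_iff_index_eq)
  then show ?thesis
    unfolding peo_def elim_iff simplicial_del_verts[OF assms] by blast
qed

context elimination_input
begin

lemma sorting_program_correct:
  assumes w: "32 * M \<le> 2 ^ w"
  shows "\<exists>t S. halted sorting_program (run w q sorting_program (graph_input adj) t) \<and>
    out_words n (run w q sorting_program (graph_input adj) t) = \<pi> \<and>
    t \<le> 1000 * (n + m + S + 1) + 5 \<and>
    queries (run w q sorting_program (graph_input adj) t) \<le> 4 * n + 2 * S \<and>
    (n = 1 \<longrightarrow> queries (run w q sorting_program (graph_input adj) t) = 0) \<and>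
    2 ^ S \<le> card {vs. elim E {..<n} vs} * 4 ^ n"
proof -
  let ?P = sorting_program
  let ?c0 = "initial w (graph_input adj)"
  have bM: "b \<le> M" "1 \<le> M" "1 < M" "n + 1 < M" using b_bounds M_bounds by auto
  have tb: "take_bit w x = x" if "x < M" for x using that w by (intro take_bit_less) auto
  have "wp M b q main_code (\<lambda>s'. (\<forall>i<n. arr s' 0 (Suc i) = \<pi> ! i) \<and>
      (\<exists>S. time s' \<le> 1000 * (n + m + S + 1) \<and> asked s' \<le> 4 * n + 2 * S \<and> (n = 1 \<longrightarrow> asked s' = 0) \<and>
        2 ^ S \<le> card {vs. elim E {..<n} vs} * 4 ^ n)) start"
    by (rule wp_main) (use raw_ok_start in \<open>auto simp: start_def\<close>)
  then obtain s' S where ex: "exec M b q main_code start s'" and out: "\<forall>i<n. arr s' 0 (Suc i) = \<pi> ! i"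
    and S: "time s' \<le> 1000 * (n + m + S + 1)" "asked s' \<le> 4 * n + 2 * S" "n = 1 \<longrightarrow> asked s' = 0"
      "2 ^ S \<le> card {vs. elim E {..<n} vs} * 4 ^ n"
    unfolding wp_def by blast
  have mem: "mem ?c0 i = (if i < b then graph_input adj ! i else 0)" for i
    using input_less tb by (simp add: initial_def length_input)
  have m0: "mem ?c0 0 = n" "mem ?c0 (Suc n) = b"
    using nth_input(1) nth_input(2)[of n] b_bounds by (simp_all add: mem b_def[symmetric])
  let ?c1 = "set_reg w 2 n ?c0"
  let ?c2 = "set_reg w 0 1 ?c1"
  let ?c3 = "set_reg w 2 (n + 1) ?c2"
  let ?c4 = "set_reg w 1 b ?c3"
  have bits: "take_bit w n = n" "take_bit w b = b" "take_bit w (Suc 0) = Suc 0" "take_bit w (Suc n) = Suc n"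
    using bM b_bounds M_bounds by (intro tb, simp)+
  have w0: "w \<noteq> 0" using w bM by (cases w) auto
  have pc: "pc (set_reg w r v cf) = Suc (pc cf)" for r v cf by (simp add: set_reg_def)
  have pc0: "pc ?c0 = 0" and reg0: "reg ?c0 = (\<lambda>_. 0)" by (simp_all add: initial_def)
  have one: "reaches w q ?P (Suc 0) cf' cf''"
    if "pc cf' < length ?P" "exec_instr w q (?P ! pc cf') cf' = cf''" for cf' cf''
    using that by (simp add: reaches_Suc)
  have memset: "mem (set_reg w r v cf) = mem cf" for r v cf by (simp add: set_reg_def)
  have r1: "reaches w q ?P (Suc 0) ?c0 ?c1"
    by (rule one) (simp_all add: sorting_program_def pc pc0 reg0 m0)
  have r2: "reaches w q ?P (Suc 0) ?c1 ?c2"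
    by (rule one) (simp_all add: sorting_program_def pc pc0)
  have r3: "reaches w q ?P (Suc 0) ?c2 ?c3"
    by (rule one) (simp_all add: sorting_program_def pc pc0, simp add: set_reg_def bits w0)
  have r4: "reaches w q ?P (Suc 0) ?c3 ?c4"
    by (rule one) (simp_all add: sorting_program_def pc pc0 memset, simp add: set_reg_def bits w0 m0)
  have pre: "reaches w q ?P (Suc 0 + Suc 0 + Suc 0 + Suc 0) ?c0 ?c4"
    by (intro reaches_trans) (fact r1 r2 r3 r4)+
  have R: "repr M b start ?c4"
    unfolding repr_def
  proof (intro conjI allI impI)
    show "bounded M start" using bM input_less by (auto simp: bounded_def start_def length_input)
    show "mem ?c4 i = arr start 0 i" if "i < b" for i
      using that by (simp add: memset mem start_def length_input)
    show "mem ?c4 (b + 16 * i + k) = arr start k i" if "1 \<le> k \<and> k < 16 \<and> i < M" for k i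
      using that by (simp add: memset mem start_def)
  qed (simp_all add: set_reg_def reg0 start_def bits initial_def)
  have "pc ?c4 = 4" by (simp add: pc pc0)
  moreover have "code_at ?P 4 (comp 4 main_code)"
    using code_at_middle[of "[Load 2 0, Const 0 1, Arith Add 2 2 0, Load 1 2]" "comp 4 main_code" "[Const 0 1]"]
    by (simp add: sorting_program_def eval_nat_numeral)
  ultimately obtain c5 t where c5: "reaches w q ?P t ?c4 c5" "time s' = time start + t"
    "pc c5 = 4 + length (comp 4 main_code)" "repr M b s' c5"
    using comp_correct[OF ex w bM(1,2) R, of ?P] by auto
  let ?c6 = "set_reg w 0 1 c5"
  have "?P ! (4 + length (comp 4 main_code)) = Const 0 1"
    unfolding sorting_program_def by (simp add: nth_append)
  then have r6: "reaches w q ?P (Suc 0) c5 ?c6"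
    using c5(3) by (intro one) (simp_all add: sorting_program_def)
  let ?t = "Suc 0 + Suc 0 + Suc 0 + Suc 0 + t + Suc 0"
  have run: "run w q ?P (graph_input adj) ?t = ?c6"
    using reaches_trans[OF reaches_trans[OF pre c5(1)] r6] by (simp add: run_def reaches_def)
  have "halted ?P ?c6" using c5(3) by (simp add: halted_def pc sorting_program_def)
  moreover have "out_words n ?c6 = \<pi>"
  proof (rule nth_equalityI)
    show "length (out_words n ?c6) = length \<pi>" by (simp add: out_words_def pi)
    fix i assume "i < length (out_words n ?c6)"
    then have i: "i < n" by (simp add: out_words_def)
    then have "mem c5 (Suc i) = arr s' 0 (Suc i)" using c5(4) b_bounds by (auto simp: repr_def)
    then show "out_words n ?c6 ! i = \<pi> ! i" using i out by (simp add: out_words_def set_reg_def bits w0)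
  qed
  moreover have "queries ?c6 = asked s'" using c5(4) by (simp add: set_reg_def repr_def)
  moreover have "?t \<le> 1000 * (n + m + S + 1) + 5" using S(1) c5(2) by (simp add: start_def)
  ultimately show ?thesis
    using S(2-4) run by (intro exI[of _ ?t] exI[of _ S]) simp
qed

end

theorem mainTheorem5:
  shows "\<exists>(P :: program) (\<kappa> :: real) (C :: real).
    \<forall>(G :: nat graph) (adj :: nat list list) (\<pi> :: nat list) (n :: nat) (m :: nat) (w :: nat).
      fin_graph G \<and> chordal G \<and> adjacency_lists G adj \<and> peo G \<pi> \<and>
      n = card (verts G) \<and> m = card (edges G) \<and>
      real w \<ge> \<kappa> * log 2 (real (n + m + 2)) \<longrightarrow>
      (\<exists>t. halted P (run w (precedes \<pi>) P (graph_input adj) t) \<and>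
           out_words n (run w (precedes \<pi>) P (graph_input adj) t) = \<pi> \<and>
           real t \<le> C * (1 + real n + real m + log 2 (real (card {\<sigma>. peo G \<sigma>}))) \<and>
           real (queries (run w (precedes \<pi>) P (graph_input adj) t))
             \<le> C * log 2 (real (card {\<sigma>. peo G \<sigma>})))"
proof (rule exI[of _ sorting_program], rule exI[of _ 9], rule exI[of _ 3005], intro allI impI, elim conjE)
  fix G :: "nat graph" and adj :: "nat list list" and \<pi> :: "nat list" and n m w :: nat
  assume G: "fin_graph G" "chordal G" "adjacency_lists G adj" "peo G \<pi>"
    and n: "n = card (verts G)" and m: "m = card (edges G)"
    and w: "9 * log 2 (real (n + m + 2)) \<le> real w"
  let ?N = "n + m + 2"
  let ?M = "4 * ?N ^ 2"
  let ?p = "card {\<sigma>. peo G \<sigma>}"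
  have vG: "verts G = {..<length adj}" using G(3) by (simp add: adjacency_lists_def)
  have nl: "length adj = n" using vG n by simp
  interpret elimination_input G adj ?M \<pi>
    using G nl m peo_iff_elim[OF G(1)] by unfold_locales simp_all
  have nn: "chordal_input.n adj = n" and mm: "chordal_input.m G = m"
    using nl m by (simp_all add: n_def m_def)
  have "real ?N ^ 9 = 2 powr (9 * log 2 (real ?N))"
  proof -
    have "2 powr (9 * log 2 (real ?N)) = (2 powr log 2 (real ?N)) powr 9"
      unfolding powr_powr by (simp only: mult.commute)
    also have "2 powr log 2 (real ?N) = real ?N" by (rule powr_log_cancel) auto
    also have "real ?N powr 9 = real ?N ^ 9" by (rule powr_numeral) simp
    finally show ?thesis by simp
  qed
  also have "\<dots> \<le> 2 powr real w" using w by (intro powr_mono) auto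
  also have "\<dots> = 2 ^ w" by (simp add: powr_realpow)
  finally have "real (?N ^ 9) \<le> real (2 ^ w)" by simp
  then have Nw: "?N ^ 9 \<le> 2 ^ w" by (simp only: of_nat_le_iff)
  \<comment> \<open>Origin of the factor 9: \<open>32 * 4 = 2 ^ 7\<close>, and
    \<open>?N >= 2\<close> turns \<open>2 ^ 7\<close> into at most \<open>?N ^ 7\<close>.\<close>
  have "32 * ?M = 2 ^ 7 * ?N ^ 2" by simp
  also have "\<dots> \<le> ?N ^ 7 * ?N ^ 2" by (intro mult_le_mono power_mono) auto
  also have "\<dots> = ?N ^ 9" by (simp add: power_add[symmetric])
  finally have "32 * ?M \<le> 2 ^ w" using Nw by (rule le_trans)
  from sorting_program_correct[OF this] obtain t S where
    h: "halted sorting_program (run w (precedes \<pi>) sorting_program (graph_input adj) t)"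
      "out_words n (run w (precedes \<pi>) sorting_program (graph_input adj) t) = \<pi>"
    and t: "t \<le> 1000 * (n + m + S + 1) + 5"
    and qu: "queries (run w (precedes \<pi>) sorting_program (graph_input adj) t) \<le> 4 * n + 2 * S"
      "n = 1 \<longrightarrow> queries (run w (precedes \<pi>) sorting_program (graph_input adj) t) = 0"
    and S: "2 ^ S \<le> card {vs. elim (edges G) (verts G) vs} * 4 ^ n"
    unfolding nn mm by (auto simp: E_def vG nl)
  have pE: "?p = card {vs. elim (edges G) (verts G) vs}" using peo_iff_elim[OF G(1)] by simp
  have fin: "finite (verts G)" using vG by simp
  have pn: "2 ^ (n - 1) \<le> ?p"
    unfolding pE n using card_elim_ge[OF fin elim] .
  have p1: "1 \<le> ?p" using pn by (meson le_trans one_le_numeral one_le_power)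
  let ?L = "log 2 (real ?p)"
  have Ln: "real (n - 1) \<le> ?L"
  proof -
    have "real (n - 1) = log 2 (real (2 ^ (n - 1)))" by (simp add: log_nat_power)
    also have "real (2 ^ (n - 1)) \<le> real ?p" using pn by (simp only: of_nat_le_iff)
    then have "log 2 (real (2 ^ (n - 1))) \<le> ?L" by (intro log_mono) simp_all
    finally show ?thesis .
  qed
  have LS: "real S \<le> ?L + 2 * real n"
  proof -
    have "real S = log 2 (real (2 ^ S))" by (simp add: log_nat_power)
    also have "real (2 ^ S) \<le> real (?p * 4 ^ n)" using S unfolding pE by (simp only: of_nat_le_iff)
    then have "log 2 (real (2 ^ S)) \<le> log 2 (real (?p * 4 ^ n))" by (intro log_mono) simp_all
    also have "\<dots> = ?L + log 2 (4 ^ n)" using p1 by (simp add: log_mult)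
    also have "log 2 ((4::real) ^ n) = 2 * real n"
    proof -
      have "(4::real) ^ n = 2 ^ (2 * n)" by (simp add: power_mult)
      then show ?thesis by (simp add: log_nat_power)
    qed
    finally show ?thesis .
  qed
  have L0: "0 \<le> ?L" using Ln by (meson of_nat_0_le_iff order_trans)
  have "real t \<le> real (1000 * (n + m + S + 1) + 5)" using t by (simp only: of_nat_le_iff)
  \<comment> \<open>\<open>S <= ?L + 2 * n\<close> bounds \<open>1000 * (n + S)\<close> by
    \<open>3000 * n + 1000 * ?L\<close>; the additive constant is 1005.\<close>
  then have T: "real t \<le> 3005 * (1 + real n + real m + ?L)" using LS L0 by simp
  \<comment> \<open>For \<open>n\<close> other than 1, \<open>n <= 2 * (n - 1) <= 2 * ?L\<close>,
    which includes \<open>n = 0\<close> by truncated subtraction. For \<open>n = 1\<close> the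
    number \<open>?L\<close> may be 0, and the separate branch of the program asks nothing.\<close>
  have Q: "real (queries (run w (precedes \<pi>) sorting_program (graph_input adj) t)) \<le> 3005 * ?L"
  proof (cases "n = 1")
    case True
    then show ?thesis using qu(2) L0 by simp
  next
    case False
    then have "real n \<le> 2 * real (n - 1)" by (cases n) auto
    then have "real n \<le> 2 * ?L" using Ln by linarith
    moreover have "real (queries (run w (precedes \<pi>) sorting_program (graph_input adj) t)) \<le> real (4 * n + 2 * S)"
      using qu(1) by (simp only: of_nat_le_iff)
    ultimately show ?thesis using LS L0 by simp
  qed
  show "\<exists>t. halted sorting_program (run w (precedes \<pi>) sorting_program (graph_input adj) t) \<and>
           out_words n (run w (precedes \<pi>) sorting_program (graph_input adj) t) = \<pi> \<and>
           real t \<le> 3005 * (1 + real n + real m + log 2 (real (card {\<sigma>. peo G \<sigma>}))) \<and>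
           real (queries (run w (precedes \<pi>) sorting_program (graph_input adj) t))
             \<le> 3005 * log 2 (real (card {\<sigma>. peo G \<sigma>}))"
    using h T Q by blast
qed

end
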